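(* Let $n,r\ge1$ be integers, $\check n:=\frac{n-1}{2}$, $\xi_n^\pm(s):=1+\check n\pm s$, and let $s\in I_n=(-\check{n}-1,\check{n}+1)$. Then, with the explicit polynomials $f_{n,r}(s)$ and $\beta_{n,r}(s,l)$ defined in the context, $$\mathrm{Det}_{r}\bigl(L_n(s)\bigr)=\bigl(\check{n}^2-s^2\bigr)^{(\check{n}^2-s^2)^{r-1}\delta_{|s|<\check{n}}}\cdot e^{f_{n,r}(s)}\prod^{2r+n-2}_{l=1}\Bigl(\Gamma_l\bigl(\xi^{+}_n(s)\bigr)\Gamma_l\bigl(\xi^{-}_n(s)\bigr)\Bigr)^{\beta_{n,r}(s,l)}.$$ In particular (taking $s=\check n$ and $s=\frac12$ respectively), $$\mathrm{Det}_r(\Delta_n)=e^{f_{n,r}(\check n)}\prod_{l=1}^{2r+n-2}\bigl(\Gamma_l(n)\Gamma_l(1)\bigr)^{\beta_{n,r}(\check n,l)},$$ $$\mathrm{Det}_r(Y_n)=\Bigl(\frac{n(n-2)}{4}\Bigr)^{\left(\frac{n(n-2)}{4}\right)^{r-1}\delta_{n\ge3}}\cdot e^{f_{n,r}(\frac12)}\prod_{l=1}^{2r+n-2}\Bigl(\Gamma_l\bigl(\tfrac n2+1\bigr)\Gamma_l\bigl(\tfrac n2\bigr)\Bigr)^{\beta_{n,r}(\frac12,l)}.$$ Here $\delta_{|s|<\check n}:=1$ if $|s|<\check n$ and $0$ otherwise, and $\delta_{n\ge3}:=1$ if $n\ge3$ and $0$ otherwise.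
   Context: $\Delta_n$ denotes the (nonnegative) Laplacian on the unit sphere $S^n\subset\mathbb{R}^{n+1}$ with the standard metric: its eigenvalues are $k(k+n-1)$, $k=0,1,2,\dots$, where $0$ has multiplicity $1$ and, for $k\ge1$, $k(k+n-1)$ has multiplicity $\binom{n+k}{n}-\binom{n+k-2}{n}$. $L_n(s):=\Delta_n+\check{n}^2-s^2$, so $\Delta_n=L_n(\check n)$, and $Y_n:=\Delta_n+\frac{n(n-2)}{4}=L_n(\frac12)$. For an operator $A$ with real discrete spectrum, $\zeta_A(w):=\sum_{\lambda}\lambda^{-w}$, the sum being over all (strictly) positive eigenvalues counted with multiplicity, and $\mathrm{Det}_r(A):=\exp\bigl(-\frac{\partial}{\partial w}\zeta_A(w)\big|_{w=1-r}\bigr)$, using the meromorphic continuation of $\zeta_A$ (for $A=L_n(s)$, $s\in I_n$, it exists and is holomorphic at $w=1-r$). Barnes multiple gamma function: $\Gamma_l(z):=\exp\bigl(\frac{\partial}{\partial w}\zeta_l(w,z)\big|_{w=0}\bigr)$, where $\zeta_l(w,z):=\sum_{m_1,\dots,m_l\ge0}(m_1+\cdots+m_l+z)^{-w}$ ($\mathrm{Re}(w)>l$), continued meromorphically in $w$; it is positive for real $z>0$. Polynomials: $P_n(z):=\binom{z+\check n+1}{n}-\binom{z+\check n-1}{n}$; $T_{n,d}(s)$ ($0\le d\le n-1$) are the polynomials with $P_n(z)=\sum_{d=0}^{n-1}T_{n,d}(s)(z-s)^d$. With $(w)_j:=w(w+1)\cdots(w+j-1)$ and $H(a,b):=\sum_{j=a}^{b}\frac1j$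 ($=0$ if $a>b$), $$f_{n,r}(s):=\sum_{d=1}^{n-1}\frac{(-1)^{r+d}(r-1)!}{2(r+d)_r}H(r,r+d-1)(2s)^{2r+d-1}T_{n,d}(s).$$ For $r\le k\le 2r+n-2$, $$\alpha_{n,r}(s,k):=\sum_{d=\max\{0,k-2r+1\}}^{n-1}(-1)^{k+d}\binom{r+d-1}{k-r}(2s)^{2r+d-k-1}T_{n,d}(s).$$ For $1\le l\le k$, $c_{k,l}(z):=\sum_{j=0}^{l-1}\binom{l-1}{j}(-1)^j(z-j-1)^{k-1}$. Finally, for $1\le l\le 2r+n-2$, $$\beta_{n,r}(s,l):=\sum_{k=\max\{r,l\}}^{2r+n-2}c_{k,l}\bigl(\xi_n^+(s)\bigr)\alpha_{n,r}(s,k).$$ The prefactors are read as $1$ when $\delta_{|s|<\check n}=0$, respectively $\delta_{n\ge3}=0$; also $x^0=1$ for every $x$ in polynomial expressions. *)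

theory Defs
  imports
    "HOL-Complex_Analysis.Complex_Analysis"
    "HOL-Computational_Algebra.Polynomial"
    "HOL-Library.Function_Algebras"
begin

section \<open>The Laplacian on the unit sphere\<close>

text \<open>
  The unit sphere is \<open>sphere 0 1\<close> in a Euclidean space \<open>'a\<close>; the sphere has dimension \<open>n\<close> when
  \<open>DIM('a) = n + 1\<close>.  A function on the sphere is represented by a function on \<open>'a\<close> that vanishes
  off the sphere, so that distinct representatives are distinct functions on the sphere.
  Smoothness and differentiation on the sphere are expressed through \<open>\<lambda>x. f (sgn x)\<close>, the extension
  of \<open>f\<close> to the complement of the origin that is constant along rays (\<open>sgn x = x /\<^sub>R norm x\<close>).
\<close>

definition partial :: "'a::euclidean_space \<Rightarrow> ('a \<Rightarrow> real) \<Rightarrow> 'a \<Rightarrow> real" where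
  "partial b f x = frechet_derivative f (at x) b"

primrec Ck_on :: "nat \<Rightarrow> ('a::euclidean_space \<Rightarrow> real) \<Rightarrow> 'a set \<Rightarrow> bool" where
  "Ck_on 0 f S \<longleftrightarrow> continuous_on S f"
| "Ck_on (Suc k) f S \<longleftrightarrow> f differentiable_on S \<and> (\<forall>b\<in>Basis. Ck_on k (partial b f) S)"

definition smooth_sphere :: "('a::euclidean_space \<Rightarrow> real) set" where
  "smooth_sphere =
     {f. (\<forall>x. x \<notin> sphere 0 1 \<longrightarrow> f x = 0) \<and> (\<forall>k. Ck_on k (\<lambda>x. f (sgn x)) (- {0}))}"

text \<open>
  The extension along rays has vanishing radial derivative.  At a point of the sphere its Euclidean
  gradient is therefore the tangential gradient of \<open>f\<close> for the standard metric, and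
  the Euclidean divergence of the extension of a tangential field \<open>X\<close> is
  \<open>\<Sum>i. (D X e\<^sub>i) \<bullet> e\<^sub>i\<close> over an orthonormal basis of the tangent space, i.e. the divergence on
  the sphere.
\<close>

definition sphere_grad :: "('a::euclidean_space \<Rightarrow> real) \<Rightarrow> 'a \<Rightarrow> 'a" where
  "sphere_grad f x = (\<Sum>b\<in>Basis. partial b (\<lambda>y. f (sgn y)) x *\<^sub>R b)"

definition sphere_div :: "('a::euclidean_space \<Rightarrow> 'a) \<Rightarrow> 'a \<Rightarrow> real" where
  "sphere_div X x = (\<Sum>b\<in>Basis. partial b (\<lambda>y. X (sgn y) \<bullet> b) x)"

definition sphere_laplacian :: "('a::euclidean_space \<Rightarrow> real) \<Rightarrow> 'a \<Rightarrow> real" where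
  "sphere_laplacian f x = (if x \<in> sphere 0 1 then - sphere_div (sphere_grad f) x else 0)"

definition n_check :: "nat \<Rightarrow> real" where
  "n_check n = (real n - 1) / 2"

definition L_op :: "nat \<Rightarrow> real \<Rightarrow> ('a::euclidean_space \<Rightarrow> real) \<Rightarrow> 'a \<Rightarrow> real" where
  "L_op n s f x = sphere_laplacian f x + ((n_check n)\<^sup>2 - s\<^sup>2) * f x"

definition Y_op :: "nat \<Rightarrow> ('a::euclidean_space \<Rightarrow> real) \<Rightarrow> 'a \<Rightarrow> real" where
  "Y_op n f x = sphere_laplacian f x + real n * (real n - 2) / 4 * f x"


section \<open>Meromorphic continuation of series\<close>

text \<open>
  The meromorphic function on the whole plane that is given by the series \<open>\<Sum>i\<in>I. a i w\<close> on some
  right half-plane.  Requiring \<open>nicely_meromorphic_on\<close> fixes the values at removable singularities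
  (and sets the value at poles to 0), which makes the function unique.
\<close>

definition is_continued_sum ::
    "('i \<Rightarrow> complex \<Rightarrow> complex) \<Rightarrow> 'i set \<Rightarrow> (complex \<Rightarrow> complex) \<Rightarrow> bool" where
  "is_continued_sum a I g \<longleftrightarrow> g nicely_meromorphic_on UNIV \<and>
     (\<exists>c::real. \<forall>w. Re w > c \<longrightarrow> ((\<lambda>i. a i w) has_sum g w) I)"

definition continued_sum :: "('i \<Rightarrow> complex \<Rightarrow> complex) \<Rightarrow> 'i set \<Rightarrow> complex \<Rightarrow> complex" where
  "continued_sum a I = (THE g. is_continued_sum a I g)"

lemma is_continued_sum_unique:
  assumes f: "is_continued_sum a I f" and g: "is_continued_sum a I g"
  shows "f = g"
proof -
  have nf: "f nicely_meromorphic_on UNIV" and ng: "g nicely_meromorphic_on UNIV"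
    using f g by (auto simp: is_continued_sum_def)
  obtain c where c: "\<And>w. Re w > c \<Longrightarrow> f w = g w"
  proof -
    obtain c1 c2 where
      "\<And>w. Re w > c1 \<Longrightarrow> ((\<lambda>i. a i w) has_sum f w) I"
      "\<And>w. Re w > c2 \<Longrightarrow> ((\<lambda>i. a i w) has_sum g w) I"
      using f g unfolding is_continued_sum_def by blast
    then have "f w = g w" if "Re w > max c1 c2" for w
      using that by (intro has_sum_unique) auto
    then show ?thesis using that by blast
  qed
  have mero: "(\<lambda>z. f z - g z) meromorphic_on UNIV"
    using nf ng by (auto simp: nicely_meromorphic_on_def intro!: meromorphic_intros)
  have near: "eventually (\<lambda>z. f z = g z) (at z)" for z
  proof -
    have "\<not> eventually (\<lambda>z. f z - g z \<noteq> 0) (cosparse UNIV)"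
    proof
      define z0 where "z0 = complex_of_real (c + 1)"
      assume "eventually (\<lambda>z. f z - g z \<noteq> 0) (cosparse UNIV)"
      then have "eventually (\<lambda>z. f z - g z \<noteq> 0) (at z0)"
        by (auto simp: eventually_cosparse_open_eq)
      moreover have "eventually (\<lambda>z. z \<in> {w. Re w > c}) (at z0)"
        by (intro eventually_at_in_open') (auto simp: open_halfspace_Re_gt z0_def)
      ultimately have "eventually (\<lambda>z. False) (at z0)"
        by eventually_elim (use c in auto)
      then show False by simp
    qed
    then have "eventually (\<lambda>z. f z - g z = 0) (cosparse UNIV)"
      using meromorphic_imp_constant_or_avoid[OF mero, of 0] by auto
    then show ?thesis by (auto simp: eventually_cosparse_open_eq)
  qed
  show ?thesis
  proof
    fix z
    have pole: "is_pole f z \<longleftrightarrow> is_pole g z"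
      by (intro is_pole_cong near refl)
    show "f z = g z"
    proof (cases "is_pole f z")
      case True
      then show ?thesis
        using pole is_pole_zero_at_nicely_mero[OF nf] is_pole_zero_at_nicely_mero[OF ng] by auto
    next
      case False
      then have "f \<midarrow>z\<rightarrow> f z" "g \<midarrow>z\<rightarrow> g z"
        using pole nf ng by (auto simp: nicely_meromorphic_on_def)
      moreover have "g \<midarrow>z\<rightarrow> f z"
        using \<open>f \<midarrow>z\<rightarrow> f z\<close> tendsto_cong[OF near] by blast
      ultimately show ?thesis using LIM_unique by blast
    qed
  qed
qed


section \<open>Spectral zeta function and determinants of depth r\<close>

definition sphere_eigenspace ::
    "(('a::euclidean_space \<Rightarrow> real) \<Rightarrow> 'a \<Rightarrow> real) \<Rightarrow> real \<Rightarrow> ('a \<Rightarrow> real) set" where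
  "sphere_eigenspace A ev = {f \<in> smooth_sphere. \<forall>x. A f x = ev * f x}"

definition sphere_eigenvalues ::
    "(('a::euclidean_space \<Rightarrow> real) \<Rightarrow> 'a \<Rightarrow> real) \<Rightarrow> real set" where
  "sphere_eigenvalues A = {ev. \<exists>f \<in> sphere_eigenspace A ev. f \<noteq> (\<lambda>x. 0)}"

lemma vector_space_fun:
  "vector_space (\<lambda>(c::real) (f::'a \<Rightarrow> real) x. c * f x)"
  by unfold_locales (auto simp: fun_eq_iff algebra_simps)

text \<open>Functions carry no \<open>real_vector\<close> instance, hence the dimension from the locale.\<close>

definition multiplicity_of ::
    "(('a::euclidean_space \<Rightarrow> real) \<Rightarrow> 'a \<Rightarrow> real) \<Rightarrow> real \<Rightarrow> nat" where
  "multiplicity_of A ev = vector_space.dim (\<lambda>(c::real) f x. c * f x) (sphere_eigenspace A ev)"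

definition spectral_zeta ::
    "(('a::euclidean_space \<Rightarrow> real) \<Rightarrow> 'a \<Rightarrow> real) \<Rightarrow> complex \<Rightarrow> complex" where
  "spectral_zeta A =
     continued_sum (\<lambda>ev w. of_nat (multiplicity_of A ev) * of_real ev powr (- w))
       {ev \<in> sphere_eigenvalues A. ev > 0}"

definition Det :: "nat \<Rightarrow> (('a::euclidean_space \<Rightarrow> real) \<Rightarrow> 'a \<Rightarrow> real) \<Rightarrow> complex" where
  "Det r A = exp (- deriv (spectral_zeta A) (1 - of_nat r))"


section \<open>Barnes multiple gamma functions\<close>

text \<open>
  For \<open>Re z > 0\<close> every base \<open>m\<^sub>1 + \<dots> + m\<^sub>l + z\<close> lies in the right half-plane, where the principal
  power is the standard choice.
\<close>

definition barnes_zeta :: "nat \<Rightarrow> complex \<Rightarrow> complex \<Rightarrow> complex" where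
  "barnes_zeta l z w =
     continued_sum (\<lambda>m w. (of_nat (sum_list m) + z) powr (- w)) {m :: nat list. length m = l} w"

definition multiple_gamma :: "nat \<Rightarrow> complex \<Rightarrow> complex" where
  "multiple_gamma l z = exp (deriv (barnes_zeta l z) 0)"


section \<open>The explicit polynomials\<close>

definition P_mult :: "nat \<Rightarrow> real \<Rightarrow> real" where
  "P_mult n z = ((z + n_check n + 1) gchoose n) - ((z + n_check n - 1) gchoose n)"

definition T_coeff :: "nat \<Rightarrow> nat \<Rightarrow> real \<Rightarrow> real" where
  "T_coeff n d s = coeff (THE p. \<forall>z. poly p (z - s) = P_mult n z) d"

lemma gchoose_poly:
  "\<exists>p::real poly. degree p \<le> k \<and> (\<forall>z. poly p z = (z + a) gchoose k)"
proof (intro exI conjI allI)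
  let ?p = "smult (1 / fact k) (\<Prod>i<k. [:a - real i, 1:])"
  have "degree ?p \<le> degree (\<Prod>i<k. [:a - real i, 1:])"
    by (rule degree_smult_le)
  also have "\<dots> \<le> (\<Sum>i<k. degree [:a - real i, 1:])"
    using degree_prod_sum_le[of "{..<k}" "\<lambda>i. [:a - real i, 1:]"] by (simp add: comp_def)
  also have "\<dots> = k" by simp
  finally show "degree ?p \<le> k" .
  show "poly ?p z = (z + a) gchoose k" for z
    by (simp add: gbinomial_prod_rev poly_prod atLeast0LessThan algebra_simps)
qed

lemma P_mult_expansion:
  assumes "n \<ge> 1"
  shows "P_mult n z = (\<Sum>d=0..n-1. T_coeff n d s * (z - s) ^ d)"
proof -
  obtain m where n: "n = Suc m" using assms by (cases n) auto
  have P: "P_mult n z = ((z + n_check n) gchoose m) + ((z + (n_check n - 1)) gchoose m)" for z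
    using gbinomial_Suc_Suc[of "z + n_check n" m] gbinomial_Suc_Suc[of "z + n_check n - 1" m]
    by (simp add: P_mult_def n algebra_simps)
  have P': "P_mult n (y + s) =
      ((y + (s + n_check n)) gchoose m) + ((y + (s + n_check n - 1)) gchoose m)" for y
    by (simp add: P algebra_simps)
  obtain p1 p2 :: "real poly" where
    p: "degree p1 \<le> m" "\<And>y. poly p1 y = (y + (s + n_check n)) gchoose m"
       "degree p2 \<le> m" "\<And>y. poly p2 y = (y + (s + n_check n - 1)) gchoose m"
    using gchoose_poly by metis
  define q where "q = p1 + p2"
  have deg: "degree q \<le> m" using p by (simp add: q_def degree_add_le)
  have q: "poly q y = P_mult n (y + s)" for y by (simp add: q_def p P')
  have "(THE p. \<forall>z. poly p (z - s) = P_mult n z) = q"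
  proof (rule the_equality)
    show "\<forall>z. poly q (z - s) = P_mult n z" by (simp add: q)
    fix p assume "\<forall>z. poly p (z - s) = P_mult n z"
    then have "poly p y = poly q y" for y using q[of y] by (metis add_diff_cancel)
    then show "p = q" by (simp add: poly_eq_poly_eq_iff[symmetric] fun_eq_iff)
  qed
  then have "T_coeff n d s = coeff q d" for d by (simp add: T_coeff_def)
  moreover have "P_mult n z = (\<Sum>d\<le>m. coeff q d * (z - s) ^ d)"
  proof -
    have "poly q (z - s) = (\<Sum>d\<le>m. coeff q d * (z - s) ^ d)"
      unfolding poly_altdef using deg
      by (intro sum.mono_neutral_left) (auto simp: coeff_eq_0)
    then show ?thesis by (simp add: q)
  qed
  ultimately show ?thesis by (simp add: n atLeast0AtMost)
qed

definition harm_between :: "nat \<Rightarrow> nat \<Rightarrow> real" where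
  "harm_between a b = (\<Sum>j=a..b. 1 / real j)"

definition f_poly :: "nat \<Rightarrow> nat \<Rightarrow> real \<Rightarrow> real" where
  "f_poly n r s =
     (\<Sum>d=1..n-1. (-1) ^ (r + d) * fact (r - 1) / (2 * pochhammer (real (r + d)) r)
        * harm_between r (r + d - 1) * (2 * s) ^ (2 * r + d - 1) * T_coeff n d s)"

text \<open>
  In the next definition truncated subtraction on \<open>nat\<close> gives \<open>k + 1 - 2 * r = max 0 (k - 2r + 1)\<close>;
  all other differences are nonnegative in the range \<open>1 \<le> r \<le> k\<close>.
\<close>

definition alpha_poly :: "nat \<Rightarrow> nat \<Rightarrow> real \<Rightarrow> nat \<Rightarrow> real" where
  "alpha_poly n r s k =
     (\<Sum>d=k+1-2*r..n-1. (-1) ^ (k + d) * real ((r + d - 1) choose (k - r))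
        * (2 * s) ^ (2 * r + d - k - 1) * T_coeff n d s)"

definition c_poly :: "nat \<Rightarrow> nat \<Rightarrow> real \<Rightarrow> real" where
  "c_poly k l z =
     (\<Sum>j=0..l-1. real ((l - 1) choose j) * (-1) ^ j * (z - real j - 1) ^ (k - 1))"

definition xi_plus :: "nat \<Rightarrow> real \<Rightarrow> real" where
  "xi_plus n s = 1 + n_check n + s"

definition xi_minus :: "nat \<Rightarrow> real \<Rightarrow> real" where
  "xi_minus n s = 1 + n_check n - s"

definition beta_poly :: "nat \<Rightarrow> nat \<Rightarrow> real \<Rightarrow> nat \<Rightarrow> real" where
  "beta_poly n r s l =
     (\<Sum>k=max r l..2*r+n-2. c_poly k l (xi_plus n s) * alpha_poly n r s k)"

end

theory Submission
  imports Defs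
begin

text \<open>
  Spectrum: extended constantly along rays, a smooth function \<open>f\<close> on the sphere satisfies
  \<open>sphere_laplacian f = - laplacian (\<lambda>x. f (sgn x))\<close> at points of the sphere. On restrictions of
  homogeneous polynomials of degree \<open>k\<close> the sphere Laplacian therefore is \<open>k (k + n - 1)\<close> up to
  restrictions of degree \<open>k - 2\<close>. Triangularity and the distinctness of these numbers split the space
  for \<open>k\<close> into the \<open>k\<close>-th eigenspace and the space for \<open>k - 2\<close>, which gives the multiplicities by
  counting monomials. Stone-Weierstrass and the orthogonality of eigenfunctions, with respect to
  an integral over a shell around the sphere, exclude all other eigenfunctions.

  Determinant: with \<open>x = xi_minus n s\<close> and \<open>u = 2 s\<close>, the spectral zeta function is a combination of the
  series \<open>\<Sum>m. (m + x)^(d - w) (m + x + u)^(- w)\<close>. Expanding the second factor binomially in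
  \<open>u / (m + x)\<close> continues the series by Hurwitz zeta functions. At \<open>w = 1 - r\<close> the derivative is the one obtained
  by treating \<open>log ((m + x) (m + x + u))\<close> as a sum of two logarithms, except for the single term in
  which the pole of the Hurwitz zeta function meets a zero of the binomial coefficient; that term
  yields \<open>f_poly\<close>. The remaining derivatives are turned into multiple gamma functions by expanding
  \<open>P_mult n a (a\<^sup>2 - s\<^sup>2)^(r - 1)\<close> in the basis \<open>(m + l - 1) choose (l - 1)\<close>, with coefficients
  \<open>- beta_poly n r s l\<close>.
\<close>

section \<open>Remainders of the binomial series\<close>

text \<open>Regularisation is not additive: the logarithm of a product cannot simply be split inside
  a zeta-regularised sum. With \<open>b = r - 1\<close>, the shift \<open>w + b\<close> moves the
  point \<open>1 - r\<close> to 0, where the exponents become the natural numbers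
  \<open>d + b\<close> and \<open>b\<close>. There the binomial series stops, so the remainder
  vanishes, as do all coefficients of index above \<open>b\<close>, among them the one that meets
  the pole. Only derivatives in \<open>w\<close> survive, and some of them (of the remainder, of the
  coefficients, of \<open>hurwitz_entire x\<close> at 1) have no useful closed form. They are never
  evaluated: they are the same for a second series with an explicit continuation, and subtraction
  removes them. The eigenvalue number \<open>k = m + 1\<close> is
  \<open>(m + x) * (m + x + u)\<close> with positive factors; number 0 need not be positive, is kept
  apart and gives the prefactor. On the sphere, functions extended constantly along rays are
  integrated against a radial weight. Such extensions have no radial derivative, so the gradient of
  the weight drops out of Green's identity.\<close>

definition binom_rem :: "nat \<Rightarrow> complex \<Rightarrow> real \<Rightarrow> complex" where
  "binom_rem J a v = (1 + of_real v) powr a - (\<Sum>j<J. (a gchoose j) * of_real v ^ j)"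

text \<open>Each factor \<open>a - i\<close> of the falling factorial has norm at most
  \<open>A + i\<close>. The bound is the coefficient of \<open>v ^ j\<close> in
  \<open>(1 - v) powr (- A)\<close>, hence nonnegative and independent of \<open>a\<close>.\<close>

lemma norm_gchoose_le:
  fixes a :: complex
  assumes "norm a \<le> A"
  shows "norm (a gchoose j) \<le> (-1) ^ j * ((- A) gchoose j)"
proof -
  have "norm (a gchoose j) = (\<Prod>i<j. norm (a - of_nat i)) / fact j"
    by (simp add: gbinomial_prod_rev norm_divide prod_norm[symmetric] atLeast0LessThan)
  also have "\<dots> \<le> (\<Prod>i<j. A + real i) / fact j"
  proof (intro divide_right_mono prod_mono conjI)
    fix i
    show "norm (a - of_nat i) \<le> A + real i"
      using norm_triangle_ineq4[of a "of_nat i"] assms by (simp add: norm_of_nat)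
  qed auto
  also have "(\<Prod>i<j. A + real i) = (-1) ^ j * (\<Prod>i<j. - A - real i)"
    using prod.distrib[of "\<lambda>_. -1" "\<lambda>i. - A - real i" "{..<j}"] by (simp add: algebra_simps)
  finally show ?thesis by (simp add: gbinomial_prod_rev atLeast0LessThan)
qed

text \<open>Termwise comparison with the tail of the series of
  \<open>(1 - 1/2) powr (- A) = 2 powr A\<close>, whose terms are nonnegative; splitting off
  \<open>\<bar>v\<bar> ^ J\<close> before using \<open>\<bar>v\<bar> \<le> 1/2\<close> costs the
  factor \<open>2 ^ J\<close>. As \<open>a\<close> enters only through \<open>A\<close>, the bound
  is locally uniform in the exponent.\<close>

lemma norm_binom_rem_le:
  assumes "norm a \<le> A" "\<bar>v\<bar> \<le> 1/2"
  shows "norm (binom_rem J a v) \<le> 2 ^ J * 2 powr A * \<bar>v\<bar> ^ J"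
proof -
  have "(\<lambda>j. (a gchoose j) * of_real v ^ j) sums (1 + of_real v) powr a"
    using assms by (intro gen_binomial_complex) auto
  then have 1: "(\<lambda>j. (a gchoose (j + J)) * of_real v ^ (j + J)) sums binom_rem J a v"
    unfolding binom_rem_def by (rule sums_split_initial_segment)
  have "(\<lambda>j. ((- A) gchoose j) * (-1/2) ^ j) sums (1 + (-1/2)) powr (- A)"
    using assms by (intro gen_binomial_real) auto
  moreover have "(1 + (-1/2)) powr (- A) = 2 powr A"
    by (simp add: powr_minus_divide powr_divide)
  ultimately have s: "(\<lambda>j. ((- A) gchoose j) * (-1/2) ^ j) sums 2 powr A" by simp
  have nn: "0 \<le> ((- A) gchoose j) * (-1/2) ^ j" for j
  proof -
    have "0 \<le> (-1) ^ j * ((- A) gchoose j)"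
      using norm_gchoose_le[OF assms(1), of j] norm_ge_zero order_trans by blast
    then have "0 \<le> (-1) ^ j * ((- A) gchoose j) * (1/2)^j" by simp
    also have "(-1) ^ j * ((- A) gchoose j) * (1/2)^j = ((- A) gchoose j) * ((-1) * (1/2)) ^ j"
      by (subst power_mult_distrib) simp
    finally show ?thesis by simp
  qed
  define T where "T = (\<Sum>j. ((- A) gchoose (j + J)) * (-1/2) ^ (j + J))"
  have sT: "(\<lambda>j. ((- A) gchoose (j + J)) * (-1/2) ^ (j + J)) sums T"
    unfolding T_def using s by (intro summable_sums summable_ignore_initial_segment) (rule sums_summable)
  have "T = 2 powr A - (\<Sum>j<J. ((- A) gchoose j) * (-1/2) ^ j)"
    using sums_split_initial_segment[OF s, of J] sT sums_unique2 by blast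
  also have "\<dots> \<le> 2 powr A" using nn by (simp add: sum_nonneg)
  finally have T: "T \<le> 2 powr A" .
  have 2: "(\<lambda>j. 2 ^ J * \<bar>v\<bar> ^ J * (((- A) gchoose (j + J)) * (-1/2) ^ (j + J))) sums (2 ^ J * \<bar>v\<bar> ^ J * T)"
    using sT by (rule sums_mult)
  have 3: "norm ((a gchoose (j + J)) * of_real v ^ (j + J)) \<le> 2 ^ J * \<bar>v\<bar> ^ J * (((- A) gchoose (j + J)) * (-1/2) ^ (j + J))" for j
  proof -
    have "norm ((a gchoose (j + J)) * of_real v ^ (j + J)) = norm (a gchoose (j + J)) * (\<bar>v\<bar> ^ j * \<bar>v\<bar> ^ J)"
      by (simp add: norm_mult norm_power power_add)
    also have "\<dots> \<le> ((-1) ^ (j + J) * ((- A) gchoose (j + J))) * ((1/2) ^ j * \<bar>v\<bar> ^ J)"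
      using assms by (intro mult_mono norm_gchoose_le power_mono mult_right_mono)
        (use order_trans[OF norm_ge_zero norm_gchoose_le[OF assms(1), of "j+J"]] in auto)
    also have "\<dots> = 2 ^ J * \<bar>v\<bar> ^ J * (((- A) gchoose (j + J)) * (-1/2) ^ (j + J))"
    proof -
      have "(-1) ^ (j + J) * (1/2) ^ j = (2 ^ J * (-1/2) ^ (j + J) :: real)"
        using power_mult_distrib[of "-1::real" "1/2" "j + J"] by (simp add: power_add field_simps)
      then show ?thesis by (simp add: mult_ac)
    qed
    finally show ?thesis .
  qed
  have "norm (binom_rem J a v) \<le> 2 ^ J * \<bar>v\<bar> ^ J * T"
    using norm_suminf_le[OF 3 sums_summable[OF 2]] 1 2 by (simp add: sums_iff)
  also have "\<dots> \<le> 2 ^ J * \<bar>v\<bar> ^ J * 2 powr A"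
    using T by (intro mult_left_mono) auto
  finally show ?thesis by (simp add: mult_ac)
qed

lemma summable_shift_powr:
  assumes "x > 0" "c < -1"
  shows "summable (\<lambda>m. (real m + x) powr c)"
proof (rule summable_comparison_test_ev)
  show "summable (\<lambda>m. real m powr c)" using assms by (simp add: summable_real_powr_iff)
  show "\<forall>\<^sub>F m in sequentially. norm ((real m + x) powr c) \<le> real m powr c"
    using eventually_gt_at_top[of 0] by eventually_elim (use assms in \<open>auto intro!: powr_mono2'\<close>)
qed

lemma holomorphic_gchoose [holomorphic_intros]:
  "f holomorphic_on S \<Longrightarrow> (\<lambda>w. (f w gchoose j) :: complex) holomorphic_on S"
  by (simp add: gbinomial_prod_rev atLeast0LessThan) (intro holomorphic_intros; simp)

lemma holomorphic_binom_rem [holomorphic_intros]: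
  assumes "f holomorphic_on S" "v > -1"
  shows "(\<lambda>w. binom_rem J (f w) v) holomorphic_on S"
proof -
  have "1 + of_real v \<noteq> (0::complex)" using assms by (metis add_eq_0_iff of_real_1 of_real_minus of_real_eq_iff less_irrefl)
  then show ?thesis
    unfolding binom_rem_def using assms(1) by (intro holomorphic_intros) auto
qed

text \<open>The terms are of order \<open>(m + x) powr (Re (\<alpha> w) - J)\<close>, locally
  uniformly in \<open>w\<close>, so the sum is holomorphic and may be differentiated term by term.
  The derivative series is included because the derivative of the remainder at 0 is compared for
  different exponents later.\<close>

lemma binom_rem_sum:
  fixes x u :: real and \<alpha> \<beta> :: "complex \<Rightarrow> complex"
  assumes x: "x > 0" "x + u > 0" and S: "open S" "\<alpha> holomorphic_on S" "\<beta> holomorphic_on S"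
    and conv: "\<And>w. w \<in> S \<Longrightarrow> Re (\<alpha> w) - real J < -1"
  defines "t \<equiv> \<lambda>m w. of_real (real m + x) powr \<alpha> w * binom_rem J (\<beta> w) (u / (real m + x))"
  shows "\<exists>g. g holomorphic_on S \<and> (\<forall>w\<in>S. (\<lambda>m. t m w) sums g w \<and> (\<lambda>m. deriv (t m) w) sums deriv g w)"
proof -
  have v: "u / (real m + x) > -1" for m
    using x by (simp add: field_simps)
  have ne: "of_real (real m + x) \<noteq> (0::complex)" for m
    using x by (metis add_pos_nonneg add.commute of_nat_0_le_iff of_real_eq_0_iff less_irrefl)
  have hol: "t m holomorphic_on S" for m
    unfolding t_def using S v ne by (intro holomorphic_intros) auto
  have der: "(t m has_field_derivative deriv (t m) w) (at w)" if "w \<in> S" for m w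
    using hol S(1) that holomorphic_derivI by blast
  have "\<exists>g g'. \<forall>w\<in>S. (\<lambda>m. t m w) sums g w \<and> (\<lambda>m. deriv (t m) w) sums g' w \<and> (g has_field_derivative g' w) (at w)"
  proof (rule series_and_derivative_comparison_local[OF S(1)])
    show "(t m has_field_derivative deriv (t m) w) (at w)" if "w \<in> S" for m w
      using der that .
    fix w assume w: "w \<in> S"
    \<comment> \<open>The midpoint between \<open>Re (\<alpha> w) - J\<close> and \<open>-1\<close>:
      on a neighbourhood of \<open>w\<close> the exponent stays below \<open>c\<close>, which still
      gives convergence.\<close>
    define c where "c = (Re (\<alpha> w) - real J - 1) / 2"
    have c: "c < -1" "Re (\<alpha> w) - real J < c" using conv[OF w] by (auto simp: c_def)
    define A where "A = norm (\<beta> w) + 1"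
    have "isCont \<alpha> w" "isCont \<beta> w"
      using S w holomorphic_on_imp_continuous_on continuous_on_eq_continuous_at by blast+
    then have "((\<lambda>w. Re (\<alpha> w) - real J) \<longlongrightarrow> Re (\<alpha> w) - real J) (at w)"
        "((\<lambda>w. norm (\<beta> w)) \<longlongrightarrow> norm (\<beta> w)) (at w)"
      by (auto intro!: tendsto_intros simp: isCont_def)
    then have "\<forall>\<^sub>F z in at w. Re (\<alpha> z) - real J < c \<and> norm (\<beta> z) < A"
      using c by (intro eventually_conj order_tendstoD(2)) (auto simp: A_def)
    then obtain d where d: "d > 0" "\<And>z. z \<in> ball w d \<Longrightarrow> z \<noteq> w \<Longrightarrow> Re (\<alpha> z) - real J < c \<and> norm (\<beta> z) < A"
      unfolding eventually_at by (auto simp: dist_commute)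
    then have d': "Re (\<alpha> z) - real J \<le> c" "norm (\<beta> z) \<le> A" if "z \<in> ball w d" for z
      using that c by (cases "z = w"; force simp: A_def)+
    \<comment> \<open>Only for large \<open>m\<close> is \<open>u / (m + x)\<close> at most 1/2 in
      absolute value, as the bound on the remainder requires.\<close>
    have ev: "\<forall>\<^sub>F m in sequentially. real m + x \<ge> max 1 (2 * \<bar>u\<bar>)"
      using eventually_ge_at_top[of "nat \<lceil>max 1 (2 * \<bar>u\<bar>)\<rceil>"]
      by eventually_elim (use x in linarith)
    show "\<exists>d h. 0 < d \<and> summable h \<and> (\<forall>\<^sub>F n in sequentially. \<forall>y\<in>ball w d \<inter> S. norm (t n y) \<le> h n)"
    proof (intro exI conjI)
      show "0 < d" by fact
      show "summable (\<lambda>m. 2 ^ J * 2 powr A * \<bar>u\<bar> ^ J * (real m + x) powr c)"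
        by (intro summable_mult summable_shift_powr x c)
      show "\<forall>\<^sub>F n in sequentially. \<forall>y\<in>ball w d \<inter> S. norm (t n y) \<le> 2 ^ J * 2 powr A * \<bar>u\<bar> ^ J * (real n + x) powr c"
        using ev
      proof eventually_elim
        case (elim n)
        define y where "y = real n + x"
        have y: "y \<ge> 1" "2 * \<bar>u\<bar> \<le> y" using elim by (auto simp: y_def)
        show ?case
        proof
          fix z assume z: "z \<in> ball w d \<inter> S"
          have "norm (t n z) = y powr Re (\<alpha> z) * norm (binom_rem J (\<beta> z) (u / y))"
            using y by (simp add: t_def norm_mult norm_powr_real_powr flip: y_def)
          also have "\<dots> \<le> y powr (c + J) * (2 ^ J * 2 powr A * \<bar>u / y\<bar> ^ J)"
            using y d'[of z] z by (intro mult_mono powr_mono norm_binom_rem_le) (auto simp: field_simps)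
          also have "\<dots> = 2 ^ J * 2 powr A * \<bar>u\<bar> ^ J * y powr c"
            using y by (simp add: powr_add powr_realpow field_simps)
          finally show "norm (t n z) \<le> 2 ^ J * 2 powr A * \<bar>u\<bar> ^ J * (real n + x) powr c"
            by (simp add: y_def)
        qed
      qed
    qed
  qed
  then obtain g g' where g: "\<And>w. w \<in> S \<Longrightarrow> (\<lambda>m. t m w) sums g w \<and> (\<lambda>m. deriv (t m) w) sums g' w \<and> (g has_field_derivative g' w) (at w)"
    by blast
  then have "g holomorphic_on S" using S(1) by (auto simp: holomorphic_on_open)
  moreover have "deriv g w = g' w" if "w \<in> S" for w using g[OF that] DERIV_imp_deriv by blast
  ultimately show ?thesis using g by (intro exI[of _ g]) auto
qed

section \<open>The Hurwitz zeta function\<close>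

lemma open_Re_gt: "open {w. Re w > c}"
  by (rule open_halfspace_Re_gt)

lemma connected_Re_gt: "connected {w. Re w > c}"
  by (intro convex_connected convex_halfspace_Re_gt)

lemma Re_gt_nonempty: "{w. Re w > c} \<noteq> {}"
proof -
  have "of_real (c + 1) \<in> {w. Re w > c}" by simp
  then show ?thesis by blast
qed

lemma holomorphic_halfplane_unique:
  assumes "f holomorphic_on {w. Re w > a}" "g holomorphic_on {w. Re w > a}"
    and "\<And>w. Re w > c \<Longrightarrow> f w = g w" and "Re z > a"
  shows "f z = g z"
  by (rule analytic_continuation_open[of "{w. Re w > max a c}" "{w. Re w > a}" f g])
    (use assms Re_gt_nonempty[of "max a c"] open_Re_gt[of "max a c"] in \<open>auto simp: open_Re_gt connected_Re_gt\<close>)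

text \<open>Any two of the \<open>f N\<close> agree with \<open>h\<close> far to the right, hence by
  the identity theorem wherever both are holomorphic, and every point lies in one of the
  half-planes.\<close>

lemma holomorphic_glue:
  assumes hol: "\<And>N. f N holomorphic_on {w. Re w > - real N}"
    and agree: "\<And>N w. Re w > c \<Longrightarrow> f N w = h w"
  shows "\<exists>g. g holomorphic_on UNIV \<and> (\<forall>N w. Re w > - real N \<longrightarrow> g w = f N w)"
proof -
  define g where "g = (\<lambda>w. f (nat \<lceil>\<bar>Re w\<bar>\<rceil> + 1) w)"
  have eq: "f N w = f M w" if "Re w > - real N" "Re w > - real M" for N M w
  proof (rule holomorphic_halfplane_unique[where f = "f N" and g = "f M" and z = w and a = "max (- real N) (- real M)" and c = c])
    show "f N holomorphic_on {w. Re w > max (- real N) (- real M)}"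
      by (rule holomorphic_on_subset[OF hol[of N]]) auto
    show "f M holomorphic_on {w. Re w > max (- real N) (- real M)}"
      by (rule holomorphic_on_subset[OF hol[of M]]) auto
  qed (use that agree[of _ N] agree[of _ M] in auto)
  have g: "g w = f N w" if "Re w > - real N" for N w
    unfolding g_def by (rule eq[OF _ that]) linarith
  have "g holomorphic_on {w. Re w > - real N}" for N
    using hol[of N] by (rule holomorphic_transform) (use g in auto)
  then have "g holomorphic_on (\<Union>N. {w. Re w > - real N})"
    by (intro holomorphic_on_UN_open) (auto simp: open_Re_gt)
  moreover have "(\<Union>N. {w. Re w > - real N}) = UNIV"
  proof -
    have "\<exists>N. Re w > - real N" for w
      by (rule exI[of _ "nat \<lceil>\<bar>Re w\<bar>\<rceil> + 1"]) linarith
    then show ?thesis by auto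
  qed
  ultimately show ?thesis using g by auto
qed

text \<open>Meromorphic functions may carry arbitrary values at isolated points, so agreement is
  claimed in punctured neighbourhoods. The difference vanishes almost everywhere or almost nowhere,
  and the latter fails far to the right.\<close>

lemma meromorphic_halfplane_unique:
  assumes f: "f meromorphic_on {w. Re w > a}" and g: "g meromorphic_on {w. Re w > a}"
    and eq: "\<And>w. Re w > c \<Longrightarrow> f w = g w" and z: "Re z > a"
  shows "eventually (\<lambda>w. f w = g w) (at z)"
proof -
  let ?S = "{w. Re w > a}"
  have mero: "(\<lambda>z. f z - g z) meromorphic_on ?S"
    using f g by (intro meromorphic_intros)
  have "\<not> eventually (\<lambda>z. f z - g z \<noteq> 0) (cosparse ?S)"
  proof
    define z0 where "z0 = complex_of_real (max a c + 1)"
    have z0: "z0 \<in> ?S" "Re z0 > c" by (auto simp: z0_def)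
    assume "eventually (\<lambda>z. f z - g z \<noteq> 0) (cosparse ?S)"
    then have "eventually (\<lambda>z. f z - g z \<noteq> 0) (at z0)"
      using z0 by (auto simp: eventually_cosparse_open_eq open_Re_gt)
    moreover have "eventually (\<lambda>z. z \<in> {w. Re w > c}) (at z0)"
      using z0 by (intro eventually_at_in_open') (auto simp: open_Re_gt)
    ultimately have "eventually (\<lambda>z. False) (at z0)"
      by eventually_elim (use eq in auto)
    then show False by simp
  qed
  then have "eventually (\<lambda>z. f z - g z = 0) (cosparse ?S)"
    using meromorphic_imp_constant_or_avoid[OF mero open_Re_gt connected_Re_gt, of 0] by auto
  then show ?thesis using z by (auto simp: eventually_cosparse_open_eq open_Re_gt)
qed

text \<open>\<open>remove_sings\<close> depends only on punctured neighbourhoods, so it turns the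
  agreement there into equality of values; the glued function also has the normalisation demanded by
  \<open>is_continued_sum\<close>.\<close>

lemma meromorphic_glue:
  assumes mero: "\<And>N. f N meromorphic_on {w. Re w > - real N}"
    and agree: "\<And>N w. Re w > c \<Longrightarrow> f N w = h w"
  shows "\<exists>g. g nicely_meromorphic_on UNIV \<and> (\<forall>N z. Re z > - real N \<longrightarrow> g z = remove_sings (f N) z)"
proof -
  define F where "F N = remove_sings (f N)" for N
  define g where "g = (\<lambda>w. F (nat \<lceil>\<bar>Re w\<bar>\<rceil> + 1) w)"
  have eq: "F N w = F M w" if "Re w > - real N" "Re w > - real M" for N M w
    unfolding F_def
  proof (intro remove_sings_cong refl meromorphic_halfplane_unique[where f = "f N" and g = "f M" and a = "max (- real N) (- real M)" and c = c])
    show "f N meromorphic_on {w. Re w > max (- real N) (- real M)}"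
      by (rule meromorphic_on_subset[OF mero[of N]]) auto
    show "f M meromorphic_on {w. Re w > max (- real N) (- real M)}"
      by (rule meromorphic_on_subset[OF mero[of M]]) auto
  qed (use that agree[of _ N] agree[of _ M] in auto)
  have g: "g w = F N w" if "Re w > - real N" for N w
    unfolding g_def by (rule eq[OF _ that]) linarith
  have evg: "eventually (\<lambda>w. g w = F N w) (nhds z)" if "Re z > - real N" for N z
  proof -
    have "eventually (\<lambda>w. w \<in> {w. Re w > - real N}) (nhds z)"
      using that by (intro eventually_nhds_in_open) (auto simp: open_Re_gt)
    then show ?thesis by eventually_elim (use g in auto)
  qed
  have nice: "F N nicely_meromorphic_on {w. Re w > - real N}" for N
    unfolding F_def by (rule remove_sings_nicely_meromorphic) (rule mero)
  have "g meromorphic_on {z} \<and> ((is_pole g z \<and> g z = 0) \<or> g \<midarrow>z\<rightarrow> g z)" for z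
  proof -
    define N where "N = nat \<lceil>\<bar>Re z\<bar>\<rceil> + 1"
    have N: "Re z > - real N" unfolding N_def by linarith
    have ev: "eventually (\<lambda>w. g w = F N w) (at z)"
      using evg[OF N] by (auto simp: eventually_at_filter elim: eventually_mono)
    have gz: "g z = F N z" using g[OF N] .
    have "F N meromorphic_on {z}"
      using nice[of N] N by (auto simp: nicely_meromorphic_on_def intro: meromorphic_on_subset)
    then have 1: "g meromorphic_on {z}"
      using meromorphic_on_cong[of "{z}" g "F N" "{z}"] ev by auto
    have "(is_pole (F N) z \<and> F N z = 0) \<or> (F N) \<midarrow>z\<rightarrow> F N z"
      using nice[of N] N by (auto simp: nicely_meromorphic_on_def)
    then show ?thesis
      using 1 is_pole_cong[OF ev refl] tendsto_cong[OF ev] gz by auto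
  qed
  then have nm: "g nicely_meromorphic_on UNIV"
    unfolding nicely_meromorphic_on_def by (subst meromorphic_on_meromorphic_at) blast
  then show ?thesis using g unfolding F_def by blast
qed

section \<open>Continuation of the Hurwitz zeta function\<close>

lemma shift_nonzero:
  assumes "x > 0"
  shows "of_nat m + of_real x \<noteq> (0::complex)"
proof -
  have "of_nat m + of_real x = (of_real (real m + x) :: complex)" by simp
  then show ?thesis using assms by (simp only: of_real_eq_0_iff)
qed

definition shift_zeta_sum :: "real \<Rightarrow> complex \<Rightarrow> complex" where
  "shift_zeta_sum x v = (\<Sum>m. of_real (real m + x) powr (- v))"

lemma norm_summable_shift_powr:
  assumes "x > 0" "Re a < -1"
  shows "summable (\<lambda>m. norm (of_real (real m + x) powr a :: complex))"
  using summable_shift_powr[OF assms] assms(1) by (simp add: norm_powr_real_powr)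

lemma shift_zeta_sums:
  assumes "x > 0" "Re a < -1"
  shows "(\<lambda>m. of_real (real m + x) powr a) sums shift_zeta_sum x (- a)"
  unfolding shift_zeta_sum_def
  using summable_norm_cancel[OF norm_summable_shift_powr[OF assms]] by (simp add: summable_sums)

text \<open>Principal powers of positive reals are multiplicative, so
  \<open>y + u = y * (1 + u / y)\<close> can be raised to a complex power factor by factor.\<close>

lemma powr_expand:
  assumes "y > 0" "y + u > 0"
  shows "of_real y powr p * of_real (y + u) powr a =
    (\<Sum>j<J. (a gchoose j) * of_real u ^ j * of_real y powr (p + a - of_nat j))
      + of_real y powr (p + a) * binom_rem J a (u / y)"
proof -
  have 0: "1 + u / y \<ge> 0" using assms by (simp add: field_simps)
  have "of_real (y + u) = of_real y * (of_real (1 + u / y) :: complex)"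
    using assms by (simp only: flip: of_real_mult) (simp add: field_simps)
  then have "of_real (y + u) powr a = of_real y powr a * of_real (1 + u / y) powr a"
    using assms 0 by (simp only: powr_times_real Reals_of_real Re_complex_of_real)
  then have 1: "of_real y powr p * of_real (y + u) powr a = of_real y powr (p + a) * (1 + of_real (u / y)) powr a"
    by (simp add: powr_add)
  have 2: "(1 + of_real (u / y)) powr a = binom_rem J a (u / y) + (\<Sum>j<J. (a gchoose j) * of_real (u / y) ^ j)"
    by (simp add: binom_rem_def)
  have 3: "of_real y powr (p + a) * ((a gchoose j) * of_real (u / y) ^ j) =
      (a gchoose j) * of_real u ^ j * of_real y powr (p + a - of_nat j)" for j
    using assms by (simp add: powr_diff powr_nat power_divide)
  show ?thesis unfolding 1 2 by (simp only: distrib_left sum_distrib_left 3) (simp add: add.commute)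
qed

text \<open>
  The differences of \<open>(m + x)\<^sup>1\<^sup>-\<^sup>w\<close> telescope; expanding them binomially expresses the series at \<open>w\<close> by
  its values at \<open>w + 1, w + 2, \<dots>\<close>.
\<close>

lemma hurwitz_recursion:
  assumes x: "x > 0" and w: "Re w > 1"
    and g: "(\<lambda>m. of_real (real m + x) powr (1 - w) * binom_rem (K + 2) (1 - w) (1 / (real m + x))) sums g"
  shows "(w - 1) * shift_zeta_sum x w = of_real x powr (1 - w)
     + (\<Sum>j<K. ((1 - w) gchoose (j + 2)) * shift_zeta_sum x (w + of_nat j + 1)) + g"
proof -
  define f :: "nat \<Rightarrow> complex" where "f m = of_real (real m + x) powr (1 - w)" for m
  have "(\<lambda>m. (real m + x) powr (1 - Re w)) \<longlonglongrightarrow> 0"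
    using w by real_asymp
  then have "f \<longlonglongrightarrow> 0"
    using x by (subst tendsto_norm_zero_iff[symmetric]) (simp add: f_def norm_powr_real_powr)
  then have tel: "(\<lambda>m. f (Suc m) - f m) sums (0 - f 0)" by (rule telescope_sums)
  \<comment> \<open>In the expansion of \<open>f (Suc m)\<close> the term \<open>j = 0\<close> is
    \<open>f m\<close>, the term \<open>j = 1\<close> is the series to be continued, and the others
    decay faster by integer powers.\<close>
  have A: "f (Suc m) - f m = (\<Sum>j<K. ((1 - w) gchoose (j + 2)) * of_real (real m + x) powr (- (w + of_nat j + 1)))
      + (1 - w) * of_real (real m + x) powr (- w)
      + of_real (real m + x) powr (1 - w) * binom_rem (K + 2) (1 - w) (1 / (real m + x))" for m
  proof -
    have "f (Suc m) = (\<Sum>j<Suc (Suc K). ((1 - w) gchoose j) * of_real (real m + x) powr (1 - w - of_nat j))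
      + of_real (real m + x) powr (1 - w) * binom_rem (K + 2) (1 - w) (1 / (real m + x))"
      using powr_expand[of "real m + x" 1 0 "1 - w" "K + 2"] x shift_nonzero[OF x, of m]
      by (simp add: f_def add_ac del: sum.lessThan_Suc)
    then show ?thesis
      by (simp only: sum.lessThan_Suc_shift) (simp add: f_def algebra_simps)
  qed
  have "(\<lambda>m. f (Suc m) - f m) sums ((\<Sum>j<K. ((1 - w) gchoose (j + 2)) * shift_zeta_sum x (w + of_nat j + 1))
      + (1 - w) * shift_zeta_sum x w + g)"
    unfolding A
    using shift_zeta_sums[OF x, of "- w"] shift_zeta_sums[OF x, of "- (w + of_nat j + 1)" for j] w
    by (intro sums_add sums_sum sums_mult g) (auto simp only: minus_minus uminus_complex.sel plus_complex.sel complex_Re_of_nat one_complex.sel)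
  from sums_unique2[OF this tel] show ?thesis by (simp add: f_def algebra_simps)
qed

lemma gchoose_Suc_mult:
  fixes a :: complex
  shows "a gchoose Suc k = (a gchoose k) * (a - of_nat k) / of_nat (Suc k)"
  by (simp add: gbinomial_prod_rev atLeast0LessThan field_simps)

lemma hurwitz_rem:
  assumes "x > 0"
  shows "\<exists>g. g holomorphic_on {w. Re w > - real K} \<and> (\<forall>w. Re w > - real K \<longrightarrow>
    (\<lambda>m. of_real (real m + x) powr (1 - w) * binom_rem (K + 2) (1 - w) (1 / (real m + x))) sums g w)"
proof -
  define S where "S = {w. Re w > - real K}"
  have "\<exists>g. g holomorphic_on S \<and> (\<forall>w\<in>S.
      (\<lambda>m. of_real (real m + x) powr (1 - w) * binom_rem (K + 2) (1 - w) (1 / (real m + x))) sums g w \<and>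
      (\<lambda>m. deriv (\<lambda>w. of_real (real m + x) powr (1 - w) * binom_rem (K + 2) (1 - w) (1 / (real m + x))) w) sums deriv g w)"
    by (rule binom_rem_sum) (use assms in \<open>auto simp: S_def open_Re_gt intro!: holomorphic_intros\<close>)
  then show ?thesis unfolding S_def by blast
qed

text \<open>The product with \<open>w - 1\<close> is continued because it has no pole. In the
  recursion, \<open>(1 - w) gchoose (j + 2)\<close> contains the factor \<open>w + j\<close>, which
  is \<open>v - 1\<close> at \<open>v = w + j + 1\<close>. So the recursion only involves
  \<open>e\<close> at points further to the right, and each step gains a strip of width 1.\<close>

lemma hurwitz_strip:
  assumes x: "x > 0"
  shows "\<exists>e. e holomorphic_on {w. Re w > - real N} \<and>
     (\<forall>w. Re w > 1 \<longrightarrow> e w = (w - 1) * shift_zeta_sum x w) \<and> e 1 = 1"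
proof (induction N)
  case 0
  obtain g where g: "g holomorphic_on {w. Re w > 0}" "\<And>w. Re w > 0 \<Longrightarrow>
    (\<lambda>m. of_real (real m + x) powr (1 - w) * binom_rem 2 (1 - w) (1 / (real m + x))) sums g w"
    using hurwitz_rem[OF x, of 0] by (auto simp: numeral_2_eq_2)
  \<comment> \<open>At \<open>w = 1\<close> the exponent \<open>1 - w\<close> is 0, and
    \<open>(1 + v) powr 0\<close> equals its binomial expansion, so every remainder vanishes. This
    leaves the value \<open>x powr 0 = 1\<close>, the residue of the Hurwitz zeta function.\<close>
  have "(\<lambda>m. 0) sums g 1"
  proof -
    have "1 + 1 / (of_nat m + of_real x) \<noteq> (0 :: complex)" for m
      using shift_nonzero[OF x, of m] shift_nonzero[of "x + 1" m] x by (simp add: field_simps)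
    then show ?thesis
      using g(2)[of 1] x by (simp add: binom_rem_def numeral_2_eq_2)
  qed
  then have "g 1 = 0" by (simp add: sums_iff)
  then show ?case
  proof (intro exI[of _ "\<lambda>w. of_real x powr (1 - w) + g w"] conjI allI impI)
    show "(\<lambda>w. of_real x powr (1 - w) + g w) holomorphic_on {w. Re w > - real 0}"
      using g(1) x by (auto intro!: holomorphic_intros)
    show "of_real x powr (1 - w) + g w = (w - 1) * shift_zeta_sum x w" if "Re w > 1" for w
      using hurwitz_recursion[OF x that, of 0 "g w"] g(2)[of w] that by (simp add: numeral_2_eq_2)
    show "of_real x powr (1 - 1) + g 1 = 1"
      using \<open>g 1 = 0\<close> x by simp
  qed
next
  case (Suc N)
  then obtain e where e: "e holomorphic_on {w. Re w > - real N}"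
     "\<And>w. Re w > 1 \<Longrightarrow> e w = (w - 1) * shift_zeta_sum x w" "e 1 = 1" by blast
  obtain g where g: "g holomorphic_on {w. Re w > - real (Suc N)}" "\<And>w. Re w > - real (Suc N) \<Longrightarrow>
    (\<lambda>m. of_real (real m + x) powr (1 - w) * binom_rem (Suc N + 2) (1 - w) (1 / (real m + x))) sums g w"
    using hurwitz_rem[OF x, of "Suc N"] by blast
  define e' where "e' w = of_real x powr (1 - w)
     - (\<Sum>j<Suc N. ((1 - w) gchoose (j + 1)) / of_nat (j + 2) * e (w + of_nat j + 1)) + g w" for w
  have comp: "(\<lambda>w. e (w + of_nat j + 1)) holomorphic_on {w. Re w > - real (Suc N)}" for j
  proof -
    have "e \<circ> (\<lambda>w. w + of_nat j + 1) holomorphic_on {w. Re w > - real (Suc N)}"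
      by (rule holomorphic_on_compose_gen[OF _ e(1)]) (auto intro!: holomorphic_intros)
    then show ?thesis by (simp add: o_def)
  qed
  have "e' holomorphic_on {w. Re w > - real (Suc N)}"
    unfolding e'_def using x g(1) comp by (intro holomorphic_intros) auto
  moreover have 1: "e' w = (w - 1) * shift_zeta_sum x w" if w: "Re w > 1" for w
  proof -
    have "((1 - w) gchoose (j + 2)) * shift_zeta_sum x (w + of_nat j + 1) =
        - (((1 - w) gchoose (j + 1)) / of_nat (j + 2) * e (w + of_nat j + 1))" for j
    proof -
      have "e (w + of_nat j + 1) = (w + of_nat j) * shift_zeta_sum x (w + of_nat j + 1)"
        using w e(2)[of "w + of_nat j + 1"] by simp
      moreover have "(1 - w) gchoose (j + 2) = - (((1 - w) gchoose (j + 1)) * (w + of_nat j) / of_nat (j + 2))"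
      proof -
        have "1 - w - of_nat (j + 1) = - (w + of_nat j)" by simp
        then have "(1 - w) gchoose (j + 2) = ((1 - w) gchoose (j + 1)) * (- (w + of_nat j)) / of_nat (j + 2)"
          using gchoose_Suc_mult[of "1 - w" "j + 1"]
          by (simp only:) (simp only: Suc_eq_plus1 add.assoc one_add_one)
        then show ?thesis by (simp only: mult_minus_right minus_divide_left)
      qed
      ultimately show ?thesis by (simp only:) simp
    qed
    then show ?thesis
      using hurwitz_recursion[OF x w g(2)] w by (simp add: e'_def sum_negf)
  qed
  moreover have "e' 1 = e 1"
  proof (rule holomorphic_halfplane_unique[where a = 0 and c = 1 and f = e' and g = e])
    show "e' holomorphic_on {w. 0 < Re w}" "e holomorphic_on {w. 0 < Re w}"
      by (rule holomorphic_on_subset[OF \<open>e' holomorphic_on _\<close>] holomorphic_on_subset[OF e(1)]; auto)+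
    show "e' w = e w" if "Re w > 1" for w using 1[OF that] e(2)[OF that] by simp
  qed auto
  ultimately show ?case using e(3) by (intro exI[of _ e']) auto
qed

lemma hurwitz_entire_exists:
  assumes x: "x > 0"
  shows "\<exists>E. E holomorphic_on UNIV \<and> (\<forall>w. Re w > 1 \<longrightarrow> E w = (w - 1) * shift_zeta_sum x w) \<and> E 1 = 1"
proof -
  obtain e where e: "\<And>N. e N holomorphic_on {w. Re w > - real N}"
     "\<And>N w. Re w > 1 \<Longrightarrow> e N w = (w - 1) * shift_zeta_sum x w" "\<And>N. e N 1 = 1"
    using hurwitz_strip[OF x] by metis
  obtain E where E: "E holomorphic_on UNIV" "\<And>N w. Re w > - real N \<Longrightarrow> E w = e N w"
    using holomorphic_glue[of e 1 "\<lambda>w. (w - 1) * shift_zeta_sum x w"] e by blast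
  then show ?thesis using e E(2)[of 0] by (intro exI[of _ E]) auto
qed

definition hurwitz_entire :: "real \<Rightarrow> complex \<Rightarrow> complex" where
  "hurwitz_entire x = (SOME E. E holomorphic_on UNIV \<and>
     (\<forall>w. Re w > 1 \<longrightarrow> E w = (w - 1) * shift_zeta_sum x w) \<and> E 1 = 1)"

lemma hurwitz_entire:
  assumes "x > 0"
  shows hurwitz_entire_holomorphic: "hurwitz_entire x holomorphic_on UNIV"
    and hurwitz_entire_eq: "\<And>w. Re w > 1 \<Longrightarrow> hurwitz_entire x w = (w - 1) * shift_zeta_sum x w"
    and hurwitz_entire_1: "hurwitz_entire x 1 = 1"
proof -
  have "hurwitz_entire x holomorphic_on UNIV \<and>
     (\<forall>w. Re w > 1 \<longrightarrow> hurwitz_entire x w = (w - 1) * shift_zeta_sum x w) \<and> hurwitz_entire x 1 = 1"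
    unfolding hurwitz_entire_def by (rule someI_ex[OF hurwitz_entire_exists[OF assms]])
  then show "hurwitz_entire x holomorphic_on UNIV"
    and "\<And>w. Re w > 1 \<Longrightarrow> hurwitz_entire x w = (w - 1) * shift_zeta_sum x w"
    and "hurwitz_entire x 1 = 1"
    by simp_all
qed

text \<open>Reflection: conjugating argument and value gives a function with the same series. It
  makes the derivatives at real points real, hence the multiple gamma values positive, so that
  powers of their products split.\<close>

lemma hurwitz_entire_cnj:
  assumes x: "x > 0"
  shows "hurwitz_entire x (cnj w) = cnj (hurwitz_entire x w)"
proof -
  have sz: "shift_zeta_sum x (cnj w) = cnj (shift_zeta_sum x w)" if "Re w > 1" for w
  proof -
    have "(\<lambda>m. cnj (of_real (real m + x) powr (- w))) sums cnj (shift_zeta_sum x w)"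
      using shift_zeta_sums[OF x, of "- w"] that by (simp add: sums_cnj)
    also have "(\<lambda>m. cnj (of_real (real m + x) powr (- w))) = (\<lambda>m. of_real (real m + x) powr (- cnj w))"
      using x by (intro ext) (simp add: cnj_powr)
    finally show ?thesis by (simp add: shift_zeta_sum_def sums_iff)
  qed
  have "cnj \<circ> hurwitz_entire x \<circ> cnj holomorphic_on UNIV"
    by (intro holomorphic_on_compose_cnj_cnj holomorphic_on_subset[OF hurwitz_entire_holomorphic[OF x]]) auto
  then have "(cnj \<circ> hurwitz_entire x \<circ> cnj) holomorphic_on {z. Re z > Re w - 1}"
    by (rule holomorphic_on_subset) simp
  moreover have "hurwitz_entire x holomorphic_on {z. Re z > Re w - 1}"
    by (rule holomorphic_on_subset[OF hurwitz_entire_holomorphic[OF x]]) simp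
  moreover have "(cnj \<circ> hurwitz_entire x \<circ> cnj) z = hurwitz_entire x z" if "Re z > 1" for z
  proof -
    have "hurwitz_entire x (cnj z) = cnj ((z - 1) * shift_zeta_sum x z)"
      using that by (subst hurwitz_entire_eq[OF x]) (simp_all only: sz[OF that], simp_all)
    then show ?thesis by (simp only: o_apply hurwitz_entire_eq[OF x that] complex_cnj_cnj)
  qed
  moreover have "Re w > Re w - 1" by simp
  ultimately have "(cnj \<circ> hurwitz_entire x \<circ> cnj) w = hurwitz_entire x w"
    by (rule holomorphic_halfplane_unique[where f = "cnj \<circ> hurwitz_entire x \<circ> cnj" and c = 1])
  from arg_cong[OF this, of cnj] show ?thesis by (simp only: o_apply complex_cnj_cnj)
qed

section \<open>Products of two shifted powers\<close>

text \<open>At the pole \<open>v = 1\<close> division by zero gives the value 0.\<close>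

definition hurwitz :: "real \<Rightarrow> complex \<Rightarrow> complex" where
  "hurwitz x v = hurwitz_entire x v / (v - 1)"

lemma hurwitz_sums:
  assumes "x > 0" "Re a < -1"
  shows "(\<lambda>m. of_real (real m + x) powr a) sums hurwitz x (- a)"
proof -
  have "- a - 1 \<noteq> 0" using assms(2) by (auto simp: complex_eq_iff)
  moreover have "Re (- a) > 1" using assms(2) by simp
  ultimately have "hurwitz x (- a) = shift_zeta_sum x (- a)"
    unfolding hurwitz_def by (subst hurwitz_entire_eq[OF assms(1)]) auto
  then show ?thesis using shift_zeta_sums[OF assms] by simp
qed

lemma hurwitz_holomorphic: "x > 0 \<Longrightarrow> hurwitz x holomorphic_on - {1}"
  unfolding hurwitz_def
  by (intro holomorphic_intros holomorphic_on_subset[OF hurwitz_entire_holomorphic]) auto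

lemma hurwitz_analytic: "x > 0 \<Longrightarrow> v \<noteq> 1 \<Longrightarrow> hurwitz x analytic_on {v}"
  by (rule holomorphic_on_imp_analytic_at[OF hurwitz_holomorphic]) auto

lemma hurwitz_has_derivative:
  "x > 0 \<Longrightarrow> v \<noteq> 1 \<Longrightarrow> (hurwitz x has_field_derivative deriv (hurwitz x) v) (at v)"
  by (rule holomorphic_derivI[OF hurwitz_holomorphic]) auto

lemma hurwitz_compose_analytic:
  assumes "x > 0" "f analytic_on {w}" "f w \<noteq> 1"
  shows "(\<lambda>w. hurwitz x (f w)) analytic_on {w}"
proof -
  have "(hurwitz x \<circ> f) analytic_on {w}"
    using assms by (intro analytic_on_compose) (auto simp: hurwitz_analytic)
  then show ?thesis by (simp add: o_def)
qed

lemma hurwitz_compose_meromorphic: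
  assumes "x > 0" "f analytic_on S"
  shows "(\<lambda>w. hurwitz x (f w)) meromorphic_on S"
proof -
  have "(hurwitz_entire x \<circ> f) analytic_on S"
  proof (rule analytic_on_compose[OF assms(2)])
    show "hurwitz_entire x analytic_on f ` S"
      by (rule analytic_on_subset[of _ UNIV]) (auto simp: analytic_on_open hurwitz_entire_holomorphic[OF assms(1)])
  qed
  then have "(\<lambda>w. hurwitz_entire x (f w)) meromorphic_on S"
    by (intro analytic_on_imp_meromorphic_on) (simp add: o_def)
  moreover have "f meromorphic_on S" using assms(2) by (rule analytic_on_imp_meromorphic_on)
  ultimately show ?thesis unfolding hurwitz_def by (intro meromorphic_intros)
qed

lemma hurwitz_deriv_real:
  assumes x: "x > 0" and v: "v \<in> \<real>" "v \<noteq> 1"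
  shows "deriv (hurwitz x) v \<in> \<real>"
proof -
  have cnj: "hurwitz x (cnj w) = cnj (hurwitz x w)" for w
    by (simp add: hurwitz_def hurwitz_entire_cnj[OF x])
  have "((\<lambda>t. hurwitz x (of_real t)) has_vector_derivative deriv (hurwitz x) v) (at (Re v))"
    using hurwitz_has_derivative[OF x v(2)] v(1)
    by (intro has_vector_derivative_real_field) (auto simp: Reals_def)
  then have d: "((\<lambda>t. Im (hurwitz x (of_real t))) has_real_derivative Im (deriv (hurwitz x) v)) (at (Re v))"
    by (simp add: has_real_derivative_iff_has_vector_derivative has_vector_derivative_complex_iff)
  have "Im (hurwitz x (of_real t)) = 0" for t
    using cnj[of "of_real t"] by (simp add: complex_eq_iff)
  then have "((\<lambda>t. Im (hurwitz x (of_real t))) has_real_derivative 0) (at (Re v))"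
    by simp
  with d have "Im (deriv (hurwitz x) v) = 0" using DERIV_unique by blast
  then show ?thesis by (simp add: complex_is_Real_iff)
qed

section \<open>Continuation of series of products\<close>

lemma analytic_gchoose [analytic_intros]:
  "f analytic_on S \<Longrightarrow> (\<lambda>w. (f w gchoose j) :: complex) analytic_on S"
  by (simp add: gbinomial_prod_rev atLeast0LessThan) (intro analytic_intros; simp)

text \<open>The exponents are arbitrary entire functions so that one expansion covers the spectral
  series, the series it is compared with, and constant exponents. The remainder converges on a
  half-plane that grows with \<open>J\<close>.\<close>

lemma shifted_expansion:
  fixes J :: nat
  assumes x: "x > 0" "x + u > 0" and p: "p holomorphic_on UNIV" "a holomorphic_on UNIV"
  defines "t \<equiv> \<lambda>m w. of_real (real m + x) powr (p w + a w) * binom_rem J (a w) (u / (real m + x))"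
  shows "\<exists>R. R holomorphic_on {w. Re (p w + a w) - real J < -1} \<and>
    (\<forall>w. Re (p w + a w) - real J < -1 \<longrightarrow> (\<lambda>m. t m w) sums R w \<and> (\<lambda>m. deriv (t m) w) sums deriv R w) \<and>
    (\<forall>w. Re (p w + a w) < -1 \<longrightarrow>
      (\<lambda>m. of_real (real m + x) powr p w * of_real (real m + x + u) powr a w) sums
        ((\<Sum>j<J. (a w gchoose j) * of_real u ^ j * hurwitz x (of_nat j - p w - a w)) + R w))"
proof -
  define S where "S = {w. Re (p w + a w) - real J < -1}"
  have "continuous_on UNIV p" "continuous_on UNIV a"
    using p holomorphic_on_imp_continuous_on by auto
  then have "open S" unfolding S_def by (intro open_Collect_less continuous_intros)
  have "\<exists>R. R holomorphic_on S \<and> (\<forall>w\<in>S. (\<lambda>m. t m w) sums R w \<and> (\<lambda>m. deriv (t m) w) sums deriv R w)"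
    unfolding t_def
  proof (rule binom_rem_sum[OF x \<open>open S\<close>])
    show "(\<lambda>w. p w + a w) holomorphic_on S" "a holomorphic_on S"
      using p by (auto intro!: holomorphic_on_add intro: holomorphic_on_subset)
  qed (auto simp: S_def)
  then obtain R where R: "R holomorphic_on S" "\<And>w. w \<in> S \<Longrightarrow> (\<lambda>m. t m w) sums R w"
      "\<And>w. w \<in> S \<Longrightarrow> (\<lambda>m. deriv (t m) w) sums deriv R w" by blast
  have "(\<lambda>m. of_real (real m + x) powr p w * of_real (real m + x + u) powr a w) sums
        ((\<Sum>j<J. (a w gchoose j) * of_real u ^ j * hurwitz x (of_nat j - p w - a w)) + R w)"
    if w: "Re (p w + a w) < -1" for w
  proof -
    have "(\<lambda>m. (\<Sum>j<J. (a w gchoose j) * of_real u ^ j * of_real (real m + x) powr (p w + a w - of_nat j)) + t m w)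
        sums ((\<Sum>j<J. (a w gchoose j) * of_real u ^ j * hurwitz x (- (p w + a w - of_nat j))) + R w)"
      using w x R(2)[of w]
      by (intro sums_add sums_sum sums_mult hurwitz_sums) (auto simp: S_def)
    moreover have "of_real (real m + x) powr p w * of_real (real m + x + u) powr a w =
        (\<Sum>j<J. (a w gchoose j) * of_real u ^ j * of_real (real m + x) powr (p w + a w - of_nat j)) + t m w" for m
      unfolding t_def using x by (intro powr_expand) linarith+
    moreover have "- (p w + a w - of_nat j) = of_nat j - p w - a w" for j
      by simp
    ultimately show ?thesis by (simp only:)
  qed
  then show ?thesis using R unfolding S_def by blast
qed

text \<open>Taking norms replaces the exponents by their real parts. With these the terms are
  positive, and the expansion with \<open>J = 0\<close> already gives convergence.\<close>

lemma shifted_norm_summable: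
  assumes x: "x > 0" "x + u > 0" and "Re (p + a) < -1"
  shows "summable (\<lambda>m. norm (of_real (real m + x) powr p * of_real (real m + x + u) powr a :: complex))"
proof -
  have "\<exists>R. (\<lambda>m. of_real (real m + x) powr of_real (Re p) * of_real (real m + x + u) powr of_real (Re a)) sums (R :: complex)"
  proof -
    have "Re (of_real (Re p) + of_real (Re a)) < -1" using assms(3) by simp
    then show ?thesis
      using shifted_expansion[OF x, of "\<lambda>_. of_real (Re p)" "\<lambda>_. of_real (Re a)" 0]
      by (simp only: holomorphic_on_const) blast
  qed
  then have "summable (\<lambda>m. of_real (real m + x) powr of_real (Re p) * of_real (real m + x + u) powr of_real (Re a) :: complex)"
    by (auto simp: summable_def)
  also have "(\<lambda>m. of_real (real m + x) powr of_real (Re p) * of_real (real m + x + u) powr of_real (Re a) :: complex) =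
      (\<lambda>m. of_real (norm (of_real (real m + x) powr p * of_real (real m + x + u) powr a :: complex)))"
  proof
    fix m
    have *: "real m + x > 0" "real m + x + u > 0" using x by linarith+
    have "norm (of_real (real m + x) powr p * of_real (real m + x + u) powr a :: complex) =
       (real m + x) powr Re p * (real m + x + u) powr Re a"
      using * by (simp only: norm_mult norm_powr_real_powr Reals_of_real Re_complex_of_real)
    then show "of_real (real m + x) powr of_real (Re p) * of_real (real m + x + u) powr of_real (Re a) =
      (of_real (norm (of_real (real m + x) powr p * of_real (real m + x + u) powr a :: complex)) :: complex)"
      using * by (simp only: powr_of_real of_real_mult less_imp_le)
  qed
  finally show ?thesis by (simp only: summable_complex_of_real)
qed

lemma shifted_global:
  assumes x: "x > 0" "x + u > 0"
  shows "\<exists>Z. Z nicely_meromorphic_on UNIV \<and> (\<forall>w. Re w > (real q + real b + 1) / 2 \<longrightarrow> Z analytic_on {w} \<and>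
     (\<lambda>m. of_real (real m + x) powr (of_nat q - w) * of_real (real m + x + u) powr (of_nat b - w)) sums Z w)"
proof -
  define p where "p = (\<lambda>w::complex. of_nat q - w)"
  define a where "a = (\<lambda>w::complex. of_nat b - w)"
  have hol: "p holomorphic_on UNIV" "a holomorphic_on UNIV"
    by (auto simp: p_def a_def intro!: holomorphic_intros)
  \<comment> \<open>For this \<open>J\<close> the remainder converges exactly for
    \<open>Re w > - N\<close>: its exponent has real part
    \<open>-1 - 2 * (Re w + N)\<close>.\<close>
  define J where "J N = q + b + 1 + 2 * N" for N
  define F where "F R N w = (\<Sum>j<J N. (a w gchoose j) * of_real u ^ j * hurwitz x (of_nat j - p w - a w)) + R w"
    for R N w
  define c where "c = (real q + real b + 1) / 2"
  have conv: "Re (p w + a w) < -1 \<longleftrightarrow> Re w > c" for w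
    by (auto simp: p_def a_def c_def field_simps)
  have ex: "\<forall>N. \<exists>R. R holomorphic_on {w. Re w > - real N} \<and> (\<forall>w. Re w > c \<longrightarrow>
     (\<lambda>m. of_real (real m + x) powr p w * of_real (real m + x + u) powr a w) sums F R N w)"
  proof
    fix N
    have "{w. Re w > - real N} \<subseteq> {w. Re (p w + a w) - real (J N) < -1}"
      by (auto simp: p_def a_def J_def)
    note sub = this
    obtain R' where R': "R' holomorphic_on {w. Re (p w + a w) - real (J N) < -1}"
      "\<And>w. Re (p w + a w) < -1 \<Longrightarrow>
        (\<lambda>m. of_real (real m + x) powr p w * of_real (real m + x + u) powr a w) sums F R' N w"
      using shifted_expansion[OF x hol, of "J N"] unfolding F_def by blast
    have "R' holomorphic_on {w. Re w > - real N} \<and> (\<forall>w. Re w > c \<longrightarrow>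
       (\<lambda>m. of_real (real m + x) powr p w * of_real (real m + x + u) powr a w) sums F R' N w)"
      using holomorphic_on_subset[OF R'(1) sub] R'(2)[unfolded conv] by (intro conjI allI impI)
    then show "\<exists>R. R holomorphic_on {w. Re w > - real N} \<and> (\<forall>w. Re w > c \<longrightarrow>
       (\<lambda>m. of_real (real m + x) powr p w * of_real (real m + x + u) powr a w) sums F R N w)"
      by (intro exI[of _ R'])
  qed
  obtain R where R': "\<forall>N. R N holomorphic_on {w. Re w > - real N} \<and> (\<forall>w. Re w > c \<longrightarrow>
     (\<lambda>m. of_real (real m + x) powr p w * of_real (real m + x + u) powr a w) sums F (R N) N w)"
    using choice[OF ex] by (elim exE)
  have R: "R N holomorphic_on {w. Re w > - real N}"
     "Re w > c \<Longrightarrow> (\<lambda>m. of_real (real m + x) powr p w * of_real (real m + x + u) powr a w) sums F (R N) N w" for N w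
    using spec[OF R', of N] by (simp_all only: simp_thms)
  have an: "p analytic_on S" "a analytic_on S" for S
    by (auto simp: p_def a_def intro!: analytic_intros)
  have an': "(\<lambda>w. of_nat j - p w - a w) analytic_on S" "(\<lambda>w. (a w gchoose j) * of_real u ^ j) analytic_on S" for j S
    using an by (auto intro!: analytic_intros)
  have mero: "F (R N) N meromorphic_on {w. Re w > - real N}" for N
  proof -
    have "R N meromorphic_on {w. Re w > - real N}"
      using R(1)[of N] by (intro analytic_on_imp_meromorphic_on) (simp add: analytic_on_open open_Re_gt)
    then show ?thesis
      unfolding F_def
      by (intro meromorphic_on_add meromorphic_on_sum meromorphic_on_mult[of "\<lambda>w. (a w gchoose j) * of_real u ^ j" for j]
          analytic_on_imp_meromorphic_on[OF an'(2)] hurwitz_compose_meromorphic x an'(1))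
  qed
  define h where "h w = (\<Sum>m. of_real (real m + x) powr p w * of_real (real m + x + u) powr a w)" for w
  have agree: "F (R N) N w = h w" if "Re w > c" for N w
    using R(2)[OF that, of N] by (simp add: h_def sums_iff)
  obtain Z where Z: "Z nicely_meromorphic_on UNIV" "\<And>N z. Re z > - real N \<Longrightarrow> Z z = remove_sings (F (R N) N) z"
    using meromorphic_glue[where f = "\<lambda>N. F (R N) N" and c = c and h = h] mero agree by metis
  have FA: "F (R 0) 0 analytic_on {w}" if "Re w > c" for w
  proof -
    have "c > 0" by (simp add: c_def)
    have "of_nat j - p w - a w \<noteq> 1" for j
    proof
      assume "of_nat j - p w - a w = 1"
      then have "Re (of_nat j - p w - a w) = 1" by (simp only: one_complex.sel)
      then show False using that conv[of w] by simp
    qed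
    moreover have "R 0 analytic_on {w}"
      using R(1)[of 0] that \<open>c > 0\<close> by (intro holomorphic_on_imp_analytic_at[of _ "{w. Re w > - real 0}"]) (auto simp: open_Re_gt)
    ultimately show ?thesis
      unfolding F_def using x
      by (intro analytic_on_add analytic_on_sum analytic_on_mult[OF an'(2)] hurwitz_compose_analytic an'(1))
  qed
  have "c > 0" by (simp add: c_def)
  have ZF: "Z w = F (R 0) 0 w" if "Re w > c" for w
    using Z(2)[of 0 w] that \<open>c > 0\<close> FA[OF that] by simp
  have "Z analytic_on {w}" if "Re w > c" for w
  proof -
    have "eventually (\<lambda>z. z \<in> {z. Re z > c}) (nhds w)"
      using that by (intro eventually_nhds_in_open open_Re_gt) auto
    then have "eventually (\<lambda>z. F (R 0) 0 z = Z z) (nhds w)" by eventually_elim (simp add: ZF)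
    then show ?thesis using analytic_at_cong[of "F (R 0) 0" Z w w] FA[OF that] by simp
  qed
  moreover have "(\<lambda>m. of_real (real m + x) powr (of_nat q - w) * of_real (real m + x + u) powr (of_nat b - w)) sums Z w"
    if "Re w > c" for w
    using R(2)[OF that, of 0] ZF[OF that] by (simp add: p_def a_def)
  ultimately have "Z nicely_meromorphic_on UNIV \<and> (\<forall>w. Re w > c \<longrightarrow> Z analytic_on {w} \<and>
     (\<lambda>m. of_real (real m + x) powr (of_nat q - w) * of_real (real m + x + u) powr (of_nat b - w)) sums Z w)"
    using Z(1) by simp
  then show ?thesis unfolding c_def by (intro exI[of _ Z])
qed

text \<open>The coefficient of index \<open>j = q + b + 1\<close>, divided by its simple zero at
  \<open>e = 0\<close>. This is the index at which the Hurwitz zeta function is evaluated at its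
  pole when \<open>e = 0\<close>.\<close>

definition pole_coeff :: "nat \<Rightarrow> nat \<Rightarrow> complex \<Rightarrow> complex" where
  "pole_coeff q b e = - (\<Prod>k=1..b. of_nat k - e) * (\<Prod>k=1..q. - of_nat k - e) / fact (q + b + 1)"

text \<open>The factors \<open>b - e - i\<close> of the falling factorial with \<open>i < b\<close>,
  \<open>i = b\<close> and \<open>i > b\<close> yield the first product, the factor
  \<open>- e\<close> and the second product.\<close>

lemma gchoose_pole_coeff:
  "((of_nat b - e :: complex) gchoose (q + b + 1)) = e * pole_coeff q b e"
proof -
  have 1: "(\<Prod>i<b. of_nat b - e - of_nat i) = (\<Prod>k=1..b. of_nat k - e)"
    by (rule prod.reindex_bij_witness[of _ "\<lambda>k. b - k" "\<lambda>i. b - i"]) (auto simp: of_nat_diff)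
  have "(\<Prod>i<q + b + 1. of_nat b - e - of_nat i) =
      (\<Prod>i<b. of_nat b - e - of_nat i) * (- e) * (\<Prod>k=1..q. - of_nat k - e)"
    by (induction q) (auto simp: algebra_simps)
  then show ?thesis
    by (simp add: gbinomial_prod_rev atLeast0LessThan pole_coeff_def 1)
qed

lemma has_field_derivative_prod_linear:
  fixes c :: "'i \<Rightarrow> complex"
  assumes "finite A" "\<And>i. i \<in> A \<Longrightarrow> c i \<noteq> 0"
  shows "((\<lambda>e. \<Prod>i\<in>A. c i - e) has_field_derivative - (\<Prod>i\<in>A. c i) * (\<Sum>i\<in>A. 1 / c i)) (at 0)"
  using assms
proof (induction rule: finite_induct)
  case (insert a A)
  then have "((\<lambda>e. \<Prod>i\<in>A. c i - e) has_field_derivative - (\<Prod>i\<in>A. c i) * (\<Sum>i\<in>A. 1 / c i)) (at 0)"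
    by simp
  note IH = this
  have "((\<lambda>e. c a - e) has_field_derivative -1) (at 0)"
    by (auto intro!: derivative_eq_intros)
  from DERIV_mult[OF this IH]
  have "((\<lambda>e. (c a - e) * (\<Prod>i\<in>A. c i - e)) has_field_derivative
      - (\<Prod>i\<in>A. c i) + - (\<Prod>i\<in>A. c i) * (\<Sum>i\<in>A. 1 / c i) * c a) (at 0)"
    by simp
  moreover have "- (\<Prod>i\<in>A. c i) + - (\<Prod>i\<in>A. c i) * (\<Sum>i\<in>A. 1 / c i) * c a =
      - (\<Prod>i\<in>insert a A. c i) * (\<Sum>i\<in>insert a A. 1 / c i)"
    using insert by (simp add: field_simps)
  ultimately show ?case using insert by simp
qed simp

text \<open>Logarithmic differentiation: the two products contribute harmonic numbers of opposite
  sign. Their difference is the source of \<open>harm_between\<close> in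
  \<open>f_poly\<close>.\<close>

lemma pole_coeff_has_derivative:
  "(pole_coeff q b has_field_derivative pole_coeff q b 0 * ((\<Sum>k=1..q. 1 / of_nat k) - (\<Sum>k=1..b. 1 / of_nat k))) (at 0)"
proof -
  have 1: "((\<lambda>e. \<Prod>k=1..b. of_nat k - e) has_field_derivative
      - (\<Prod>k=1..b. of_nat k) * (\<Sum>k=1..b. 1 / of_nat k)) (at (0::complex))"
    by (rule has_field_derivative_prod_linear) auto
  have 2: "((\<lambda>e. \<Prod>k=1..q. - of_nat k - e) has_field_derivative
      - (\<Prod>k=1..q. - of_nat k) * (\<Sum>k=1..q. 1 / - of_nat k)) (at (0::complex))"
    by (rule has_field_derivative_prod_linear) auto
  have "((\<lambda>e. - ((\<Prod>k=1..b. of_nat k - e) * (\<Prod>k=1..q. - of_nat k - e) / fact (q + b + 1))) has_field_derivative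
    - ((- (\<Prod>k=1..b. of_nat k) * (\<Sum>k=1..b. 1 / of_nat k) * (\<Prod>k=1..q. - of_nat k - 0) +
      - (\<Prod>k=1..q. - of_nat k) * (\<Sum>k=1..q. 1 / - of_nat k) * (\<Prod>k=1..b. of_nat k - 0)) / fact (q + b + 1))) (at (0::complex))"
    by (intro DERIV_minus DERIV_cdivide DERIV_mult 1 2)
  moreover have "pole_coeff q b = (\<lambda>e. - ((\<Prod>k=1..b. of_nat k - e) * (\<Prod>k=1..q. - of_nat k - e) / fact (q + b + 1)))"
    by (simp only: pole_coeff_def fun_eq_iff mult_minus_left minus_divide_left simp_thms)
  moreover have "- ((- (\<Prod>k=1..b. of_nat k) * (\<Sum>k=1..b. 1 / of_nat k) * (\<Prod>k=1..q. - of_nat k - 0) +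
      - (\<Prod>k=1..q. - of_nat k) * (\<Sum>k=1..q. 1 / - of_nat k) * (\<Prod>k=1..b. of_nat k - 0)) / fact (q + b + 1))
    = pole_coeff q b 0 * ((\<Sum>k=1..q. 1 / of_nat k) - (\<Sum>k=1..b. 1 / of_nat k))"
    unfolding pole_coeff_def by (simp add: sum_negf field_simps del: fact_Suc)
  ultimately show ?thesis by (simp only:)
qed

lemma pole_coeff_0:
  "pole_coeff q b 0 = (-1) ^ (q + 1) * fact b * fact q / fact (q + b + 1)"
proof -
  have "(\<Prod>k=1..q. - of_nat k) = (-1) ^ q * (fact q :: complex)"
    by (simp add: fact_prod prod_uminus)
  then show ?thesis by (simp add: pole_coeff_def fact_prod)
qed

text \<open>The binomial theorem is exact once \<open>J\<close> exceeds the exponent. Hence, at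
  \<open>w = 0\<close>, only the derivative of the remainder factor itself matters.\<close>

lemma binom_rem_of_nat:
  assumes "b < J" "v > -1"
  shows "binom_rem J (of_nat b) v = 0"
proof -
  have ne: "1 + of_real v \<noteq> (0::complex)"
    using assms(2) by (metis add.commute less_irrefl of_real_1 of_real_add of_real_eq_0_iff add_eq_0_iff)
  have "(1 + of_real v) powr (of_nat b :: complex) = (\<Sum>k\<le>b. of_nat (b choose k) * of_real v ^ k)"
    using ne binomial_ring[of "of_real v :: complex" 1 b] by (simp add: powr_nat' add.commute[of 1])
  also have "\<dots> = (\<Sum>j<J. (of_nat b gchoose j) * of_real v ^ j)"
    using assms(1) by (intro sum.mono_neutral_cong_left) (auto simp: binomial_gbinomial[symmetric])
  finally show ?thesis by (simp add: binom_rem_def)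
qed

lemma analytic_at_eventually:
  assumes "f analytic_on {z}"
  shows "eventually (\<lambda>w. f analytic_on {w}) (nhds z)"
proof -
  obtain s where s: "open s" "z \<in> s" "f holomorphic_on s" using assms by (auto simp: analytic_at)
  have "eventually (\<lambda>w. w \<in> s) (nhds z)" using s by (intro eventually_nhds_in_open)
  then show ?thesis by eventually_elim (use s in \<open>auto simp: analytic_at\<close>)
qed

lemma remove_sings_eq_analytic:
  assumes V: "V analytic_on {z}" and S: "open S" "z \<in> S"
    and eq: "\<And>w. w \<in> S \<Longrightarrow> eventually (\<lambda>w. G w = V w) (at w)"
  shows "eventually (\<lambda>w. remove_sings G w = V w) (nhds z)"
proof -
  have "eventually (\<lambda>w. w \<in> S) (nhds z)" using S by (intro eventually_nhds_in_open)
  with analytic_at_eventually[OF V] show ?thesis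
  proof eventually_elim
    case (elim w)
    have "remove_sings G w = remove_sings V w" by (intro remove_sings_cong eq elim refl)
    then show ?case using elim by simp
  qed
qed

text \<open>
  The last summand comes from the pole term and is the only one that is not affine in \<open>k\<close>. For \<open>k = 2\<close>
  both factors carry the exponent \<open>- w\<close>, for \<open>k = 1\<close> only the second one; comparing the two cases
  isolates the anomaly.
\<close>

lemma continuation_deriv:
  fixes x u :: real and q b :: nat
  assumes x: "x > 0" "x + u > 0"
  shows "\<exists>A. \<forall>k\<ge>1. \<forall>G c. G meromorphic_on UNIV \<longrightarrow> (\<forall>w. Re w > c \<longrightarrow>
     (\<lambda>m. of_real (real m + x) powr (of_nat q - (of_nat k - 1) * w) * of_real (real m + x + u) powr (of_nat b - w)) sums G w) \<longrightarrow>
     remove_sings G analytic_on {0} \<and> deriv (remove_sings G) 0 =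
       A + of_nat k * (\<Sum>j<q+b+1. of_nat (b choose j) * of_real u ^ j * deriv (hurwitz x) (of_nat j - of_nat (q + b)))
         + of_real u ^ (q + b + 1) * deriv (pole_coeff q b) 0 / of_nat k"
proof -
  define D where "D j = deriv (\<lambda>w. (of_nat b - w :: complex) gchoose j) 0" for j
  \<comment> \<open>The least \<open>J\<close> for which the remainder converges near
    \<open>w = 0\<close>: one term beyond the pole term \<open>j = q + b + 1\<close>.\<close>
  define J where "J = q + b + 2"
  define \<rho> where "\<rho> = (\<Sum>m. of_real (real m + x) powr of_nat (q + b) *
     deriv (\<lambda>w. binom_rem J (of_nat b - w) (u / (real m + x))) 0)"
  \<comment> \<open>\<open>A\<close> collects all that is independent of \<open>k\<close>:
    derivatives of the coefficients, the remainder, and the derivative of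
    \<open>hurwitz_entire x\<close>, where the factor \<open>k\<close> from the chain rule cancels
    the \<open>k\<close> in the denominator of the pole term.\<close>
  define A where "A = (\<Sum>j<q+b+1. D j * of_real u ^ j * hurwitz x (of_nat j - of_nat (q + b)))
      + of_real u ^ (q + b + 1) * pole_coeff q b 0 * deriv (hurwitz_entire x) 1 + \<rho>"
  have v: "u / (real m + x) > -1" for m using x by (simp add: field_simps)
  show ?thesis
  proof (intro exI[of _ A] allI impI)
    fix k :: nat and G :: "complex \<Rightarrow> complex" and c :: real
    assume k: "k \<ge> 1" and G: "G meromorphic_on UNIV"
      and Gs: "\<forall>w. Re w > c \<longrightarrow> (\<lambda>m. of_real (real m + x) powr (of_nat q - (of_nat k - 1) * w) *
         of_real (real m + x + u) powr (of_nat b - w)) sums G w"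
    define p where "p = (\<lambda>w::complex. of_nat q - (of_nat k - 1) * w)"
    define a where "a = (\<lambda>w::complex. of_nat b - w)"
    have pa: "p w + a w = of_nat (q + b) - of_nat k * w" for w by (simp add: p_def a_def algebra_simps)
    have pa': "of_nat j - p w - a w = of_nat j - of_nat (q + b) + of_nat k * w" for w j
      by (simp add: p_def a_def algebra_simps)
    have Re_pa: "Re (p w + a w) = real (q + b) - real k * Re w" for w
      by (simp only: pa) simp
    have hol: "p holomorphic_on UNIV" "a holomorphic_on UNIV"
      by (auto simp: p_def a_def intro!: holomorphic_intros)
    define S where "S = {w. Re w > - (1 / real k)}"
    have S: "{w. Re (p w + a w) - real J < -1} = S"
      unfolding S_def Re_pa J_def using k by (auto simp: field_simps)
    define t where "t m w = of_real (real m + x) powr (p w + a w) * binom_rem J (a w) (u / (real m + x))" for m w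
    obtain R where R: "R holomorphic_on S" "\<And>w. w \<in> S \<Longrightarrow> (\<lambda>m. deriv (t m) w) sums deriv R w"
      "\<And>w. Re (p w + a w) < -1 \<Longrightarrow>
      (\<lambda>m. of_real (real m + x) powr p w * of_real (real m + x + u) powr a w) sums
        ((\<Sum>j<J. (a w gchoose j) * of_real u ^ j * hurwitz x (of_nat j - p w - a w)) + R w)"
      using shifted_expansion[OF x hol, of J] unfolding S[symmetric] t_def[abs_def] by auto
    have oS: "open S" "0 \<in> S" using k by (auto simp: S_def open_Re_gt)
    \<comment> \<open>In the pole term the Hurwitz zeta function is
      \<open>hurwitz_entire x (1 + k * w) / (k * w)\<close> and the coefficient is
      \<open>w * pole_coeff q b w\<close>. \<open>V\<close> is the expansion after cancelling
      \<open>w\<close>, which makes it analytic at 0.\<close>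
    define V where "V w = (\<Sum>j<q+b+1. (a w gchoose j) * of_real u ^ j * hurwitz x (of_nat j - of_nat (q + b) + of_nat k * w))
       + of_real u ^ (q + b + 1) * (pole_coeff q b w / of_nat k) * hurwitz_entire x (1 + of_nat k * w) + R w" for w
    have entire: "hurwitz_entire x analytic_on T" for T
      by (rule analytic_on_subset[of _ UNIV]) (auto simp: analytic_on_open hurwitz_entire_holomorphic[OF x(1)])
    have ent: "(\<lambda>w. hurwitz_entire x (1 + of_nat k * w)) analytic_on T" for T
    proof -
      have "(hurwitz_entire x \<circ> (\<lambda>w. 1 + of_nat k * w)) analytic_on T"
        by (intro analytic_on_compose entire analytic_intros)
      then show ?thesis by (simp add: o_def)
    qed
    have apc: "pole_coeff q b analytic_on T" for T
      unfolding pole_coeff_def by (intro analytic_intros fact_nonzero)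
    have aa: "a analytic_on T" for T unfolding a_def by (intro analytic_intros)
    have aR: "R analytic_on S" using R(1) oS by (simp add: analytic_on_open)
    have aV: "V analytic_on {0}"
    proof -
      have "of_nat j - of_nat (q + b) + of_nat k * 0 \<noteq> (1::complex)" if "j < q + b + 1" for j
      proof
        assume "of_nat j - of_nat (q + b) + of_nat k * 0 = (1::complex)"
        then have "of_nat j = (of_nat (q + b + 1) :: complex)" by (simp add: algebra_simps)
        then show False using that by (simp only: of_nat_eq_iff)
      qed
      then show ?thesis
        unfolding V_def[abs_def] using aR oS x
        by (intro analytic_on_add analytic_on_sum analytic_on_mult analytic_gchoose aa ent apc
            analytic_on_const analytic_on_divide hurwitz_compose_analytic analytic_on_diff analytic_on_ident
            analytic_on_subset[OF aR]) (use k in auto)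
    qed
    have mV: "V meromorphic_on S"
      unfolding V_def[abs_def] using x k
      by (intro meromorphic_on_add meromorphic_on_sum meromorphic_on_mult hurwitz_compose_meromorphic
          analytic_on_imp_meromorphic_on[OF ent] analytic_on_imp_meromorphic_on[OF aR]
          analytic_on_imp_meromorphic_on[OF analytic_gchoose[OF aa]]
          analytic_on_imp_meromorphic_on[OF apc] meromorphic_on_divide
          meromorphic_on_const analytic_intros)
    have GV: "G w = V w" if w: "Re w > max c (real (q + b + 1))" for w
    proof -
      have "real k * Re w \<ge> 1 * Re w" using k w by (intro mult_right_mono) auto
      moreover have "Re w > real (q + b) + 1" using w by simp
      ultimately have conv: "Re (p w + a w) < -1" unfolding Re_pa by linarith
      have w0: "w \<noteq> 0" using w by auto
      have "G w = (\<Sum>j<J. (a w gchoose j) * of_real u ^ j * hurwitz x (of_nat j - p w - a w)) + R w"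
        using Gs w R(3)[OF conv] unfolding p_def a_def by (intro sums_unique2) auto
      also have "(\<Sum>j<J. (a w gchoose j) * of_real u ^ j * hurwitz x (of_nat j - p w - a w)) =
         (\<Sum>j<q+b+1. (a w gchoose j) * of_real u ^ j * hurwitz x (of_nat j - p w - a w)) +
         (a w gchoose (q+b+1)) * of_real u ^ (q+b+1) * hurwitz x (of_nat (q+b+1) - p w - a w)"
        unfolding J_def by simp
      also have "hurwitz x (of_nat (q+b+1) - p w - a w) = hurwitz_entire x (1 + of_nat k * w) / (of_nat k * w)"
        unfolding pa' by (simp add: hurwitz_def)
      also have "a w gchoose (q+b+1) = w * pole_coeff q b w"
        unfolding a_def by (rule gchoose_pole_coeff)
      finally show ?thesis
        using w0 k unfolding V_def pa' by simp
    qed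
    have ev: "eventually (\<lambda>w. G w = V w) (at z)" if "z \<in> S" for z
      using meromorphic_halfplane_unique[where f = G and g = V and a = "- (1 / real k)" and z = z
          and c = "max c (real (q + b + 1))",
          OF meromorphic_on_subset[OF G subset_UNIV] mV[unfolded S_def] GV] that
      by (simp add: S_def)
    have near: "eventually (\<lambda>w. remove_sings G w = V w) (nhds 0)"
      by (rule remove_sings_eq_analytic[OF aV oS ev])
    \<comment> \<open>The remainder factor vanishes at 0, so the product rule leaves only its own
      derivative. The other factor, whose exponent depends on \<open>k\<close>, is merely evaluated
      at 0, where \<open>k\<close> disappears.\<close>
    have R0: "deriv R 0 = \<rho>"
    proof -
      have "deriv (t m) 0 = of_real (real m + x) powr of_nat (q + b) *
          deriv (\<lambda>w. binom_rem J (of_nat b - w) (u / (real m + x))) 0" for m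
      proof -
        have "(\<lambda>w. binom_rem J (of_nat b - w) (u / (real m + x))) holomorphic_on UNIV"
          by (intro holomorphic_intros v)
        then have 1: "((\<lambda>w. binom_rem J (of_nat b - w) (u / (real m + x))) has_field_derivative
            deriv (\<lambda>w. binom_rem J (of_nat b - w) (u / (real m + x))) 0) (at 0)"
          by (rule holomorphic_derivI) auto
        have ne: "of_real (real m + x) \<noteq> (0::complex)"
          using shift_nonzero[OF x(1), of m] by simp
        have "(\<lambda>w. of_real (real m + x) powr (p w + a w)) holomorphic_on UNIV"
          using ne hol by (intro holomorphic_intros) auto
        then have 2: "((\<lambda>w. of_real (real m + x) powr (p w + a w)) has_field_derivative
            deriv (\<lambda>w. of_real (real m + x) powr (p w + a w)) 0) (at 0)"
          by (rule holomorphic_derivI) auto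
        have "binom_rem J (of_nat b) (u / (real m + x)) = 0"
          by (rule binom_rem_of_nat[OF _ v]) (simp add: J_def)
        then show ?thesis
          unfolding t_def using DERIV_mult[OF 2 1] by (intro DERIV_imp_deriv) (simp add: a_def p_def mult.commute)
      qed
      then show ?thesis using R(2)[OF oS(2)] by (simp add: \<rho>_def sums_iff)
    qed
    have "(V has_field_derivative
        (\<Sum>j<q+b+1. of_real u ^ j * (D j * hurwitz x (of_nat j - of_nat (q + b)) +
            of_nat k * deriv (hurwitz x) (of_nat j - of_nat (q + b)) * of_nat (b choose j)))
        + of_real u ^ (q + b + 1) * (deriv (pole_coeff q b) 0 / of_nat k + of_nat k * deriv (hurwitz_entire x) 1 * (pole_coeff q b 0 / of_nat k))
        + \<rho>) (at 0)"
    proof -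
      have t1: "((\<lambda>w. (a w gchoose j) * of_real u ^ j * hurwitz x (of_nat j - of_nat (q + b) + of_nat k * w)) has_field_derivative
         of_real u ^ j * (D j * hurwitz x (of_nat j - of_nat (q + b)) +
            of_nat k * deriv (hurwitz x) (of_nat j - of_nat (q + b)) * of_nat (b choose j))) (at 0)"
        if j: "j < q + b + 1" for j
      proof -
        have "of_nat j - of_nat (q + b) \<noteq> (1::complex)"
        proof
          assume "of_nat j - of_nat (q + b) = (1::complex)"
          then have "of_nat j = (of_nat (q + b + 1) :: complex)" by (simp add: algebra_simps)
          then show False using j by (simp only: of_nat_eq_iff)
        qed
        then have "(hurwitz x has_field_derivative deriv (hurwitz x) (of_nat j - of_nat (q + b))) (at (of_nat j - of_nat (q + b) + of_nat k * 0))"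
          using hurwitz_has_derivative[OF x(1)] by simp
        moreover have "((\<lambda>w. of_nat j - of_nat (q + b) + of_nat k * w) has_field_derivative of_nat k) (at (0::complex))"
          by (auto intro!: derivative_eq_intros)
        ultimately have 1: "((\<lambda>w. hurwitz x (of_nat j - of_nat (q + b) + of_nat k * w)) has_field_derivative
            deriv (hurwitz x) (of_nat j - of_nat (q + b)) * of_nat k) (at 0)"
          by (rule DERIV_chain2[where g = "\<lambda>w. of_nat j - of_nat (q + b) + of_nat k * w"])
        have "(\<lambda>w. (of_nat b - w :: complex) gchoose j) holomorphic_on UNIV"
          by (intro holomorphic_intros)
        then have 2: "((\<lambda>w. a w gchoose j) has_field_derivative D j) (at 0)"
          unfolding D_def a_def by (rule holomorphic_derivI) auto
        have "((\<lambda>w. of_real u ^ j * ((a w gchoose j) * hurwitz x (of_nat j - of_nat (q + b) + of_nat k * w))) has_field_derivative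
           of_real u ^ j * (D j * hurwitz x (of_nat j - of_nat (q + b) + of_nat k * 0) +
            deriv (hurwitz x) (of_nat j - of_nat (q + b)) * of_nat k * (a 0 gchoose j))) (at 0)"
          by (intro DERIV_cmult DERIV_mult 1 2)
        then show ?thesis by (simp add: a_def binomial_gbinomial mult_ac)
      qed
      have "(hurwitz_entire x has_field_derivative deriv (hurwitz_entire x) 1) (at (1 + of_nat k * 0))"
        using holomorphic_derivI[OF hurwitz_entire_holomorphic[OF x(1)] open_UNIV] by simp
      moreover have "((\<lambda>w. 1 + of_nat k * w) has_field_derivative of_nat k) (at (0::complex))"
        by (auto intro!: derivative_eq_intros)
      ultimately have t2: "((\<lambda>w. hurwitz_entire x (1 + of_nat k * w)) has_field_derivative deriv (hurwitz_entire x) 1 * of_nat k) (at 0)"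
        by (rule DERIV_chain2[where g = "\<lambda>w. 1 + of_nat k * w"])
      have t3: "(pole_coeff q b has_field_derivative deriv (pole_coeff q b) 0) (at 0)"
        using pole_coeff_has_derivative DERIV_imp_deriv by metis
      have t4: "(R has_field_derivative \<rho>) (at 0)"
        using holomorphic_derivI[OF R(1) oS] R0 by simp
      have "((\<lambda>w. (\<Sum>j<q+b+1. (a w gchoose j) * of_real u ^ j * hurwitz x (of_nat j - of_nat (q + b) + of_nat k * w))
         + of_real u ^ (q + b + 1) * ((pole_coeff q b w / of_nat k) * hurwitz_entire x (1 + of_nat k * w)) + R w) has_field_derivative
        (\<Sum>j<q+b+1. of_real u ^ j * (D j * hurwitz x (of_nat j - of_nat (q + b)) +
            of_nat k * deriv (hurwitz x) (of_nat j - of_nat (q + b)) * of_nat (b choose j)))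
        + of_real u ^ (q + b + 1) * (deriv (pole_coeff q b) 0 / of_nat k * hurwitz_entire x (1 + of_nat k * 0) +
            deriv (hurwitz_entire x) 1 * of_nat k * (pole_coeff q b 0 / of_nat k)) + \<rho>) (at 0)"
        by (intro DERIV_add DERIV_sum DERIV_cmult DERIV_mult DERIV_cdivide t1 t2 t3 t4) simp
      then show ?thesis
        by (simp add: V_def[abs_def] hurwitz_entire_1[OF x(1)] mult_ac)
    qed
    then have "deriv V 0 = A + of_nat k * (\<Sum>j<q+b+1. of_nat (b choose j) * of_real u ^ j * deriv (hurwitz x) (of_nat j - of_nat (q + b)))
         + of_real u ^ (q + b + 1) * deriv (pole_coeff q b) 0 / of_nat k"
      using k by (subst DERIV_imp_deriv) (auto simp: A_def sum.distrib sum_distrib_left algebra_simps)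
    moreover have "deriv (remove_sings G) 0 = deriv V 0"
      by (rule deriv_cong_ev[OF near refl])
    moreover have "remove_sings G analytic_on {0}"
      using analytic_at_cong[OF near refl] aV by simp
    ultimately show "remove_sings G analytic_on {0} \<and> deriv (remove_sings G) 0 =
       A + of_nat k * (\<Sum>j<q+b+1. of_nat (b choose j) * of_real u ^ j * deriv (hurwitz x) (of_nat j - of_nat (q + b)))
         + of_real u ^ (q + b + 1) * deriv (pole_coeff q b) 0 / of_nat k"
      by simp
  qed
qed

section \<open>Barnes zeta functions\<close>

text \<open>The continuation of the series with terms
  \<open>poly p (m + x) * (m + x) powr (- w)\<close>, written as a combination of shifted Hurwitz
  zeta functions.\<close>

definition hurwitz_poly :: "real \<Rightarrow> real poly \<Rightarrow> complex \<Rightarrow> complex" where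
  "hurwitz_poly x p w = (\<Sum>i\<le>degree p. of_real (coeff p i) * hurwitz x (w - of_nat i))"

text \<open>The derivative of \<open>hurwitz_poly x p\<close> at 0, that is, minus the regularised
  sum of \<open>poly p (m + x) * ln (m + x)\<close>. It is linear in \<open>p\<close>, so identities
  between polynomials become identities between logarithms of gamma values.\<close>

definition hurwitz_poly_deriv :: "real \<Rightarrow> real poly \<Rightarrow> complex" where
  "hurwitz_poly_deriv x p = (\<Sum>i\<le>degree p. of_real (coeff p i) * deriv (hurwitz x) (- of_nat i))"

lemma hurwitz_poly_deriv_altdef:
  assumes "degree p \<le> N"
  shows "hurwitz_poly_deriv x p = (\<Sum>i\<le>N. of_real (coeff p i) * deriv (hurwitz x) (- of_nat i))"
  unfolding hurwitz_poly_deriv_def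
  by (rule sum.mono_neutral_left) (use assms in \<open>auto simp: coeff_eq_0\<close>)

lemma hurwitz_poly_deriv_add: "hurwitz_poly_deriv x (p + q) = hurwitz_poly_deriv x p + hurwitz_poly_deriv x q"
proof -
  define N where "N = max (degree p) (degree q)"
  have "degree p \<le> N" "degree q \<le> N" "degree (p + q) \<le> N"
    by (auto simp: N_def degree_add_le)
  then show ?thesis by (simp add: hurwitz_poly_deriv_altdef[of _ N] sum.distrib algebra_simps)
qed

lemma hurwitz_poly_deriv_0 [simp]: "hurwitz_poly_deriv x 0 = 0"
  by (simp add: hurwitz_poly_deriv_def)

lemma hurwitz_poly_deriv_smult: "hurwitz_poly_deriv x (smult c p) = of_real c * hurwitz_poly_deriv x p"
  using hurwitz_poly_deriv_altdef[OF degree_smult_le[of c p], of x]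
  by (simp add: hurwitz_poly_deriv_def sum_distrib_left mult_ac)

lemma hurwitz_poly_deriv_uminus: "hurwitz_poly_deriv x (- p) = - hurwitz_poly_deriv x p"
  using hurwitz_poly_deriv_smult[of x "-1" p] by simp

lemma hurwitz_poly_deriv_sum: "hurwitz_poly_deriv x (\<Sum>i\<in>I. f i) = (\<Sum>i\<in>I. hurwitz_poly_deriv x (f i))"
  by (induction I rule: infinite_finite_induct) (auto simp: hurwitz_poly_deriv_add)

lemma hurwitz_poly_deriv_monom: "hurwitz_poly_deriv x (monom c n) = of_real c * deriv (hurwitz x) (- of_nat n)"
proof -
  have "hurwitz_poly_deriv x (monom c n) = (\<Sum>i\<le>n. if i = n then of_real c * deriv (hurwitz x) (- of_nat n) else 0)"
    unfolding hurwitz_poly_deriv_altdef[OF degree_monom_le] by (intro sum.cong) auto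
  then show ?thesis by simp
qed

lemma hurwitz_poly_deriv_real:
  assumes "x > 0"
  shows "hurwitz_poly_deriv x p \<in> \<real>"
proof -
  have "deriv (hurwitz x) (- of_nat i) \<in> \<real>" for i
  proof (rule hurwitz_deriv_real[OF assms])
    have "Re (- of_nat i) \<noteq> Re 1" by simp
    then show "- of_nat i \<noteq> (1::complex)" by metis
  qed auto
  then show ?thesis unfolding hurwitz_poly_deriv_def by (intro sum_in_Reals) auto
qed

lemma hurwitz_poly_meromorphic:
  "x > 0 \<Longrightarrow> hurwitz_poly x p meromorphic_on UNIV"
  unfolding hurwitz_poly_def
  by (intro meromorphic_intros hurwitz_compose_meromorphic analytic_intros)

lemma hurwitz_poly_analytic:
  assumes "x > 0" "Re w < 1 \<or> Re w > real (degree p) + 1"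
  shows "hurwitz_poly x p analytic_on {w}"
proof -
  have "w - of_nat i \<noteq> 1" if "i \<le> degree p" for i
  proof
    assume "w - of_nat i = 1"
    then have "Re (w - of_nat i) = 1" by (simp only: one_complex.sel)
    then show False using assms(2) that by auto
  qed
  then show ?thesis
    unfolding hurwitz_poly_def using assms(1)
    by (intro analytic_intros hurwitz_compose_analytic) auto
qed

lemma deriv_hurwitz_poly:
  assumes "x > 0"
  shows "deriv (hurwitz_poly x p) 0 = hurwitz_poly_deriv x p"
proof (rule DERIV_imp_deriv)
  have "((\<lambda>w. hurwitz x (w - of_nat i)) has_field_derivative deriv (hurwitz x) (- of_nat i)) (at 0)" for i
  proof -
    have "Re (- of_nat i) \<noteq> Re 1" by simp
    then have "- of_nat i \<noteq> (1::complex)" by metis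
    then have "(hurwitz x has_field_derivative deriv (hurwitz x) (- of_nat i)) (at (0 - of_nat i))"
      using hurwitz_has_derivative[OF assms] by simp
    moreover have "((\<lambda>w. w - of_nat i) has_field_derivative 1) (at (0::complex))"
      by (auto intro!: derivative_eq_intros)
    ultimately have "((\<lambda>w. hurwitz x (w - of_nat i)) has_field_derivative deriv (hurwitz x) (- of_nat i) * 1) (at 0)"
      by (rule DERIV_chain2[where g = "\<lambda>w. w - of_nat i"])
    then show ?thesis by simp
  qed
  then show "(hurwitz_poly x p has_field_derivative hurwitz_poly_deriv x p) (at 0)"
    unfolding hurwitz_poly_def[abs_def] hurwitz_poly_deriv_def
    by (intro DERIV_sum DERIV_cmult)
qed

lemma has_sum_finite_sum:
  fixes f :: "'i \<Rightarrow> 'b \<Rightarrow> 'a :: {topological_comm_monoid_add}"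
  assumes "\<And>i. i \<in> I \<Longrightarrow> (f i has_sum s i) A"
  shows "((\<lambda>x. \<Sum>i\<in>I. f i x) has_sum (\<Sum>i\<in>I. s i)) A"
  using assms by (induction I rule: infinite_finite_induct) (auto intro!: has_sum_add)

lemma hurwitz_poly_has_sum:
  assumes x: "x > 0" and w: "Re w > real (degree p) + 1"
  shows "((\<lambda>m. of_real (poly p (real m + x)) * of_real (real m + x) powr (- w)) has_sum hurwitz_poly x p w) UNIV"
proof -
  have "((\<lambda>m. \<Sum>i\<le>degree p. of_real (coeff p i) * of_real (real m + x) powr (of_nat i - w)) has_sum
      (\<Sum>i\<le>degree p. of_real (coeff p i) * hurwitz x (- (of_nat i - w)))) UNIV"
    using w x by (intro has_sum_finite_sum has_sum_cmult_right norm_summable_imp_has_sum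
        norm_summable_shift_powr hurwitz_sums) auto
  moreover have "(\<Sum>i\<le>degree p. of_real (coeff p i) * of_real (real m + x) powr (of_nat i - w)) =
     of_real (poly p (real m + x)) * of_real (real m + x) powr (- w)" for m
  proof -
    have "of_real (real m + x) powr (of_nat i - w) = of_real (real m + x) ^ i * of_real (real m + x) powr (- w)" for i
      using shift_nonzero[OF x, of m] by (simp add: powr_diff powr_minus powr_nat' field_simps)
    then show ?thesis by (simp add: poly_altdef sum_distrib_left sum_distrib_right mult_ac)
  qed
  ultimately show ?thesis by (simp add: hurwitz_poly_def)
qed

text \<open>\<open>remove_sings\<close> supplies the normalisation under which the continuation is
  unique, so any meromorphic function with the right series can be used to compute it.\<close>

lemma continued_sum_eq:
  assumes mero: "f meromorphic_on UNIV" and an: "\<And>w. Re w > c \<Longrightarrow> f analytic_on {w}"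
    and sum: "\<And>w. Re w > c \<Longrightarrow> ((\<lambda>i. a i w) has_sum f w) I"
  shows "continued_sum a I = remove_sings f"
proof -
  have *: "is_continued_sum a I (remove_sings f)"
    unfolding is_continued_sum_def
  proof (intro conjI exI[of _ c] allI impI)
    show "remove_sings f nicely_meromorphic_on UNIV"
      by (rule remove_sings_nicely_meromorphic[OF mero])
    show "((\<lambda>i. a i w) has_sum remove_sings f w) I" if "Re w > c" for w
      using sum[OF that] an[OF that] by simp
  qed
  then show ?thesis
    unfolding continued_sum_def by (intro the_equality) (auto intro: is_continued_sum_unique)
qed

text \<open>The binomial coefficient counts the tuples of length \<open>l\<close> with sum
  \<open>m\<close>. As a polynomial in \<open>m + z\<close> it reduces the Barnes zeta function to
  Hurwitz zeta functions.\<close>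

lemma barnes_poly_exists:
  assumes "l \<ge> 1"
  shows "\<exists>p::real poly. \<forall>m::nat. poly p (real m + z) = real (m + l - 1 choose (l - 1))"
proof -
  obtain p :: "real poly" where p: "\<And>y. poly p y = (y + (real l - 1 - z)) gchoose (l - 1)"
    using gchoose_poly by metis
  have "poly p (real m + z) = real (m + l - 1 choose (l - 1))" for m
  proof -
    have "real m + z + (real l - 1 - z) = real (m + l - 1)" using assms by simp
    then show ?thesis unfolding p by (simp only: binomial_gbinomial)
  qed
  then show ?thesis by blast
qed

text \<open>The lists are grouped by their sum. The groups are finite, and regrouping is justified
  by absolute convergence, which for complex series is equivalent to summability.\<close>

lemma has_sum_lists:
  fixes g :: "nat \<Rightarrow> complex"
  assumes l: "l \<ge> 1"
    and S: "((\<lambda>N. of_nat (N + l - 1 choose (l - 1)) * g N) has_sum S) UNIV"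
  shows "((\<lambda>m. g (sum_list m)) has_sum S) {m :: nat list. length m = l}"
proof -
  define B where "B N = {m :: nat list. length m = l \<and> sum_list m = N}" for N
  have card: "card (B N) = (N + l - 1 choose (l - 1))" for N
    using card_length_sum_list[of l N] l binomial_symmetric[of N "N + l - 1"] by (simp add: B_def)
  have fin: "finite (B N)" for N
  proof -
    have "card (B N) > 0" unfolding card using l by (simp add: zero_less_binomial_iff)
    then show ?thesis by (simp add: card_gt_0_iff)
  qed
  have "((\<lambda>(N, m). g N) has_sum S) (Sigma UNIV B)"
  proof (rule has_sum_SigmaI)
    show "((\<lambda>m. case (N, m) of (N, m) \<Rightarrow> g N) has_sum of_nat (N + l - 1 choose (l - 1)) * g N) (B N)" for N
      using fin by (intro has_sum_finiteI) (auto simp: card)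
    show "(\<lambda>(N, m). g N) summable_on Sigma UNIV B"
    proof (rule abs_summable_summable)
      have "(\<lambda>x. norm (of_nat (x + l - 1 choose (l - 1)) * g x)) summable_on UNIV"
        by (rule summable_on_iff_abs_summable_on_complex[THEN iffD1, OF has_sum_imp_summable[OF S]])
      then have "(\<lambda>x. real (x + l - 1 choose (l - 1)) * norm (g x)) summable_on UNIV"
        by (simp add: norm_mult)
      then show "(\<lambda>x. norm (case x of (N, m) \<Rightarrow> g N)) summable_on Sigma UNIV B"
        by (intro summable_on_SigmaI[where g = "\<lambda>x. real (x + l - 1 choose (l - 1)) * norm (g x)"] has_sum_finiteI)
          (auto simp: fin card)
    qed
  qed (rule S)
  also have "Sigma UNIV B = (\<lambda>m. (sum_list m, m)) ` {m. length m = l}"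
    by (auto simp: B_def)
  finally show ?thesis
    by (subst (asm) has_sum_reindex) (auto simp: inj_on_def o_def)
qed

lemma multiple_gamma_eq:
  assumes l: "l \<ge> 1" and z: "z > 0"
    and p: "\<And>m::nat. poly p (real m + z) = real (m + l - 1 choose (l - 1))"
  shows "multiple_gamma l (of_real z) = exp (hurwitz_poly_deriv z p)"
proof -
  have cs: "continued_sum (\<lambda>m w. (of_nat (sum_list m) + of_real z) powr (- w)) {m :: nat list. length m = l} =
      remove_sings (hurwitz_poly z p)"
  proof (rule continued_sum_eq[where c = "real (degree p) + 1"])
    show "hurwitz_poly z p meromorphic_on UNIV" by (rule hurwitz_poly_meromorphic[OF z])
    fix w :: complex assume w: "Re w > real (degree p) + 1"
    show "hurwitz_poly z p analytic_on {w}" by (rule hurwitz_poly_analytic[OF z]) (use w in auto)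
    have "((\<lambda>m. of_real (poly p (real m + z)) * of_real (real m + z) powr (- w)) has_sum hurwitz_poly z p w) UNIV"
      by (rule hurwitz_poly_has_sum[OF z w])
    then have "((\<lambda>N. of_nat (N + l - 1 choose (l - 1)) * (of_nat N + of_real z) powr (- w)) has_sum hurwitz_poly z p w) UNIV"
      unfolding p by simp
    from has_sum_lists[OF l this]
    show "((\<lambda>m. (of_nat (sum_list m) + of_real z) powr (- w)) has_sum hurwitz_poly z p w) {m :: nat list. length m = l}" .
  qed
  have "deriv (barnes_zeta l (of_real z)) 0 = deriv (remove_sings (hurwitz_poly z p)) 0"
    unfolding barnes_zeta_def cs by simp
  also have "\<dots> = deriv (hurwitz_poly z p) 0"
    by (rule deriv_remove_sings_at_analytic) (rule hurwitz_poly_analytic[OF z], simp)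
  also have "\<dots> = hurwitz_poly_deriv z p" by (rule deriv_hurwitz_poly[OF z])
  finally show ?thesis by (simp add: multiple_gamma_def)
qed

lemma nicely_meromorphic_remove_sings:
  assumes "f nicely_meromorphic_on UNIV"
  shows "remove_sings f = f"
proof
  fix z
  have "(is_pole f z \<and> f z = 0) \<or> f \<midarrow>z\<rightarrow> f z"
    using assms by (simp add: nicely_meromorphic_on_def)
  then show "remove_sings f z = f z" by (auto simp: remove_sings_eqI)
qed

text \<open>The derivative sought is \<open>A + 2 * B + C / 2\<close>, the case
  \<open>k = 2\<close>. For \<open>k = 1\<close> the first factor is a polynomial, so the value
  \<open>A + B + C\<close> is an explicit \<open>hurwitz_poly_deriv\<close> at \<open>x + u\<close>.
  Since \<open>B\<close> is one at \<open>x\<close>, writing the result as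
  \<open>B + (A + B + C) - C / 2\<close> eliminates the unknown \<open>A\<close>.\<close>

lemma product_continuation_deriv:
  assumes x: "x > 0" "x + u > 0" and Z: "Z nicely_meromorphic_on UNIV"
    and Zs: "\<And>w. Re w > c \<Longrightarrow>
      (\<lambda>m. of_real (real m + x) powr (of_nat q - w) * of_real (real m + x + u) powr (of_nat b - w)) sums Z w"
  shows "Z analytic_on {0}"
    and "deriv Z 0 = hurwitz_poly_deriv x ([:0, 1:] ^ q * [:u, 1:] ^ b)
       + hurwitz_poly_deriv (x + u) ([:- u, 1:] ^ q * [:0, 1:] ^ b)
       - of_real u ^ (q + b + 1) * deriv (pole_coeff q b) 0 / 2"
proof -
  define B where "B = (\<Sum>j<q+b+1. of_nat (b choose j) * of_real u ^ j * deriv (hurwitz x) (of_nat j - of_nat (q + b)))"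
  define C where "C = of_real u ^ (q + b + 1) * deriv (pole_coeff q b) 0"
  obtain A where A: "\<forall>k\<ge>1. \<forall>G c. G meromorphic_on UNIV \<longrightarrow> (\<forall>w. Re w > c \<longrightarrow>
     (\<lambda>m. of_real (real m + x) powr (of_nat q - (of_nat k - 1) * w) * of_real (real m + x + u) powr (of_nat b - w)) sums G w) \<longrightarrow>
     remove_sings G analytic_on {0} \<and> deriv (remove_sings G) 0 = A + of_nat k * B + C / of_nat k"
    using continuation_deriv[OF x, of q b] unfolding B_def C_def by auto
  have "Z meromorphic_on UNIV" using Z by (simp add: nicely_meromorphic_on_def)
  then have Z2: "Z analytic_on {0}" "deriv Z 0 = A + 2 * B + C / 2"
    using A[rule_format, of 2 Z c] Zs nicely_meromorphic_remove_sings[OF Z] by auto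
  show "Z analytic_on {0}" by fact
  \<comment> \<open>The polynomial \<open>(y - u) ^ q * y ^ b\<close> at
    \<open>y = m + x + u\<close> is \<open>(m + x) ^ q * (m + x + u) ^ b\<close>, the comparison
    series at \<open>w = 0\<close>.\<close>
  define P where "P = [:- u, 1:] ^ q * [:0, 1:] ^ b"
  define G where "G = hurwitz_poly (x + u) P"
  have "(\<lambda>m. of_real (real m + x) powr (of_nat q - (of_nat 1 - 1) * w) * of_real (real m + x + u) powr (of_nat b - w)) sums G w"
    if "Re w > real (degree P) + 1" for w
  proof -
    have "(\<lambda>m. of_real (poly P (real m + (x + u))) * of_real (real m + (x + u)) powr (- w)) sums G w"
      unfolding G_def using has_sum_imp_sums[OF hurwitz_poly_has_sum[OF x(2) that]] by simp
    moreover have "of_real (poly P (real m + (x + u))) * of_real (real m + (x + u)) powr (- w) =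
       of_real (real m + x) powr (of_nat q - (of_nat 1 - 1) * w) * of_real (real m + x + u) powr (of_nat b - w)" for m
      using shift_nonzero[OF x(1), of m] shift_nonzero[OF x(2), of m]
      by (simp add: P_def poly_power powr_nat' powr_diff powr_minus field_simps)
    ultimately show ?thesis by simp
  qed
  then have "deriv (remove_sings G) 0 = A + B + C"
    using A[rule_format, of 1 G "real (degree P) + 1"] hurwitz_poly_meromorphic[OF x(2), of P] by (auto simp: G_def)
  moreover have "deriv (remove_sings G) 0 = hurwitz_poly_deriv (x + u) P"
    unfolding G_def using deriv_remove_sings_at_analytic[OF hurwitz_poly_analytic[OF x(2), of 0]] deriv_hurwitz_poly[OF x(2)]
    by simp
  ultimately have 1: "A + B + C = hurwitz_poly_deriv (x + u) P" by simp
  \<comment> \<open>The same product in the variable \<open>m + x\<close>: its coefficients are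
    those in \<open>B\<close>, where the terms with \<open>j > b\<close> vanish.\<close>
  have "[:0, 1:] ^ q * [:u, 1:] ^ b = (\<Sum>j\<le>b. monom (real (b choose j) * u ^ j) (q + b - j))"
  proof -
    have "[:u, 1:] = [:u:] + [:0, 1:]" by simp
    then have "[:u, 1:] ^ b = (\<Sum>j\<le>b. of_nat (b choose j) * [:u:] ^ j * [:0, 1:] ^ (b - j))"
      by (simp only: binomial_ring)
    then show ?thesis
      by (simp add: sum_distrib_left monom_altdef poly_const_pow of_nat_poly power_add[symmetric] smult_smult mult_ac)
  qed
  then have "hurwitz_poly_deriv x ([:0, 1:] ^ q * [:u, 1:] ^ b) =
      (\<Sum>j\<le>b. of_real (real (b choose j) * u ^ j) * deriv (hurwitz x) (- of_nat (q + b - j)))"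
    by (simp only: hurwitz_poly_deriv_sum hurwitz_poly_deriv_monom)
  also have "\<dots> = B"
    unfolding B_def by (intro sum.mono_neutral_cong_left) (auto simp: of_nat_diff)
  finally have Beq: "hurwitz_poly_deriv x ([:0, 1:] ^ q * [:u, 1:] ^ b) = B" .
  show "deriv Z 0 = hurwitz_poly_deriv x ([:0, 1:] ^ q * [:u, 1:] ^ b)
       + hurwitz_poly_deriv (x + u) ([:- u, 1:] ^ q * [:0, 1:] ^ b)
       - of_real u ^ (q + b + 1) * deriv (pole_coeff q b) 0 / 2"
    unfolding Z2(2) Beq 1[unfolded P_def, symmetric] C_def[symmetric] by (simp add: field_simps)
qed

section \<open>The determinant of the sequence of eigenvalues\<close>

definition backward_diff :: "(real \<Rightarrow> real) \<Rightarrow> real \<Rightarrow> real" where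
  "backward_diff h x = h x - h (x - 1)"

lemma backward_diff_funpow:
  "(backward_diff ^^ i) h x = (\<Sum>j\<le>i. real (i choose j) * (-1) ^ j * h (x - real j))"
proof (induction i arbitrary: x)
  case 0
  then show ?case by simp
next
  case (Suc i)
  have "(\<Sum>j\<le>Suc i. real (Suc i choose j) * (-1) ^ j * h (x - real j)) =
     h x + (\<Sum>j\<le>i. real (i choose Suc j) * (-1) ^ Suc j * h (x - real (Suc j)))
         + (\<Sum>j\<le>i. real (i choose j) * (-1) ^ Suc j * h (x - real (Suc j)))"
    unfolding sum.atMost_Suc_shift[of _ i]
    by (simp only: add.assoc sum.distrib[symmetric]) (simp add: algebra_simps sum.distrib)
  also have "h x + (\<Sum>j\<le>i. real (i choose Suc j) * (-1) ^ Suc j * h (x - real (Suc j))) =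
     (\<Sum>j\<le>Suc i. real (i choose j) * (-1) ^ j * h (x - real j))"
    by (subst sum.atMost_Suc_shift) simp
  also have "\<dots> = (backward_diff ^^ i) h x"
    using Suc[of x] by simp
  also have "(\<Sum>j\<le>i. real (i choose j) * (-1) ^ Suc j * h (x - real (Suc j))) = - (backward_diff ^^ i) h (x - 1)"
    by (simp add: Suc sum_negf algebra_simps)
  finally show ?case by (simp add: backward_diff_def[of "(backward_diff ^^ i) h"])
qed

text \<open>Newton's backward difference formula, exact because the differences of order
  \<open>K\<close> vanish. Applied to \<open>backward_diff h\<close> by induction on
  \<open>K\<close>, it gives the increments of \<open>h\<close>, which Pascal's rule sums
  up.\<close>

lemma newton_backward:
  assumes "\<And>x. (backward_diff ^^ K) h x = 0"
  shows "h (x + real m + 1) = (\<Sum>i<K. real (m + i choose i) * (backward_diff ^^ i) h x)"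
  using assms
proof (induction K arbitrary: h x m)
  case 0
  then show ?case by simp
next
  case (Suc K)
  have IH: "backward_diff h (x + real m + 1) =
      (\<Sum>i<K. real (m + i choose i) * (backward_diff ^^ Suc i) h x)" for m
    using Suc.IH[of "backward_diff h" x m] Suc.prems by (simp add: funpow_Suc_right del: funpow.simps)
  show ?case
  proof (induction m)
    case 0
    show ?case
      using IH[of 0] by (subst sum.lessThan_Suc_shift) (simp add: backward_diff_def)
  next
    case (Suc m)
    have "h (x + real (Suc m) + 1) = h (x + real m + 1) + backward_diff h (x + real (Suc m) + 1)"
      by (simp add: backward_diff_def algebra_simps)
    also have "\<dots> = h x + (\<Sum>i<K. (real (m + Suc i choose Suc i) + real (Suc m + i choose i)) * (backward_diff ^^ Suc i) h x)"
      unfolding IH Suc by (subst sum.lessThan_Suc_shift) (simp add: sum.distrib algebra_simps)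
    also have "\<dots> = (\<Sum>i<Suc K. real (Suc m + i choose i) * (backward_diff ^^ i) h x)"
      by (subst sum.lessThan_Suc_shift) (simp add: add.commute del: funpow.simps)
    finally show ?case .
  qed
qed

text \<open>The leading terms of \<open>p\<close> and of its shift cancel, so each difference lowers
  the degree; constants are treated apart, as their difference is 0.\<close>

lemma backward_diff_poly:
  assumes "degree p < K"
  shows "(backward_diff ^^ K) (poly p) x = 0"
  using assms
proof (induction K arbitrary: p x)
  case 0
  then show ?case by simp
next
  case (Suc K)
  define q where "q = p - pcompose p [:-1, 1:]"
  have 1: "backward_diff (poly p) = poly q"
    by (simp add: backward_diff_def fun_eq_iff q_def poly_pcompose)
  show ?case
  proof (cases "degree p = 0")
    case True
    then have "q = 0" by (elim degree_eq_zeroE) (simp add: q_def pcompose_pCons)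
    then have "poly q = (\<lambda>x. 0)" by (simp add: fun_eq_iff)
    moreover have "(backward_diff ^^ K) (\<lambda>x. 0) x = 0"
      by (induction K arbitrary: x) (simp_all add: backward_diff_def)
    ultimately show ?thesis
      by (simp only: funpow_Suc_right 1 o_apply)
  next
    case False
    have dp: "degree (pcompose p [:-1, 1:]) = degree p"
      by (simp add: degree_pcompose)
    have "lead_coeff (pcompose p [:-1, 1:]) = lead_coeff p"
      by (subst lead_coeff_comp) auto
    then have c: "coeff q (degree p) = 0"
      using dp by (simp add: q_def)
    have "degree q \<le> degree p" unfolding q_def using dp by (metis degree_diff_le order_refl)
    moreover have "degree q \<noteq> degree p"
      using c False by (metis degree_0 leading_coeff_0_iff)
    ultimately have "degree q < K" using Suc.prems by linarith
    then show ?thesis using Suc.IH[of q] by (simp add: funpow_Suc_right 1 del: funpow.simps)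
  qed
qed

text \<open>\<open>c_poly k l z\<close> is the backward difference of order \<open>l - 1\<close> of
  \<open>(x + z) ^ (k - 1)\<close> at \<open>x = -1\<close>. Newton's formula from the base point -1
  with step \<open>m + 1\<close> evaluates this power at \<open>m\<close>.\<close>

lemma sum_c_poly_choose:
  assumes "k \<ge> 1"
  shows "(\<Sum>l=1..k. c_poly k l z * real (m + l - 1 choose (l - 1))) = (real m + z) ^ (k - 1)"
proof -
  define p where "p = [:z, 1:] ^ (k - 1)"
  have p: "poly p = (\<lambda>x. (x + z) ^ (k - 1))"
    by (simp add: p_def poly_power fun_eq_iff add.commute)
  have "degree p < k" using assms by (simp add: p_def degree_linear_power)
  then have "poly p (-1 + real m + 1) = (\<Sum>i<k. real (m + i choose i) * (backward_diff ^^ i) (poly p) (-1))"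
    by (intro newton_backward backward_diff_poly)
  also have "\<dots> = (\<Sum>i<k. real (m + i choose i) * c_poly k (Suc i) z)"
    by (simp add: backward_diff_funpow p c_poly_def atMost_atLeast0 algebra_simps)
  also have "\<dots> = (\<Sum>l=1..k. c_poly k l z * real (m + l - 1 choose (l - 1)))"
    by (rule sum.reindex_bij_witness[of _ "\<lambda>l. l - 1" Suc]) auto
  finally show ?thesis by (simp add: p)
qed

lemma poly_eq_if_eq_on_nat:
  fixes p q :: "real poly"
  assumes "\<And>m::nat. poly p (real m + z) = poly q (real m + z)"
  shows "p = q"
proof (rule ccontr)
  assume "p \<noteq> q"
  then have "finite {y. poly (p - q) y = 0}" by (intro poly_roots_finite) simp
  moreover have "range (\<lambda>m::nat. real m + z) \<subseteq> {y. poly (p - q) y = 0}"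
    using assms by auto
  ultimately have "finite (range (\<lambda>m::nat. real m + z))" by (rule rev_finite_subset)
  moreover have "inj (\<lambda>m::nat. real m + z)" by (auto simp: inj_def)
  ultimately show False using finite_imageD by blast
qed

text \<open>For \<open>X = m + xi_plus n s\<close> the number \<open>X - 2 * s\<close> is
  \<open>m + xi_minus n s\<close>. Expanding \<open>(X - 2 * s) ^ (r + d - 1)\<close> by the
  binomial theorem shows that \<open>alpha_poly\<close> lists, up to sign, the coefficients in
  powers of \<open>X\<close>.\<close>

lemma sum_alpha_poly:
  assumes n: "n \<ge> 1" and r: "r \<ge> 1"
  shows "(\<Sum>k=r..2*r+n-2. alpha_poly n r s k * X ^ (k - 1)) =
    - (\<Sum>d=0..n-1. T_coeff n d s * ((X - 2 * s) ^ (r + d - 1) * X ^ (r - 1)))"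
proof -
  \<comment> \<open>For \<open>d < k + 1 - 2 * r\<close> the lower entry \<open>k - r\<close>
    exceeds \<open>r + d - 1\<close>, so the binomial coefficient is 0 and the sum may start at
    0.\<close>
  have al: "alpha_poly n r s k = (\<Sum>d=0..n-1. (-1) ^ (k + d) * real ((r + d - 1) choose (k - r))
        * (2 * s) ^ (2 * r + d - k - 1) * T_coeff n d s)" if "k \<ge> r" for k
    unfolding alpha_poly_def
    by (rule sum.mono_neutral_left) (use r that in \<open>auto simp: binomial_eq_0_iff\<close>)
  have inner: "(\<Sum>k=r..2*r+n-2. (-1) ^ (k + d) * real ((r + d - 1) choose (k - r))
        * (2 * s) ^ (2 * r + d - k - 1) * X ^ (k - 1)) = - ((X - 2 * s) ^ (r + d - 1) * X ^ (r - 1))"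
    if d: "d \<le> n - 1" for d
  proof -
    define N where "N = r + d - 1"
    have "(\<Sum>k=r..2*r+n-2. (-1) ^ (k + d) * real ((r + d - 1) choose (k - r))
        * (2 * s) ^ (2 * r + d - k - 1) * X ^ (k - 1)) =
      (\<Sum>j=0..r+n-2. (-1) ^ (j + r + d) * real (N choose j) * (2 * s) ^ (N - j) * X ^ (j + r - 1))"
    proof -
      have K: "2*r+n-2 = (r + n - 2) + r" using r n by simp
      have e: "2 * r + d - (j + r) - 1 = N - j" for j using r by (simp add: N_def)
      show ?thesis
        unfolding K sum.shift_bounds_cl_nat_ivl[of _ 0 r "r+n-2", unfolded add_0]
        by (simp only: e add_diff_cancel_right' N_def[symmetric])
    qed
    also have "\<dots> = (\<Sum>j\<le>N. (-1) ^ (j + r + d) * real (N choose j) * (2 * s) ^ (N - j) * X ^ (j + r - 1))"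
      by (rule sum.mono_neutral_right) (use d n r in \<open>auto simp: N_def\<close>)
    also have "\<dots> = (\<Sum>j\<le>N. - (X ^ (r - 1) * (of_nat (N choose j) * X ^ j * (- (2 * s)) ^ (N - j))))"
    proof (rule sum.cong)
      fix j assume "j \<in> {..N}"
      then have j: "j + (N - j) = N" by auto
      have "(-1::real) ^ (j + r + d) = - ((-1) ^ (N - j))"
      proof -
        have e: "j + r + d = Suc (2 * j + (N - j))" using j r N_def by linarith
        show ?thesis unfolding e by (simp add: power_add)
      qed
      moreover have "(- (2 * s)) ^ (N - j) = (-1) ^ (N - j) * (2 * s) ^ (N - j)"
        by (metis mult_minus1 power_mult_distrib)
      moreover have "X ^ (j + r - 1) = X ^ (r - 1) * X ^ j"
      proof -
        have e: "j + r - 1 = (r - 1) + j" using r by simp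
        show ?thesis unfolding e by (rule power_add)
      qed
      ultimately show "(-1) ^ (j + r + d) * real (N choose j) * (2 * s) ^ (N - j) * X ^ (j + r - 1) =
          - (X ^ (r - 1) * (of_nat (N choose j) * X ^ j * (- (2 * s)) ^ (N - j)))"
        by simp
    qed simp
    also have "\<dots> = - (X ^ (r - 1) * (X + (- (2 * s))) ^ N)"
      by (simp only: binomial_ring[of X] sum_negf sum_distrib_left)
    finally show ?thesis by (simp add: N_def)
  qed
  have "(\<Sum>k=r..2*r+n-2. alpha_poly n r s k * X ^ (k - 1)) =
    (\<Sum>k=r..2*r+n-2. \<Sum>d=0..n-1. T_coeff n d s * ((-1) ^ (k + d) * real ((r + d - 1) choose (k - r))
        * (2 * s) ^ (2 * r + d - k - 1) * X ^ (k - 1)))"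
  proof (intro sum.cong refl)
    fix k assume "k \<in> {r..2*r+n-2}"
    then have "k \<ge> r" by simp
    show "alpha_poly n r s k * X ^ (k - 1) = (\<Sum>d=0..n-1. T_coeff n d s * ((-1) ^ (k + d) * real ((r + d - 1) choose (k - r))
        * (2 * s) ^ (2 * r + d - k - 1) * X ^ (k - 1)))"
      unfolding al[OF \<open>k \<ge> r\<close>] sum_distrib_right by (intro sum.cong refl) (simp only: mult_ac)
  qed
  also have "\<dots> = (\<Sum>d=0..n-1. T_coeff n d s * (\<Sum>k=r..2*r+n-2. (-1) ^ (k + d) * real ((r + d - 1) choose (k - r))
        * (2 * s) ^ (2 * r + d - k - 1) * X ^ (k - 1)))"
    by (subst sum.swap) (simp only: sum_distrib_left)
  also have "\<dots> = (\<Sum>d=0..n-1. - (T_coeff n d s * ((X - 2 * s) ^ (r + d - 1) * X ^ (r - 1))))"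
    by (intro sum.cong refl) (simp only: atLeastAtMost_iff inner mult_minus_right)
  finally show ?thesis by (simp add: sum_negf)
qed

text \<open>With \<open>a = m + 1 + n_check n\<close>, the factors on the right are
  \<open>a - s\<close> and \<open>a + s\<close>, so the sum is
  \<open>P_mult n a * (a\<^sup>2 - s\<^sup>2) ^ (r - 1)\<close>. The powers of
  \<open>m + xi_plus n s\<close> from \<open>sum_alpha_poly\<close> are rewritten by
  \<open>sum_c_poly_choose\<close>.\<close>

lemma sum_beta_poly:
  assumes n: "n \<ge> 1" and r: "r \<ge> 1"
  shows "(\<Sum>l=1..2*r+n-2. beta_poly n r s l * real (m + l - 1 choose (l - 1))) =
    - (\<Sum>d=0..n-1. T_coeff n d s * ((real m + xi_minus n s) ^ (r + d - 1) * (real m + xi_plus n s) ^ (r - 1)))"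
proof -
  define K where "K = 2*r+n-2"
  define F where "F l k = c_poly k l (xi_plus n s) * alpha_poly n r s k * real (m + l - 1 choose (l - 1))" for l k
  have "(\<Sum>l=1..K. beta_poly n r s l * real (m + l - 1 choose (l - 1))) = (\<Sum>l=1..K. \<Sum>k=max r l..K. F l k)"
    by (simp add: beta_poly_def K_def F_def sum_distrib_right)
  also have "\<dots> = (\<Sum>(l,k)\<in>(SIGMA l:{1..K}. {max r l..K}). F l k)"
    by (simp add: sum.Sigma)
  \<comment> \<open>The region \<open>max r l \<le> k\<close> is traversed by \<open>k\<close>
    first; since \<open>r \<ge> 1\<close>, each \<open>k\<close> then meets exactly
    \<open>l = 1..k\<close>.\<close>
  also have "\<dots> = (\<Sum>(k,l)\<in>(SIGMA k:{r..K}. {1..k}). F l k)"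
    by (rule sum.reindex_bij_witness[of _ "\<lambda>(k,l). (l,k)" "\<lambda>(l,k). (k,l)"]) auto
  also have "\<dots> = (\<Sum>k=r..K. \<Sum>l=1..k. F l k)"
    by (simp add: sum.Sigma)
  also have "\<dots> = (\<Sum>k=r..K. alpha_poly n r s k * (real m + xi_plus n s) ^ (k - 1))"
  proof (rule sum.cong)
    fix k assume k: "k \<in> {r..K}"
    then have "k \<ge> 1" using r by simp
    then have "(\<Sum>l=1..k. c_poly k l (xi_plus n s) * real (m + l - 1 choose (l - 1))) = (real m + xi_plus n s) ^ (k - 1)"
      by (rule sum_c_poly_choose)
    note e = this
    show "(\<Sum>l=1..k. F l k) = alpha_poly n r s k * (real m + xi_plus n s) ^ (k - 1)"
      unfolding F_def e[symmetric] by (simp only: sum_distrib_left mult_ac)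
  qed simp
  also have "\<dots> = - (\<Sum>d=0..n-1. T_coeff n d s * ((real m + xi_plus n s - 2 * s) ^ (r + d - 1) * (real m + xi_plus n s) ^ (r - 1)))"
    unfolding K_def by (rule sum_alpha_poly[OF n r])
  also have "real m + xi_plus n s - 2 * s = real m + xi_minus n s"
    by (simp add: xi_plus_def xi_minus_def)
  finally show ?thesis by (simp add: K_def)
qed

text \<open>With \<open>b = r - 1\<close> and \<open>q = d + b\<close>, the harmonic sums up to
  \<open>q\<close> and \<open>b\<close> differ by the terms from \<open>r\<close> to
  \<open>r + d - 1\<close>, and \<open>fact (q + b + 1)\<close> is \<open>fact q\<close> times the
  Pochhammer symbol.\<close>

lemma deriv_pole_coeff_f_poly:
  assumes r: "r \<ge> 1"
  shows "deriv (pole_coeff (d + r - 1) (r - 1)) 0 =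
    of_real ((-1) ^ (r + d) * fact (r - 1) / pochhammer (real (r + d)) r * harm_between r (r + d - 1))"
proof -
  obtain b where b: "r = Suc b" using r by (cases r) auto
  define q where "q = d + b"
  have "(\<Sum>k=1..q. 1 / real k) = (\<Sum>k=1..b. 1 / real k) + (\<Sum>k=b+1..q. 1 / real k)"
    using sum.ub_add_nat[of 1 b "\<lambda>k. 1 / real k" d] by (simp add: q_def add.commute)
  then have "(\<Sum>k=1..q. 1 / real k) - (\<Sum>k=1..b. 1 / real k) = harm_between r (r + d - 1)"
    by (simp add: harm_between_def b q_def add.commute)
  from arg_cong[OF this, of complex_of_real]
  have 1: "(\<Sum>k=1..q. 1 / of_nat k) - (\<Sum>k=1..b. 1 / of_nat k) = (of_real (harm_between r (r + d - 1)) :: complex)"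
    by simp
  have "fact (q + b + 1) = (fact q * pochhammer (real (r + d)) r :: real)"
    using pochhammer_product'[of "1::real" q r]
    by (simp add: b q_def pochhammer_fact add_ac)
  then have "(-1) ^ (q + 1) * fact b * fact q / fact (q + b + 1) = (-1) ^ (r + d) * fact (r - 1) / pochhammer (real (r + d)) r"
    by (simp add: b q_def add.commute[of b d] del: fact_Suc)
  from arg_cong[OF this, of complex_of_real]
  have 2: "pole_coeff q b 0 = of_real ((-1) ^ (r + d) * fact (r - 1) / pochhammer (real (r + d)) r)"
    unfolding pole_coeff_0 by (simp del: fact_Suc)
  have 3: "d + r - 1 = q" "r - 1 = b" by (simp_all add: b q_def)
  have "deriv (pole_coeff q b) 0 = of_real ((-1) ^ (r + d) * fact (r - 1) / pochhammer (real (r + d)) r) * of_real (harm_between r (r + d - 1))"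
    using DERIV_imp_deriv[OF pole_coeff_has_derivative[of q b]] unfolding 1 2 .
  then show ?thesis unfolding 3(1) 3(2) by simp
qed


text \<open>Polynomials that agree at all \<open>m + z\<close> coincide, so the numerical identity
  \<open>sum_beta_poly\<close> passes through the linear map \<open>hurwitz_poly_deriv z\<close>.
  The base point \<open>z\<close> is left open because both \<open>xi_minus\<close> and
  \<open>xi_plus\<close> are needed. \<open>g\<close> is the real logarithm of the gamma
  values.\<close>

lemma sum_beta_hurwitz_poly_deriv:
  assumes n: "n \<ge> 1" and r: "r \<ge> 1" and z: "z > 0"
    and q: "\<And>m::nat. poly q (real m + z) =
      (\<Sum>d=0..n-1. T_coeff n d s * ((real m + xi_minus n s) ^ (r + d - 1) * (real m + xi_plus n s) ^ (r - 1)))"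
  obtains g where "\<And>l. l \<ge> 1 \<Longrightarrow> multiple_gamma l (of_real z) = of_real (exp (g l))"
    and "(\<Sum>l=1..2*r+n-2. beta_poly n r s l * g l) = - Re (hurwitz_poly_deriv z q)"
proof -
  have "\<forall>l. \<exists>p::real poly. l \<ge> 1 \<longrightarrow> (\<forall>m::nat. poly p (real m + z) = real (m + l - 1 choose (l - 1)))"
    using barnes_poly_exists by blast
  from choice[OF this] obtain p :: "nat \<Rightarrow> real poly"
    where p: "\<And>l m. l \<ge> 1 \<Longrightarrow> poly (p l) (real m + z) = real (m + l - 1 choose (l - 1))" by blast
  define g where "g l = Re (hurwitz_poly_deriv z (p l))" for l
  have g: "hurwitz_poly_deriv z (p l) = of_real (g l)" for l
    using hurwitz_poly_deriv_real[OF z, of "p l"] by (simp add: g_def)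
  show ?thesis
  proof
    show "multiple_gamma l (of_real z) = of_real (exp (g l))" if "l \<ge> 1" for l
      using multiple_gamma_eq[OF that z p[OF that]] by (simp add: g exp_of_real)
    have "(\<Sum>l=1..2*r+n-2. smult (beta_poly n r s l) (p l)) = - q"
    proof (rule poly_eq_if_eq_on_nat)
      fix m :: nat
      have "poly (\<Sum>l=1..2*r+n-2. smult (beta_poly n r s l) (p l)) (real m + z) =
          (\<Sum>l=1..2*r+n-2. beta_poly n r s l * real (m + l - 1 choose (l - 1)))"
        unfolding poly_sum by (intro sum.cong refl) (simp add: p)
      then show "poly (\<Sum>l=1..2*r+n-2. smult (beta_poly n r s l) (p l)) (real m + z) = poly (- q) (real m + z)"
        unfolding sum_beta_poly[OF n r] by (simp add: q)
    qed
    from arg_cong[OF this, of "\<lambda>p. Re (hurwitz_poly_deriv z p)"]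
    show "(\<Sum>l=1..2*r+n-2. beta_poly n r s l * g l) = - Re (hurwitz_poly_deriv z q)"
      by (simp add: hurwitz_poly_deriv_sum hurwitz_poly_deriv_smult hurwitz_poly_deriv_uminus g)
  qed
qed

text \<open>The analytic half of the result, for a given sequence of multiplicities. The value
  \<open>mult 0 = 1\<close> is a separate hypothesis: for \<open>n = 1\<close> the polynomial
  \<open>P_mult\<close> would give 2 at \<open>k = 0\<close>.\<close>

lemma exp_deriv_spectral_sum:
  fixes n r :: nat and s :: real and mult :: "nat \<Rightarrow> nat"
  assumes n: "n \<ge> 1" and r: "r \<ge> 1" and s: "s \<in> {- n_check n - 1 <..< n_check n + 1}"
    and mult: "mult 0 = 1" "\<And>k. k \<ge> 1 \<Longrightarrow> real (mult k) = P_mult n (real k + n_check n)"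
  defines "ev \<equiv> \<lambda>k. (real k + n_check n)\<^sup>2 - s\<^sup>2"
  shows "exp (- deriv (continued_sum (\<lambda>k w. of_nat (mult k) * of_real (ev k) powr (- w)) {k. ev k > 0}) (1 - of_nat r)) =
          of_real (if \<bar>s\<bar> < n_check n
                   then ((n_check n)\<^sup>2 - s\<^sup>2) powr (((n_check n)\<^sup>2 - s\<^sup>2) ^ (r - 1)) else 1)
          * of_real (exp (f_poly n r s))
          * (\<Prod>l=1..2*r+n-2.
               (multiple_gamma l (of_real (xi_plus n s)) * multiple_gamma l (of_real (xi_minus n s)))
                 powr of_real (beta_poly n r s l))"
proof -
  define b where "b = r - 1"
  define x where "x = xi_minus n s"
  define u where "u = 2 * s"
  have x: "x > 0" "x + u > 0" and xu: "x + u = xi_plus n s"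
    using s by (auto simp: x_def u_def xi_minus_def xi_plus_def)
  have nc: "n_check n \<ge> 0" using n by (simp add: n_check_def)
  have "\<forall>d. \<exists>Z. Z nicely_meromorphic_on UNIV \<and> (\<forall>w. Re w > (real (d + b) + real b + 1) / 2 \<longrightarrow> Z analytic_on {w} \<and>
     (\<lambda>m. of_real (real m + x) powr (of_nat (d + b) - w) * of_real (real m + x + u) powr (of_nat b - w)) sums Z w)"
    by (intro allI shifted_global x)
  from choice[OF this] obtain Z where Z:
    "\<And>d. Z d nicely_meromorphic_on UNIV"
    "\<And>d w. Re w > (real (d + b) + real b + 1) / 2 \<Longrightarrow> Z d analytic_on {w}"
    "\<And>d w. Re w > (real (d + b) + real b + 1) / 2 \<Longrightarrow>
       (\<lambda>m. of_real (real m + x) powr (of_nat (d + b) - w) * of_real (real m + x + u) powr (of_nat b - w)) sums Z d w"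
    by blast
  define T where "T d = T_coeff n d s" for d
  \<comment> \<open>The eigenvalue number 0, counted only if it is positive.\<close>
  define E where "E w = (if \<bar>s\<bar> < n_check n then of_real (ev 0) powr (- w) else 0 :: complex)" for w
  \<comment> \<open>Shifting the argument by \<open>b = r - 1\<close> cancels the extra
    \<open>b\<close> in both exponents of \<open>Z d\<close> and moves the point
    \<open>1 - r\<close> to 0.\<close>
  define H where "H w = (\<Sum>d=0..n-1. of_real (T d) * Z d (w + of_nat b)) + E w" for w
  have ev0: "ev 0 = (n_check n)\<^sup>2 - s\<^sup>2" by (simp add: ev_def)
  have ev0_pos: "ev 0 > 0 \<longleftrightarrow> \<bar>s\<bar> < n_check n"
    using nc abs_le_square_iff[of "n_check n" s] by (auto simp: ev0)
  have evS: "ev (Suc m) = (real m + x) * (real m + x + u)" for m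
    by (simp add: ev_def x_def u_def xi_minus_def power2_eq_square algebra_simps)
  have pos: "real m + x > 0" "real m + x + u > 0" for m using x by linarith+
  have multS: "real (mult (Suc m)) = (\<Sum>d=0..n-1. T d * (real m + x) ^ d)" for m
    using mult(2)[of "Suc m"] P_mult_expansion[OF n, of "real (Suc m) + n_check n" s]
    by (simp add: T_def x_def xi_minus_def algebra_simps)
  have aE: "E analytic_on S" for S
  proof (cases "\<bar>s\<bar> < n_check n")
    case True
    then have "of_real (ev 0) \<noteq> (0::complex)" using ev0_pos by simp
    then have "(\<lambda>w. of_real (ev 0) powr (- w) :: complex) holomorphic_on UNIV"
      by (intro holomorphic_intros)
    then show ?thesis
      using True unfolding E_def[abs_def] by (auto intro!: analytic_on_subset[of _ UNIV S] simp: analytic_on_open)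
  next
    case False
    then show ?thesis unfolding E_def[abs_def] by simp
  qed
  have shiftZ: "(\<lambda>w. Z d (w + of_nat b)) analytic_on {w}" if "Z d analytic_on {w + of_nat b}" for d w
  proof -
    have "(Z d \<circ> (\<lambda>w. w + of_nat b)) analytic_on {w}"
      using that by (intro analytic_on_compose analytic_intros) auto
    then show ?thesis by (simp add: o_def)
  qed
  have cs: "continued_sum (\<lambda>k w. of_nat (mult k) * of_real (ev k) powr (- w)) {k. ev k > 0} = remove_sings H"
  proof (rule continued_sum_eq[where c = "real n / 2"])
    have "(\<lambda>w. Z d (w + of_nat b)) meromorphic_on UNIV" for d
      by (rule meromorphic_on_compose[of "Z d" UNIV]) (use Z(1) in \<open>auto simp: nicely_meromorphic_on_def intro!: analytic_intros\<close>)
    then show "H meromorphic_on UNIV"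
      unfolding H_def[abs_def]
      by (intro meromorphic_on_add meromorphic_on_sum meromorphic_on_mult meromorphic_on_const analytic_on_imp_meromorphic_on[OF aE])
    fix w :: complex assume w: "Re w > real n / 2"
    have conv: "Re (w + of_nat b) > (real (d + b) + real b + 1) / 2" if "d \<in> {0..n-1}" for d
    proof -
      have "real d + 1 \<le> real n" using that n by auto
      then show ?thesis using w by (simp add: field_simps)
    qed
    show "H analytic_on {w}"
      unfolding H_def[abs_def]
      by (intro analytic_on_add analytic_on_sum analytic_on_mult analytic_on_const aE shiftZ Z(2) conv)
    have "((\<lambda>m. \<Sum>d=0..n-1. of_real (T d) * (of_real (real m + x) powr (of_nat (d + b) - (w + of_nat b)) *
        of_real (real m + x + u) powr (of_nat b - (w + of_nat b)))) has_sum (\<Sum>d=0..n-1. of_real (T d) * Z d (w + of_nat b))) UNIV"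
    proof (intro has_sum_finite_sum has_sum_cmult_right norm_summable_imp_has_sum Z(3) conv shifted_norm_summable x)
      fix d assume "d \<in> {0..n-1}"
      from conv[OF this] show "Re (of_nat (d + b) - (w + of_nat b) + (of_nat b - (w + of_nat b))) < -1"
        by (simp add: field_simps)
    qed
    moreover have "(\<Sum>d=0..n-1. of_real (T d) * (of_real (real m + x) powr (of_nat (d + b) - (w + of_nat b)) *
        of_real (real m + x + u) powr (of_nat b - (w + of_nat b)))) = of_nat (mult (Suc m)) * of_real (ev (Suc m)) powr (- w)" for m
    proof -
      have "of_real (ev (Suc m)) powr (- w) = of_real (real m + x) powr (- w) * of_real (real m + x + u) powr (- w)"
        unfolding evS of_real_mult using pos[of m] by (intro powr_times_real) auto
      moreover have "of_real (real m + x) powr (of_nat d - w) = of_real (real m + x) ^ d * of_real (real m + x) powr (- w)" for d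
        using shift_nonzero[OF x(1), of m] by (simp add: powr_diff powr_minus powr_nat' field_simps)
      moreover have "of_nat (mult (Suc m)) = (\<Sum>d=0..n-1. of_real (T d) * of_real (real m + x) ^ d :: complex)"
        using arg_cong[OF multS[of m], of complex_of_real] by simp
      moreover have "of_nat (d + b) - (w + of_nat b) = of_nat d - w" "of_nat b - (w + of_nat b) = - w" for d
        by simp_all
      ultimately show ?thesis by (simp only: sum_distrib_left sum_distrib_right mult_ac)
    qed
    ultimately have "((\<lambda>m. of_nat (mult (Suc m)) * of_real (ev (Suc m)) powr (- w)) has_sum (\<Sum>d=0..n-1. of_real (T d) * Z d (w + of_nat b))) UNIV"
      by (simp only:)
    then have 1: "((\<lambda>k. of_nat (mult k) * of_real (ev k) powr (- w)) has_sum (\<Sum>d=0..n-1. of_real (T d) * Z d (w + of_nat b))) (range Suc)"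
      by (subst has_sum_reindex) (auto simp: o_def)
    define I0 where "I0 = (if \<bar>s\<bar> < n_check n then {0::nat} else {})"
    have 2: "((\<lambda>k. of_nat (mult k) * of_real (ev k) powr (- w)) has_sum E w) I0"
      unfolding I0_def E_def by (rule has_sum_finiteI) (auto simp: mult)
    have "range Suc \<inter> I0 = {}" by (auto simp: I0_def)
    moreover have "range Suc \<union> I0 = {k. ev k > 0}"
    proof (intro set_eqI)
      fix k show "k \<in> range Suc \<union> I0 \<longleftrightarrow> k \<in> {k. ev k > 0}"
        using ev0_pos pos[of "k - 1"] by (cases k) (auto simp: I0_def evS)
    qed
    ultimately show "((\<lambda>k. of_nat (mult k) * of_real (ev k) powr (- w)) has_sum H w) {k. ev k > 0}"
      using has_sum_Un_disjoint[OF 1 2] by (simp add: H_def)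
  qed
  \<comment> \<open>\<open>Q1\<close> in the variable \<open>m + x\<close> and \<open>Q2\<close> in
    the variable \<open>m + x + u\<close> express the same numbers, namely multiplicity times
    eigenvalue to the power \<open>r - 1\<close>.\<close>
  define Q1 where "Q1 = (\<Sum>d=0..n-1. smult (T d) ([:0, 1:] ^ (d + b) * [:u, 1:] ^ b))"
  define Q2 where "Q2 = (\<Sum>d=0..n-1. smult (T d) ([:- u, 1:] ^ (d + b) * [:0, 1:] ^ b))"
  have Z0: "Z d analytic_on {0}"
     "deriv (Z d) 0 = hurwitz_poly_deriv x ([:0, 1:] ^ (d + b) * [:u, 1:] ^ b)
       + hurwitz_poly_deriv (x + u) ([:- u, 1:] ^ (d + b) * [:0, 1:] ^ b)
       - of_real u ^ (d + b + b + 1) * deriv (pole_coeff (d + b) b) 0 / 2" for d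
    by (rule product_continuation_deriv[OF x Z(1) Z(3)[of d]], assumption)+
  have fp: "(\<Sum>d=0..n-1. of_real (T d) * (of_real u ^ ((d + b) + b + 1) * deriv (pole_coeff (d + b) b) 0 / 2)) = (of_real (f_poly n r s) :: complex)"
  proof -
    have "of_real (T d) * (of_real u ^ ((d + b) + b + 1) * deriv (pole_coeff (d + b) b) 0 / 2) =
       (of_real ((-1) ^ (r + d) * fact (r - 1) / (2 * pochhammer (real (r + d)) r)
        * harm_between r (r + d - 1) * (2 * s) ^ (2 * r + d - 1) * T_coeff n d s) :: complex)" for d
    proof -
      have e: "d + r - 1 = d + b" "r - 1 = b" "(d + b) + b + 1 = 2 * r + d - 1" using r by (simp_all add: b_def)
      show ?thesis
        unfolding e(3) deriv_pole_coeff_f_poly[OF r, of d, unfolded e(1,2)] u_def T_def e(2) by (simp add: mult_ac)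
    qed
    then have "(\<Sum>d=0..n-1. of_real (T d) * (of_real u ^ ((d + b) + b + 1) * deriv (pole_coeff (d + b) b) 0 / 2)) =
      (of_real (\<Sum>d=0..n-1. (-1) ^ (r + d) * fact (r - 1) / (2 * pochhammer (real (r + d)) r)
        * harm_between r (r + d - 1) * (2 * s) ^ (2 * r + d - 1) * T_coeff n d s) :: complex)"
      by (simp only: of_real_sum)
    also have "(\<Sum>d=0..n-1. (-1) ^ (r + d) * fact (r - 1) / (2 * pochhammer (real (r + d)) r)
        * harm_between r (r + d - 1) * (2 * s) ^ (2 * r + d - 1) * T_coeff n d s) = f_poly n r s"
      unfolding f_poly_def
    proof (rule sum.mono_neutral_right)
      \<comment> \<open>The empty harmonic sum removes \<open>d = 0\<close>; this is why
        \<open>f_poly\<close> starts at \<open>d = 1\<close>.\<close>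
      have "harm_between r (r - 1) = 0" using r by (simp add: harm_between_def)
      then show "\<forall>i\<in>{0..n - 1} - {1..n - 1}. (-1) ^ (r + i) * fact (r - 1) / (2 * pochhammer (real (r + i)) r)
        * harm_between r (r + i - 1) * (2 * s) ^ (2 * r + i - 1) * T_coeff n i s = 0"
        by (auto simp: not_le)
    qed auto
    finally show ?thesis .
  qed
  define L where "L = (if \<bar>s\<bar> < n_check n then ev 0 ^ b * ln (ev 0) else 0)"
  have dH: "- deriv (remove_sings H) (1 - of_nat r) =
      of_real L + of_real (f_poly n r s) - hurwitz_poly_deriv x Q1 - hurwitz_poly_deriv (x + u) Q2"
  proof -
    define w0 where "w0 = (- of_nat b :: complex)"
    have w0: "1 - of_nat r = w0" using r by (simp add: w0_def b_def of_nat_diff)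
    have "H analytic_on {w0}"
      unfolding H_def[abs_def] using Z0(1)
      by (intro analytic_on_add analytic_on_sum analytic_on_mult analytic_on_const aE shiftZ) (simp add: w0_def)
    then have 1: "deriv (remove_sings H) w0 = deriv H w0" by (rule deriv_remove_sings_at_analytic)
    have dZ: "((\<lambda>w. Z d (w + of_nat b)) has_field_derivative deriv (Z d) 0) (at w0)" for d
    proof -
      have "(Z d has_field_derivative deriv (Z d) 0) (at (w0 + of_nat b))"
        using Z0(1)[of d] by (simp add: w0_def analytic_derivI)
      moreover have "((\<lambda>w. w + of_nat b) has_field_derivative 1) (at w0)"
        by (auto intro!: derivative_eq_intros)
      ultimately have "((\<lambda>w. Z d (w + of_nat b)) has_field_derivative deriv (Z d) 0 * 1) (at w0)"
        by (rule DERIV_chain2[where g = "\<lambda>w. w + of_nat b"])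
      then show ?thesis by simp
    qed
    have dE: "(E has_field_derivative - of_real L) (at w0)"
    proof (cases "\<bar>s\<bar> < n_check n")
      case True
      then have p: "ev 0 > 0" using ev0_pos by simp
      have "(\<lambda>w. of_real (ev 0) powr (- w)) = (\<lambda>w::complex. exp (- w * of_real (ln (ev 0))))"
        using p by (simp add: powr_def Ln_of_real fun_eq_iff)
      moreover have "((\<lambda>w. exp (- w * of_real (ln (ev 0)))) has_field_derivative
          exp (of_nat b * of_real (ln (ev 0))) * - of_real (ln (ev 0))) (at w0)"
        by (auto intro!: derivative_eq_intros simp: w0_def)
      moreover have "exp (of_nat b * of_real (ln (ev 0))) = (of_real (ev 0) ^ b :: complex)"
        using p by (simp add: exp_of_nat_mult exp_of_real)
      ultimately have "((\<lambda>w. of_real (ev 0) powr (- w)) has_field_derivative - (of_real (ev 0) ^ b * of_real (ln (ev 0)))) (at w0)"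
        by simp
      then show ?thesis using True by (simp add: E_def[abs_def] L_def)
    next
      case False
      then show ?thesis by (simp add: E_def[abs_def] L_def)
    qed
    have "(H has_field_derivative (\<Sum>d=0..n-1. of_real (T d) * deriv (Z d) 0) + - of_real L) (at w0)"
      unfolding H_def[abs_def] by (intro DERIV_add DERIV_sum DERIV_cmult dZ dE)
    then have 2: "deriv H w0 = (\<Sum>d=0..n-1. of_real (T d) * deriv (Z d) 0) - of_real L"
      by (simp add: DERIV_imp_deriv)
    have "(\<Sum>d=0..n-1. of_real (T d) * deriv (Z d) 0) =
       (\<Sum>d=0..n-1. of_real (T d) * hurwitz_poly_deriv x ([:0, 1:] ^ (d + b) * [:u, 1:] ^ b)) +
       (\<Sum>d=0..n-1. of_real (T d) * hurwitz_poly_deriv (x + u) ([:- u, 1:] ^ (d + b) * [:0, 1:] ^ b)) -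
       (\<Sum>d=0..n-1. of_real (T d) * (of_real u ^ ((d + b) + b + 1) * deriv (pole_coeff (d + b) b) 0 / 2))"
      unfolding Z0(2) by (simp only: ring_distribs sum.distrib sum_subtractf)
    also have "\<dots> = hurwitz_poly_deriv x Q1 + hurwitz_poly_deriv (x + u) Q2 - of_real (f_poly n r s)"
      unfolding fp by (simp only: Q1_def Q2_def hurwitz_poly_deriv_sum hurwitz_poly_deriv_smult)
    finally show ?thesis unfolding w0 1 2 by simp
  qed
  have rb: "r + d - 1 = d + b" for d using r by (simp add: b_def)
  have q1: "poly Q1 (real m + x) = (\<Sum>d=0..n-1. T_coeff n d s * ((real m + xi_minus n s) ^ (r + d - 1) * (real m + xi_plus n s) ^ (r - 1)))" for m
    unfolding rb b_def[symmetric] xu[symmetric] x_def[symmetric]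
    by (simp add: Q1_def poly_sum poly_power T_def add_ac)
  have q2: "poly Q2 (real m + (x + u)) = (\<Sum>d=0..n-1. T_coeff n d s * ((real m + xi_minus n s) ^ (r + d - 1) * (real m + xi_plus n s) ^ (r - 1)))" for m
    unfolding rb b_def[symmetric] xu[symmetric] x_def[symmetric]
    by (simp add: Q2_def poly_sum poly_power T_def)
  obtain g1 where g1: "\<And>l. l \<ge> 1 \<Longrightarrow> multiple_gamma l (of_real x) = of_real (exp (g1 l))"
    "(\<Sum>l=1..2*r+n-2. beta_poly n r s l * g1 l) = - Re (hurwitz_poly_deriv x Q1)"
    by (rule sum_beta_hurwitz_poly_deriv[OF n r x(1) q1]) (rule that; assumption)
  obtain g2 where g2: "\<And>l. l \<ge> 1 \<Longrightarrow> multiple_gamma l (of_real (x + u)) = of_real (exp (g2 l))"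
    "(\<Sum>l=1..2*r+n-2. beta_poly n r s l * g2 l) = - Re (hurwitz_poly_deriv (x + u) Q2)"
    by (rule sum_beta_hurwitz_poly_deriv[OF n r x(2) q2]) (rule that; assumption)
  have "(\<Prod>l=1..2*r+n-2. (multiple_gamma l (of_real (x + u)) * multiple_gamma l (of_real x)) powr of_real (beta_poly n r s l)) =
     (\<Prod>l=1..2*r+n-2. of_real (exp (beta_poly n r s l * g2 l + beta_poly n r s l * g1 l)))"
  proof (rule prod.cong)
    fix l assume "l \<in> {1..2*r+n-2}"
    then have l: "l \<ge> 1" by simp
    \<comment> \<open>Both gamma values are positive reals, so the principal power of the product is
      a real exponential.\<close>
    have "(multiple_gamma l (of_real (x + u)) * multiple_gamma l (of_real x)) powr of_real (beta_poly n r s l) =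
        of_real (exp (g2 l + g1 l)) powr of_real (beta_poly n r s l)"
      unfolding g1(1)[OF l] g2(1)[OF l] by (simp add: exp_add)
    also have "\<dots> = of_real (exp (g2 l + g1 l) powr beta_poly n r s l)"
      by (rule powr_of_real) simp
    also have "exp (g2 l + g1 l) powr beta_poly n r s l = exp (beta_poly n r s l * g2 l + beta_poly n r s l * g1 l)"
      by (simp add: powr_def ring_distribs)
    finally show "(multiple_gamma l (of_real (x + u)) * multiple_gamma l (of_real x)) powr of_real (beta_poly n r s l) =
        of_real (exp (beta_poly n r s l * g2 l + beta_poly n r s l * g1 l))" .
  qed simp
  also have "\<dots> = of_real (exp ((\<Sum>l=1..2*r+n-2. beta_poly n r s l * g2 l) + (\<Sum>l=1..2*r+n-2. beta_poly n r s l * g1 l)))"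
    by (simp add: exp_sum sum.distrib[symmetric])
  also have "\<dots> = exp (- hurwitz_poly_deriv x Q1 - hurwitz_poly_deriv (x + u) Q2)"
  proof -
    have "hurwitz_poly_deriv x Q1 = of_real (Re (hurwitz_poly_deriv x Q1))"
      "hurwitz_poly_deriv (x + u) Q2 = of_real (Re (hurwitz_poly_deriv (x + u) Q2))"
      using hurwitz_poly_deriv_real[OF x(1)] hurwitz_poly_deriv_real[OF x(2)] by simp_all
    then have "- hurwitz_poly_deriv x Q1 - hurwitz_poly_deriv (x + u) Q2 =
        of_real (- Re (hurwitz_poly_deriv (x + u) Q2) + - Re (hurwitz_poly_deriv x Q1))"
      by (metis (no_types, opaque_lifting) add.commute diff_conv_add_uminus of_real_add of_real_minus)
    then show ?thesis unfolding g1(2) g2(2) by (simp only: exp_of_real)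
  qed
  finally have prod: "(\<Prod>l=1..2*r+n-2. (multiple_gamma l (of_real (xi_plus n s)) * multiple_gamma l (of_real (xi_minus n s)))
      powr of_real (beta_poly n r s l)) = exp (- hurwitz_poly_deriv x Q1 - hurwitz_poly_deriv (x + u) Q2)"
    unfolding xu[symmetric] x_def[symmetric] .
  have pre: "(if \<bar>s\<bar> < n_check n then ((n_check n)\<^sup>2 - s\<^sup>2) powr (((n_check n)\<^sup>2 - s\<^sup>2) ^ (r - 1)) else 1) = exp L"
    using ev0_pos unfolding ev0[symmetric] L_def b_def by (auto simp: powr_def)
  show ?thesis
    unfolding cs dH prod pre
    by (simp only: exp_of_real[symmetric] exp_add[symmetric]) (simp add: algebra_simps)
qed

section \<open>The sphere Laplacian in ambient coordinates\<close>

lemma open_nonzero: "open (- {0 :: 'a::real_normed_vector})"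
  by (simp add: open_Compl)

lemma partial_eq: "(f has_derivative D) (at x) \<Longrightarrow> partial b f x = D b"
  by (simp add: partial_def frechet_derivative_at[symmetric])

lemma has_derivative_partial:
  "f differentiable at x \<Longrightarrow> (f has_derivative frechet_derivative f (at x)) (at x)"
  by (simp add: frechet_derivative_works)

text \<open>Functions equal near \<open>x\<close> have the same derivatives there, so the choice
  operator in \<open>frechet_derivative\<close> acts on identical predicates.\<close>

lemma partial_cong:
  assumes "open S" "x \<in> S" "\<And>y. y \<in> S \<Longrightarrow> f y = g y"
  shows "partial b f x = partial b g x"
proof -
  have "(f has_derivative D) (at x) \<longleftrightarrow> (g has_derivative D) (at x)" for D
    using has_derivative_transform_within_open[OF _ assms(1,2), of f D UNIV g]
      has_derivative_transform_within_open[OF _ assms(1,2), of g D UNIV f] assms(3) by auto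
  then show ?thesis by (simp add: partial_def frechet_derivative_def)
qed

lemma differentiable_cong:
  assumes "open S" "x \<in> S" "\<And>y. y \<in> S \<Longrightarrow> f y = g y"
  shows "f differentiable at x \<longleftrightarrow> g differentiable at x"
  unfolding differentiable_def
  using has_derivative_transform_within_open[OF _ assms(1,2), of f _ UNIV g]
    has_derivative_transform_within_open[OF _ assms(1,2), of g _ UNIV f] assms(3) by auto

lemma partial_add:
  assumes "f differentiable at x" "g differentiable at x"
  shows "partial b (\<lambda>x. f x + g x) x = partial b f x + partial b g x"
  by (subst partial_eq[OF has_derivative_add[OF assms[THEN has_derivative_partial]]]) (simp add: partial_def)

lemma partial_mult:
  assumes "f differentiable at x" "g differentiable at x"
  shows "partial b (\<lambda>x. f x * g x) x = f x * partial b g x + partial b f x * g x"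
  by (subst partial_eq[OF has_derivative_mult[OF assms[THEN has_derivative_partial]]]) (simp add: partial_def)

lemma partial_const [simp]: "partial b (\<lambda>x. c) x = 0"
  by (subst partial_eq[OF has_derivative_const]) simp

lemma partial_const_fun: "p = (\<lambda>x. c) \<Longrightarrow> partial b p = (\<lambda>x. 0)"
  by (simp only:) (rule ext, rule partial_const)

lemma partial_cmult:
  assumes "f differentiable at x"
  shows "partial b (\<lambda>x. c * f x) x = c * partial b f x"
  using partial_mult[OF differentiable_const assms, of b c] by simp

lemma partial_inner: "partial b (\<lambda>x. x \<bullet> c) x = b \<bullet> c"
proof -
  have "((\<lambda>x. x \<bullet> c) has_derivative (\<lambda>h. h \<bullet> c)) (at x)"
    by (auto intro!: derivative_eq_intros)
  then show ?thesis by (rule partial_eq)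
qed

lemma differentiable_inner_right: "(\<lambda>x. x \<bullet> c) differentiable at x"
  by (auto intro!: derivative_intros)

lemma has_derivative_inverse_norm:
  fixes x :: "'a::euclidean_space"
  assumes "x \<noteq> 0"
  shows "((\<lambda>x. inverse (norm x)) has_derivative (\<lambda>h. - (h \<bullet> x) * inverse (norm x) ^ 3)) (at x)"
proof -
  have n: "(norm has_derivative (\<lambda>h. h \<bullet> sgn x)) (at x)"
    using has_derivative_norm[OF assms] by (simp add: inner_commute)
  show ?thesis
    by (rule has_derivative_eq_rhs[OF Deriv.has_derivative_inverse[OF _ n]])
      (use assms in \<open>auto simp: sgn_div_norm power3_eq_cube fun_eq_iff\<close>)
qed

lemma partial_inverse_norm:
  assumes "x \<noteq> 0"
  shows "partial b (\<lambda>x. inverse (norm x)) x = - (x \<bullet> b) * inverse (norm x) ^ 3"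
  using partial_eq[OF has_derivative_inverse_norm[OF assms], of b] by (simp add: inner_commute)

lemma partial_norm:
  fixes x :: "'a::euclidean_space"
  assumes "x \<noteq> 0"
  shows "partial b norm x = (x \<bullet> b) / norm x" "(norm :: 'a \<Rightarrow> real) differentiable at x"
proof -
  have n: "(norm has_derivative (\<lambda>h. h \<bullet> sgn x)) (at x)"
    using has_derivative_norm[OF assms] by (simp add: inner_commute)
  show "partial b norm x = (x \<bullet> b) / norm x"
    using partial_eq[OF n, of b] by (simp add: sgn_div_norm inner_commute divide_inverse)
  show "(norm :: 'a \<Rightarrow> real) differentiable at x" using n by (auto simp: differentiable_def)
qed

section \<open>Smoothness of extensions along rays\<close>

lemma Ck_on_cong:
  assumes "open S" "\<And>x. x \<in> S \<Longrightarrow> f x = g x"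
  shows "Ck_on k f S \<longleftrightarrow> Ck_on k g S"
  using assms(2)
proof (induction k arbitrary: f g)
  case 0
  then show ?case by (simp cong: continuous_on_cong)
next
  case (Suc k)
  have "f differentiable_on S \<longleftrightarrow> g differentiable_on S"
    using differentiable_cong[OF assms(1) _ Suc.prems] by (simp add: differentiable_on_eq_differentiable_at[OF assms(1)])
  moreover have "Ck_on k (partial b f) S \<longleftrightarrow> Ck_on k (partial b g) S" for b
    by (rule Suc.IH) (rule partial_cong[OF assms(1) _ Suc.prems])
  ultimately show ?case by simp
qed

lemma Ck_on_lin:
  assumes "open S" "Ck_on k f S" "Ck_on k g S"
  shows "Ck_on k (\<lambda>x. f x + c * g x) S"
  using assms(2,3)
proof (induction k arbitrary: f g)
  case 0
  then show ?case by (auto intro!: continuous_intros)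
next
  case (Suc k)
  have d: "f differentiable at x" "g differentiable at x" if "x \<in> S" for x
    using Suc.prems that by (auto simp: differentiable_on_eq_differentiable_at[OF assms(1)])
  have "Ck_on k (partial b (\<lambda>x. f x + c * g x)) S" if "b \<in> Basis" for b
  proof -
    have "partial b (\<lambda>x. f x + c * g x) x = partial b f x + c * partial b g x" if "x \<in> S" for x
      using d[OF that] by (simp add: partial_add partial_cmult)
    moreover have "Ck_on k (\<lambda>x. partial b f x + c * partial b g x) S"
      using Suc.IH Suc.prems that by auto
    ultimately show ?thesis
      using Ck_on_cong[OF assms(1), of "partial b (\<lambda>x. f x + c * g x)" "\<lambda>x. partial b f x + c * partial b g x" k]
      by simp
  qed
  moreover have "(\<lambda>x. f x + c * g x) differentiable_on S"
    using Suc.prems by (auto intro!: derivative_intros)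
  ultimately show ?case by simp
qed

text \<open>An algebra containing the extensions of polynomials along rays and closed, away from 0,
  under partial derivatives. Closure is what proves smoothness of every order.\<close>

inductive norm_poly :: "('a::euclidean_space \<Rightarrow> real) \<Rightarrow> bool" where
  norm_poly_const: "norm_poly (\<lambda>x. c)"
| norm_poly_inner: "norm_poly (\<lambda>x. x \<bullet> b)"
| norm_poly_inverse_norm: "norm_poly (\<lambda>x. inverse (norm x))"
| norm_poly_add: "norm_poly f \<Longrightarrow> norm_poly g \<Longrightarrow> norm_poly (\<lambda>x. f x + g x)"
| norm_poly_mult: "norm_poly f \<Longrightarrow> norm_poly g \<Longrightarrow> norm_poly (\<lambda>x. f x * g x)"

lemma norm_poly_partial:
  assumes "norm_poly f"
  shows "(\<forall>x. x \<noteq> 0 \<longrightarrow> f differentiable at x) \<and> (\<exists>g. norm_poly g \<and> (\<forall>x. x \<noteq> 0 \<longrightarrow> partial b f x = g x))"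
  using assms
proof induction
  case (norm_poly_const c)
  then show ?case by (auto intro!: exI[of _ "\<lambda>x. 0"] norm_poly.intros)
next
  case (norm_poly_inner c)
  then show ?case
    by (auto intro!: exI[of _ "\<lambda>x. b \<bullet> c"] norm_poly.intros simp: partial_inner differentiable_inner_right)
next
  case norm_poly_inverse_norm
  have "norm_poly (\<lambda>x. (-1) * ((x \<bullet> b) * (inverse (norm x) * (inverse (norm x) * inverse (norm x)))))"
    by (intro norm_poly.intros)
  moreover have "(\<lambda>x::'a. inverse (norm x)) differentiable at x" if "x \<noteq> 0" for x
    using has_derivative_inverse_norm[OF that] by (auto simp: differentiable_def)
  ultimately show ?case
    by (auto intro!: exI[of _ "\<lambda>x. (-1) * ((x \<bullet> b) * (inverse (norm x) * (inverse (norm x) * inverse (norm x))))"]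
        simp: partial_inverse_norm power3_eq_cube)
next
  case (norm_poly_add f g)
  then obtain f' g' where "norm_poly f'" "norm_poly g'" "\<forall>x. x \<noteq> 0 \<longrightarrow> partial b f x = f' x" "\<forall>x. x \<noteq> 0 \<longrightarrow> partial b g x = g' x"
    by blast
  with norm_poly_add show ?case
    by (auto intro!: exI[of _ "\<lambda>x. f' x + g' x"] norm_poly.intros simp: partial_add)
next
  case (norm_poly_mult f g)
  then obtain f' g' where "norm_poly f'" "norm_poly g'" "\<forall>x. x \<noteq> 0 \<longrightarrow> partial b f x = f' x" "\<forall>x. x \<noteq> 0 \<longrightarrow> partial b g x = g' x"
    by blast
  with norm_poly_mult show ?case
    by (auto intro!: exI[of _ "\<lambda>x. f x * g' x + f' x * g x"] norm_poly.intros simp: partial_mult)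
qed

lemma Ck_on_norm_poly: "norm_poly f \<Longrightarrow> Ck_on k f (- {0})"
proof (induction k arbitrary: f)
  case 0
  have "continuous (at x) f" if "x \<noteq> 0" for x
    using norm_poly_partial[OF 0] that differentiable_imp_continuous_within by blast
  then show ?case by (simp add: continuous_at_imp_continuous_on)
next
  case (Suc k)
  have "Ck_on k (partial b f) (- {0})" for b
  proof -
    obtain g where g: "norm_poly g" "\<forall>x. x \<noteq> 0 \<longrightarrow> partial b f x = g x"
      using norm_poly_partial[OF Suc.prems, of b] by blast
    have "Ck_on k (partial b f) (- {0}) \<longleftrightarrow> Ck_on k g (- {0})"
      by (rule Ck_on_cong) (use g in auto)
    then show ?thesis using Suc.IH[OF g(1)] by simp
  qed
  moreover have "f differentiable_on - {0}"
    using norm_poly_partial[OF Suc.prems] by (simp add: differentiable_on_eq_differentiable_at[OF open_nonzero])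
  ultimately show ?case by simp
qed

lemma smooth_sphereD:
  fixes f :: "'a::euclidean_space \<Rightarrow> real"
  assumes "f \<in> smooth_sphere"
  defines "F \<equiv> \<lambda>x. f (sgn x)"
  shows "\<And>x. x \<noteq> 0 \<Longrightarrow> F differentiable at x"
    and "\<And>x b. x \<noteq> 0 \<Longrightarrow> b \<in> Basis \<Longrightarrow> partial b F differentiable at x"
    and "continuous_on (- {0}) F"
    and "\<And>b. b \<in> Basis \<Longrightarrow> continuous_on (- {0}) (partial b F)"
    and "\<And>b c. b \<in> Basis \<Longrightarrow> c \<in> Basis \<Longrightarrow> continuous_on (- {0}) (partial c (partial b F))"
    and "\<And>x. x \<notin> sphere 0 1 \<Longrightarrow> f x = 0"
proof -
  have "Ck_on k F (- {0})" for k using assms by (simp add: smooth_sphere_def)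
  from this[of 2] have C: "F differentiable_on - {0}"
     "\<And>b. b \<in> Basis \<Longrightarrow> partial b F differentiable_on - {0}"
     "\<And>b c. b \<in> Basis \<Longrightarrow> c \<in> Basis \<Longrightarrow> continuous_on (- {0}) (partial c (partial b F))"
    by (simp_all add: numeral_2_eq_2)
  show "F differentiable at x" if "x \<noteq> 0" for x
    using C(1) that by (simp add: differentiable_on_eq_differentiable_at[OF open_nonzero])
  show "partial b F differentiable at x" if "x \<noteq> 0" "b \<in> Basis" for x b
    using C(2)[OF that(2)] that(1) by (simp add: differentiable_on_eq_differentiable_at[OF open_nonzero])
  show "continuous_on (- {0}) F" by (rule differentiable_imp_continuous_on[OF C(1)])
  show "continuous_on (- {0}) (partial b F)" if "b \<in> Basis" for b
    by (rule differentiable_imp_continuous_on[OF C(2)[OF that]])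
  show "continuous_on (- {0}) (partial c (partial b F))" if "b \<in> Basis" "c \<in> Basis" for b c
    by (rule C(3)[OF that])
  show "f x = 0" if "x \<notin> sphere 0 1" for x using assms(1) that by (simp add: smooth_sphere_def)
qed

lemma sgn_scale: "t > 0 \<Longrightarrow> sgn (t *\<^sub>R x) = sgn (x::'a::real_normed_vector)"
  by (simp add: sgn_scaleR)

text \<open>The chain rule for the dilation by \<open>t\<close>. It is applied to extensions along
  rays with \<open>c = 1\<close> and to their partial derivatives with \<open>c = inverse t\<close>,
  which gives the degrees -1 and -2 of the derivatives.\<close>

lemma partial_scale:
  fixes F :: "'a::euclidean_space \<Rightarrow> real"
  assumes t: "t > 0" and d: "F differentiable at (t *\<^sub>R x)"
    and h: "\<And>y. y \<noteq> 0 \<Longrightarrow> F (t *\<^sub>R y) = c * F y" and x: "x \<noteq> 0"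
    and d': "F differentiable at x"
  shows "t * partial b F (t *\<^sub>R x) = c * partial b F x"
proof -
  have "((\<lambda>y. t *\<^sub>R y) has_derivative (\<lambda>y. t *\<^sub>R y)) (at x)"
    by (auto intro!: derivative_eq_intros)
  from has_derivative_compose[OF this has_derivative_partial[OF d]]
  have "((\<lambda>y. F (t *\<^sub>R y)) has_derivative (\<lambda>y. frechet_derivative F (at (t *\<^sub>R x)) (t *\<^sub>R y))) (at x)" .
  from partial_eq[OF this, of b]
  have "partial b (\<lambda>y. F (t *\<^sub>R y)) x = frechet_derivative F (at (t *\<^sub>R x)) (t *\<^sub>R b)" .
  also have "\<dots> = t * partial b F (t *\<^sub>R x)"
    using has_derivative_linear[OF has_derivative_partial[OF d]]
    by (simp add: partial_def linear_scale)
  finally have "t * partial b F (t *\<^sub>R x) = partial b (\<lambda>y. F (t *\<^sub>R y)) x" ..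
  also have "\<dots> = partial b (\<lambda>y. c * F y) x"
    by (rule partial_cong[of "- {0}"]) (use x h in auto)
  finally show ?thesis using partial_cmult[OF d'] by simp
qed

text \<open>Differentiate the constant function \<open>t \<mapsto> f (sgn (t *\<^sub>R x))\<close>
  at \<open>t = 1\<close> and expand \<open>x\<close> in the basis.\<close>

lemma radial_derivative_zero:
  fixes f :: "'a::euclidean_space \<Rightarrow> real"
  assumes "f \<in> smooth_sphere" "x \<noteq> 0"
  shows "(\<Sum>b\<in>Basis. (x \<bullet> b) * partial b (\<lambda>x. f (sgn x)) x) = 0"
proof -
  let ?F = "\<lambda>x. f (sgn x)"
  let ?D = "frechet_derivative ?F (at x)"
  have D: "(?F has_derivative ?D) (at x)"
    using smooth_sphereD(1)[OF assms] by (rule has_derivative_partial)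
  have "((\<lambda>t. t *\<^sub>R x) has_derivative (\<lambda>t. t *\<^sub>R x)) (at (1::real))"
    by (auto intro!: derivative_eq_intros)
  then have "((\<lambda>t. ?F (t *\<^sub>R x)) has_derivative (\<lambda>t. ?D (t *\<^sub>R x))) (at (1::real))"
    using has_derivative_compose[of "\<lambda>t. t *\<^sub>R x" "\<lambda>t. t *\<^sub>R x" 1 UNIV ?F ?D] D by simp
  moreover have "((\<lambda>t. ?F (t *\<^sub>R x)) has_derivative (\<lambda>t. 0)) (at (1::real))"
    by (rule has_derivative_transform_within_open[of "\<lambda>t. ?F x" _ _ _ "{0<..}"]) (auto simp: sgn_scale)
  ultimately have "(\<lambda>t. ?D (t *\<^sub>R x)) = (\<lambda>t::real. 0)" by (rule has_derivative_unique)
  then have "?D (1 *\<^sub>R x) = 0" by (rule fun_cong)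
  then have "?D (\<Sum>b\<in>Basis. (x \<bullet> b) *\<^sub>R b) = 0" by (simp add: euclidean_representation)
  then show ?thesis
    using has_derivative_linear[OF D] by (simp add: linear_sum linear_scale partial_def)
qed

text \<open>The gradient of the extension is homogeneous of degree -1, so extending the gradient
  along rays multiplies it by \<open>norm y\<close>. Differentiating this factor produces only the
  radial derivative, which vanishes.\<close>

lemma sphere_laplacian_eq:
  fixes f :: "'a::euclidean_space \<Rightarrow> real"
  assumes f: "f \<in> smooth_sphere" and x: "norm x = 1"
  shows "sphere_laplacian f x = - (\<Sum>b\<in>Basis. partial b (partial b (\<lambda>x. f (sgn x))) x)"
proof -
  let ?F = "\<lambda>x. f (sgn x)"
  have x0: "x \<noteq> 0" using x by auto
  have g: "sphere_grad f z \<bullet> b = partial b ?F z" if "b \<in> Basis" for z b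
    unfolding sphere_grad_def using that by (simp add: inner_sum_left inner_Basis if_distrib sum.delta cong: if_cong)
  have "partial b (\<lambda>y. sphere_grad f (sgn y) \<bullet> b) x = (x \<bullet> b) * partial b ?F x + partial b (partial b ?F) x"
    if b: "b \<in> Basis" for b
  proof -
    have "partial b ?F (sgn y) = norm y * partial b ?F y" if "y \<noteq> 0" for y
    proof -
      have "sgn y \<noteq> 0" using that by (simp add: sgn_zero_iff)
      moreover have "norm y *\<^sub>R sgn y = y" using that by (simp add: sgn_div_norm)
      ultimately show ?thesis
        using partial_scale[of "norm y" ?F "sgn y" 1 b] smooth_sphereD(1)[OF f] that
        by (simp add: sgn_scale)
    qed
    then have "partial b (\<lambda>y. sphere_grad f (sgn y) \<bullet> b) x = partial b (\<lambda>y. norm y * partial b ?F y) x"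
      by (intro partial_cong[of "- {0}"]) (use x0 g[OF b] in auto)
    also have "\<dots> = norm x * partial b (partial b ?F) x + partial b norm x * partial b ?F x"
      by (intro partial_mult partial_norm x0 smooth_sphereD(2)[OF f x0 b])
    finally show ?thesis using x partial_norm(1)[OF x0, of b] by simp
  qed
  then have "sphere_div (sphere_grad f) x = (\<Sum>b\<in>Basis. (x \<bullet> b) * partial b ?F x) + (\<Sum>b\<in>Basis. partial b (partial b ?F) x)"
    by (simp add: sphere_div_def sum.distrib)
  then show ?thesis
    using radial_derivative_zero[OF f x0] x by (simp add: sphere_laplacian_def)
qed

lemma smooth_sphere_lin:
  assumes "f \<in> smooth_sphere" "g \<in> smooth_sphere"
  shows "(\<lambda>x. f x + c * g x) \<in> smooth_sphere"
  using assms Ck_on_lin[OF open_nonzero, of _ "\<lambda>x. f (sgn x)" "\<lambda>x. g (sgn x)" c] by (auto simp: smooth_sphere_def)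

lemma sphere_laplacian_lin:
  assumes f: "f \<in> smooth_sphere" and g: "g \<in> smooth_sphere"
  shows "sphere_laplacian (\<lambda>x. f x + c * g x) x = sphere_laplacian f x + c * sphere_laplacian g x"
proof (cases "x \<in> sphere 0 1")
  case True
  then have x: "norm x = 1" "x \<noteq> 0" by auto
  let ?F = "\<lambda>x. f (sgn x)" and ?G = "\<lambda>x. g (sgn x)"
  have "partial b (partial b (\<lambda>x. ?F x + c * ?G x)) x = partial b (partial b ?F) x + c * partial b (partial b ?G) x"
    if b: "b \<in> Basis" for b
  proof -
    have "partial b (\<lambda>x. ?F x + c * ?G x) y = partial b ?F y + c * partial b ?G y" if "y \<noteq> 0" for y
      using smooth_sphereD(1)[OF f that] smooth_sphereD(1)[OF g that] by (simp add: partial_add partial_cmult)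
    then have "partial b (partial b (\<lambda>x. ?F x + c * ?G x)) x = partial b (\<lambda>y. partial b ?F y + c * partial b ?G y) x"
      by (intro partial_cong[of "- {0}"]) (use x in auto)
    then show ?thesis
      using smooth_sphereD(2)[OF f x(2) b] smooth_sphereD(2)[OF g x(2) b] by (simp add: partial_add partial_cmult)
  qed
  then show ?thesis
    using sphere_laplacian_eq[OF f x(1)] sphere_laplacian_eq[OF g x(1)] sphere_laplacian_eq[OF smooth_sphere_lin[OF f g] x(1), of c]
    by (simp add: sum.distrib sum_distrib_left)
next
  case False
  then show ?thesis by (simp add: sphere_laplacian_def)
qed

section \<open>Homogeneous polynomials\<close>

inductive hpoly :: "nat \<Rightarrow> ('a::euclidean_space \<Rightarrow> real) \<Rightarrow> bool" where
  hpoly_const: "hpoly 0 (\<lambda>x. c)"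
| hpoly_mult: "b \<in> Basis \<Longrightarrow> hpoly k p \<Longrightarrow> hpoly (Suc k) (\<lambda>x. (x \<bullet> b) * p x)"
| hpoly_add: "hpoly k p \<Longrightarrow> hpoly k q \<Longrightarrow> hpoly k (\<lambda>x. p x + q x)"

lemma hpoly_cmult: "hpoly k p \<Longrightarrow> hpoly k (\<lambda>x. c * p x)"
proof (induction rule: hpoly.induct)
  case (hpoly_const d)
  then show ?case by (rule hpoly.hpoly_const)
next
  case (hpoly_mult b k p)
  from hpoly.hpoly_mult[OF hpoly_mult(1,3)] show ?case by (simp add: mult_ac)
next
  case (hpoly_add k p q)
  from hpoly.hpoly_add[OF hpoly_add(3,4)] show ?case by (simp add: distrib_left)
qed

lemma hpoly_zero: "hpoly k (\<lambda>x. 0)"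
proof (induction k)
  case 0
  show ?case by (rule hpoly_const)
next
  case (Suc k)
  from hpoly_mult[OF SOME_Basis Suc] show ?case by simp
qed

lemma hpoly_sum: "(\<And>i. i \<in> I \<Longrightarrow> hpoly k (f i)) \<Longrightarrow> hpoly k (\<lambda>x. \<Sum>i\<in>I. f i x)"
  by (induction I rule: infinite_finite_induct) (auto intro: hpoly_zero hpoly_add)

lemma hpoly_times:
  assumes "hpoly k p" "hpoly l q"
  shows "hpoly (k + l) (\<lambda>x. p x * q x)"
  using assms(1)
proof induction
  case (hpoly_const c)
  then show ?case using hpoly_cmult[OF assms(2)] by simp
next
  case (hpoly_mult b k p)
  from hpoly.hpoly_mult[OF hpoly_mult(1,3)] show ?case by (simp add: mult_ac)
next
  case (hpoly_add k p q')
  from hpoly.hpoly_add[OF hpoly_add(3,4)] show ?case by (simp add: distrib_right)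
qed

lemma hpoly_scale: "hpoly k p \<Longrightarrow> p (t *\<^sub>R x) = t ^ k * p x"
  by (induction rule: hpoly.induct) (auto simp: algebra_simps)

lemma hpoly_differentiable: "hpoly k p \<Longrightarrow> p differentiable at x"
  by (induction rule: hpoly.induct) (auto intro!: differentiable_mult differentiable_add differentiable_inner_right)

lemma hpoly_partial:
  "hpoly k p \<Longrightarrow> (k = 0 \<longrightarrow> (\<exists>c. p = (\<lambda>x. c))) \<and> (k \<noteq> 0 \<longrightarrow> hpoly (k - 1) (partial c p))"
proof (induction rule: hpoly.induct)
  case (hpoly_const c)
  then show ?case by blast
next
  case (hpoly_mult b k p)
  have d: "partial c (\<lambda>x. (x \<bullet> b) * p x) = (\<lambda>x. (x \<bullet> b) * partial c p x + (c \<bullet> b) * p x)"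
    using hpoly_differentiable[OF hpoly_mult(2)]
    by (simp add: fun_eq_iff partial_mult differentiable_inner_right partial_inner)
  have "hpoly k (\<lambda>x. (x \<bullet> b) * partial c p x)"
  proof (cases "k = 0")
    case True
    then obtain a where "p = (\<lambda>x. a)" using hpoly_mult.IH by blast
    then have "partial c p = (\<lambda>x. 0)" by (rule partial_const_fun)
    then show ?thesis by (simp add: hpoly_zero)
  next
    case False
    then show ?thesis using hpoly.hpoly_mult[OF hpoly_mult(1), of "k - 1" "partial c p"] hpoly_mult.IH by simp
  qed
  then show ?case unfolding d by (auto intro!: hpoly_add hpoly_cmult hpoly_mult(2))
next
  case (hpoly_add k p q)
  have d: "partial c (\<lambda>x. p x + q x) = (\<lambda>x. partial c p x + partial c q x)"
    using hpoly_add(1,2)[THEN hpoly_differentiable] by (simp add: fun_eq_iff partial_add)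
  show ?case unfolding d using hpoly_add.IH by (auto intro: hpoly.hpoly_add)
qed

lemma hpoly_0E: "hpoly 0 p \<Longrightarrow> (\<And>c. p = (\<lambda>x. c) \<Longrightarrow> P) \<Longrightarrow> P"
  using hpoly_partial by blast

lemma hpoly_partial_differentiable:
  assumes "hpoly k p"
  shows "partial b p differentiable at x"
proof (cases "k = 0")
  case True
  then obtain c where "p = (\<lambda>x. c)" using assms hpoly_0E by blast
  then have "partial b p = (\<lambda>x. 0)" by (rule partial_const_fun)
  then show ?thesis by simp
next
  case False
  then show ?thesis using hpoly_partial[OF assms] hpoly_differentiable by blast
qed

lemma hpoly_euler: "hpoly k p \<Longrightarrow> (\<Sum>c\<in>Basis. (x \<bullet> c) * partial c p x) = real k * p x"
proof (induction rule: hpoly.induct)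
  case (hpoly_const c)
  then show ?case by simp
next
  case (hpoly_mult b k p)
  have "(\<Sum>c\<in>Basis. (x \<bullet> c) * partial c (\<lambda>x. (x \<bullet> b) * p x) x) =
     (x \<bullet> b) * (\<Sum>c\<in>Basis. (x \<bullet> c) * partial c p x) + (\<Sum>c\<in>Basis. (x \<bullet> c) * (c \<bullet> b)) * p x"
    using hpoly_differentiable[OF hpoly_mult(2)]
    by (simp add: partial_mult differentiable_inner_right partial_inner sum.distrib sum_distrib_left sum_distrib_right algebra_simps)
  also have "(\<Sum>c\<in>Basis. (x \<bullet> c) * (c \<bullet> b)) = x \<bullet> b"
    by (subst euclidean_inner[of x b]) (simp add: inner_commute)
  finally show ?case using hpoly_mult.IH by (simp add: algebra_simps)
next
  case (hpoly_add k p q)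
  then show ?case
    using hpoly_add(1,2)[THEN hpoly_differentiable]
    by (simp add: partial_add distrib_left sum.distrib)
qed

definition laplacian :: "('a::euclidean_space \<Rightarrow> real) \<Rightarrow> 'a \<Rightarrow> real" where
  "laplacian p x = (\<Sum>b\<in>Basis. partial b (partial b p) x)"

lemma hpoly_laplacian:
  assumes "hpoly k p"
  shows "k \<ge> 2 \<Longrightarrow> hpoly (k - 2) (laplacian p)" and "k < 2 \<Longrightarrow> laplacian p = (\<lambda>x. 0)"
proof -
  assume k: "k \<ge> 2"
  have "hpoly (k - 2) (partial b (partial b p))" for b
  proof -
    have "hpoly (k - 1) (partial b p)" using hpoly_partial[OF assms, of b] k by simp
    then have "hpoly (k - 1 - 1) (partial b (partial b p))" using hpoly_partial[of "k - 1" "partial b p" b] k by simp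
    then show ?thesis by (simp add: numeral_2_eq_2)
  qed
  then show "hpoly (k - 2) (laplacian p)"
    unfolding laplacian_def[abs_def] by (intro hpoly_sum)
next
  assume k: "k < 2"
  have "partial b (partial b p) = (\<lambda>x. 0)" for b
  proof -
    have "\<exists>c. partial b p = (\<lambda>x. c)"
    proof (cases "k = 0")
      case True
      then obtain c where "p = (\<lambda>x. c)" using assms hpoly_0E by blast
      from partial_const_fun[OF this] show ?thesis by blast
    next
      case False
      then have "hpoly 0 (partial b p)" using hpoly_partial[OF assms, of b] k by (simp add: less_2_cases_iff)
      then show ?thesis using hpoly_0E by blast
    qed
    then obtain c where "partial b p = (\<lambda>x. c)" by blast
    then show ?thesis by (rule partial_const_fun)
  qed
  then show "laplacian p = (\<lambda>x. 0)" by (simp add: laplacian_def fun_eq_iff)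
qed

definition on_sphere :: "('a::euclidean_space \<Rightarrow> real) \<Rightarrow> 'a \<Rightarrow> real" where
  "on_sphere p = (\<lambda>x. if norm x = 1 then p x else 0)"

lemma on_sphere_sgn: "x \<noteq> 0 \<Longrightarrow> on_sphere p (sgn x) = p (sgn x)"
  by (simp add: on_sphere_def norm_sgn)

lemma hpoly_norm_poly_sgn: "hpoly k p \<Longrightarrow> norm_poly (\<lambda>x. p (sgn x))"
proof (induction rule: hpoly.induct)
  case (hpoly_const c)
  then show ?case by (rule norm_poly_const)
next
  case (hpoly_mult b k p)
  have "norm_poly (\<lambda>x. ((x \<bullet> b) * inverse (norm x)) * p (sgn x))"
    by (intro norm_poly.intros hpoly_mult.IH)
  then show ?case by (simp add: sgn_div_norm mult_ac)
next
  case (hpoly_add k p q)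
  from norm_poly_add[OF hpoly_add(3,4)] show ?case .
qed

lemma hpoly_smooth:
  assumes "hpoly k p"
  shows "on_sphere p \<in> smooth_sphere"
proof -
  have "Ck_on j (\<lambda>x. on_sphere p (sgn x)) (- {0})" for j
    using Ck_on_cong[OF open_nonzero, of "\<lambda>x. on_sphere p (sgn x)" "\<lambda>x. p (sgn x)" j]
      Ck_on_norm_poly[OF hpoly_norm_poly_sgn[OF assms]] by (simp add: on_sphere_sgn)
  then show ?thesis by (simp add: smooth_sphere_def on_sphere_def)
qed

lemma inverse_norm_power:
  fixes x :: "'a::euclidean_space"
  assumes "x \<noteq> 0"
  shows "partial b (\<lambda>x. inverse (norm x) ^ j) x = - real j * ((x \<bullet> b) * inverse (norm x) ^ (j + 2))"
    and "(\<lambda>x::'a. inverse (norm x) ^ j) differentiable at x"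
proof -
  have D: "((\<lambda>x. inverse (norm x) ^ j) has_derivative
     (\<lambda>h. of_nat j * (- (h \<bullet> x) * inverse (norm x) ^ 3) * inverse (norm x) ^ (j - 1))) (at x)"
    by (rule has_derivative_power[OF has_derivative_inverse_norm[OF assms]])
  show "(\<lambda>x::'a. inverse (norm x) ^ j) differentiable at x" using D by (auto simp: differentiable_def)
  show "partial b (\<lambda>x. inverse (norm x) ^ j) x = - real j * ((x \<bullet> b) * inverse (norm x) ^ (j + 2))"
    unfolding partial_eq[OF D]
    by (cases j) (simp_all add: inner_commute power3_eq_cube algebra_simps)
qed

text \<open>\<open>N\<close> is the dimension of the ambient space; for \<open>N = n + 1\<close>
  this is \<open>k * (k + n - 1)\<close>.\<close>

definition sphere_ev :: "nat \<Rightarrow> nat \<Rightarrow> real" where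
  "sphere_ev N k = real k * (real k + real N - 2)"

text \<open>The extension is \<open>p\<close> times \<open>inverse (norm x) ^ k\<close>. On the unit
  sphere the second derivatives sum to the Laplacian of \<open>p\<close> plus multiples of
  \<open>p\<close> with total factor
  \<open>k * (k + 2) - 2 * k * k - k * N = - k * (k + N - 2)\<close>, where \<open>N\<close> is the
  ambient dimension and the middle term comes from Euler's identity.\<close>

lemma sphere_laplacian_hpoly:
  fixes p :: "'a::euclidean_space \<Rightarrow> real"
  assumes p: "hpoly k p"
  shows "sphere_laplacian (on_sphere p) x = sphere_ev DIM('a) k * on_sphere p x - on_sphere (laplacian p) x"
proof (cases "norm x = 1")
  case True
  then have x0: "x \<noteq> 0" by auto
  let ?F = "\<lambda>x. on_sphere p (sgn x)"
  define M where "M j = (\<lambda>x::'a. inverse (norm x) ^ j)" for j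
  have M1: "M j x = 1" for j using True by (simp add: M_def)
  have dM: "M j differentiable at y" "partial b (M j) y = - real j * ((y \<bullet> b) * M (j + 2) y)" if "y \<noteq> 0" for j y b
    unfolding M_def using inverse_norm_power[OF that] by auto
  have F: "?F y = p y * M k y" if "y \<noteq> 0" for y
  proof -
    have "sgn y = inverse (norm y) *\<^sub>R y" by (simp add: sgn_div_norm)
    then show ?thesis using on_sphere_sgn[OF that, of p] hpoly_scale[OF p] by (simp add: M_def mult.commute)
  qed
  have "partial b (partial b ?F) x = partial b (partial b p) x + p x * (real k * (real k + 2) * (x \<bullet> b)\<^sup>2)
      - 2 * real k * ((x \<bullet> b) * partial b p x) - real k * p x" if b: "b \<in> Basis" for b
  proof -
    have 1: "partial b ?F y = (- real k) * ((y \<bullet> b) * (p y * M (k + 2) y)) + partial b p y * M k y" if "y \<noteq> 0" for y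
    proof -
      have "partial b ?F y = partial b (\<lambda>y. p y * M k y) y"
        by (rule partial_cong[OF open_nonzero]) (use that F in auto)
      then show ?thesis
        using partial_mult[OF hpoly_differentiable[OF p] dM(1)[OF that], of b k] dM(2)[OF that] by simp
    qed
    have D1: "(\<lambda>y. p y * M (k + 2) y) differentiable at x"
      by (intro differentiable_mult hpoly_differentiable[OF p] dM x0)
    have D2: "(\<lambda>y. (y \<bullet> b) * (p y * M (k + 2) y)) differentiable at x"
      by (intro differentiable_mult differentiable_inner_right D1)
    have D3: "(\<lambda>y. (- real k) * ((y \<bullet> b) * (p y * M (k + 2) y))) differentiable at x"
      by (intro differentiable_mult differentiable_const D2)
    have D4: "(\<lambda>y. partial b p y * M k y) differentiable at x"
      by (intro differentiable_mult hpoly_partial_differentiable[OF p] dM x0)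
    have "partial b (partial b ?F) x = partial b (\<lambda>y. (- real k) * ((y \<bullet> b) * (p y * M (k + 2) y)) + partial b p y * M k y) x"
      by (rule partial_cong[OF open_nonzero]) (use x0 1 in auto)
    also have "\<dots> = (- real k) * partial b (\<lambda>y. (y \<bullet> b) * (p y * M (k + 2) y)) x + partial b (\<lambda>y. partial b p y * M k y) x"
      by (simp only: partial_add[OF D3 D4] partial_cmult[OF D2])
    also have "partial b (\<lambda>y. (y \<bullet> b) * (p y * M (k + 2) y)) x =
        (x \<bullet> b) * (p x * (- real (k + 2) * (x \<bullet> b)) + partial b p x) + p x"
      using b unfolding partial_mult[OF differentiable_inner_right D1] partial_inner
        partial_mult[OF hpoly_differentiable[OF p] dM(1)[OF x0]] dM(2)[OF x0] M1 by simp
    also have "partial b (\<lambda>y. partial b p y * M k y) x = partial b p x * (- real k * (x \<bullet> b)) + partial b (partial b p) x"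
      unfolding partial_mult[OF hpoly_partial_differentiable[OF p] dM(1)[OF x0]] dM(2)[OF x0] M1 by simp
    finally show ?thesis by (simp add: power2_eq_square algebra_simps)
  qed
  then have "(\<Sum>b\<in>Basis. partial b (partial b ?F) x) =
      laplacian p x + p x * (real k * (real k + 2) * (\<Sum>b\<in>Basis. (x \<bullet> b)\<^sup>2))
      - 2 * real k * (\<Sum>b\<in>Basis. (x \<bullet> b) * partial b p x) - (\<Sum>b\<in>(Basis::'a set). real k * p x)"
    by (simp add: laplacian_def sum.distrib sum_subtractf sum_distrib_left)
  also have "(\<Sum>b\<in>Basis. (x \<bullet> b)\<^sup>2) = 1"
    using True euclidean_inner[of x x] by (simp add: power2_eq_square norm_eq_sqrt_inner)
  also have "(\<Sum>b\<in>Basis. (x \<bullet> b) * partial b p x) = real k * p x" by (rule hpoly_euler[OF p])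
  finally have "(\<Sum>b\<in>Basis. partial b (partial b ?F) x) = laplacian p x - sphere_ev DIM('a) k * p x"
    by (simp add: sphere_ev_def algebra_simps)
  then show ?thesis
    using sphere_laplacian_eq[OF hpoly_smooth[OF p] True] True by (simp add: on_sphere_def)
next
  case False
  then show ?thesis by (simp add: sphere_laplacian_def on_sphere_def)
qed

section \<open>Orthogonality and completeness of eigenfunctions\<close>

lemma integrable_continuous_bounded_support:
  fixes h :: "'a::euclidean_space \<Rightarrow> real"
  assumes "continuous_on UNIV h" "\<And>x. norm x > R \<Longrightarrow> h x = 0"
  shows "integrable lborel h"
proof -
  have "continuous_on (cball 0 R) h" using assms(1) by (rule continuous_on_subset) simp
  then have "integrable lborel (\<lambda>x. indicator (cball 0 R) x *\<^sub>R h x)"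
    by (rule borel_integrable_compact[OF compact_cball])
  also have "(\<lambda>x. indicator (cball 0 R) x *\<^sub>R h x) = h"
    using assms(2) by (auto simp: fun_eq_iff indicator_def not_le)
  finally show ?thesis .
qed

lemma integral_translation:
  fixes h :: "'a::euclidean_space \<Rightarrow> real"
  assumes "h \<in> borel_measurable borel"
  shows "integral\<^sup>L lborel (\<lambda>x. h (c + x)) = integral\<^sup>L lborel h"
    and "integrable lborel (\<lambda>x. h (c + x)) \<longleftrightarrow> integrable lborel h"
  using integral_distr[of "(+) c" lborel borel h] integrable_distr_eq[of "(+) c" lborel borel h] assms
  by (simp_all add: lborel_distr_plus)

text \<open>The integral of a partial derivative vanishes because, by translation invariance, all difference
  quotients have integral zero.\<close>

lemma integral_partial_zero:
  fixes h :: "'a::euclidean_space \<Rightarrow> real"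
  assumes b: "b \<in> Basis" and d: "\<And>x. h differentiable at x"
    and c: "continuous_on UNIV (partial b h)" and R: "\<And>x. norm x > R \<Longrightarrow> h x = 0"
  shows "integrable lborel (partial b h)" "integral\<^sup>L lborel (partial b h) = 0"
proof -
  have ch: "continuous_on UNIV h"
    using d differentiable_imp_continuous_within by (auto simp: continuous_on_eq_continuous_at)
  have out: "partial b h x = 0" if "norm x > R" for x
  proof -
    have "open {x::'a. norm x > R}" by (intro open_Collect_less continuous_intros)
    then have "partial b h x = partial b (\<lambda>x. 0) x"
      by (rule partial_cong) (use that R in auto)
    then show ?thesis by simp
  qed
  show int: "integrable lborel (partial b h)"
    by (rule integrable_continuous_bounded_support[OF c out])
  have inth: "integrable lborel h"
    by (rule integrable_continuous_bounded_support[OF ch R])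
  have mh: "h \<in> borel_measurable borel" using ch by (rule borel_measurable_continuous_onI)
  have "bounded (partial b h ` cball 0 R)"
    by (intro compact_imp_bounded compact_continuous_image continuous_on_subset[OF c]) auto
  then obtain C0 where C0: "\<forall>x\<in>cball 0 R. \<bar>partial b h x\<bar> \<le> C0"
    unfolding bounded_iff by auto
  define C where "C = max C0 0"
  have C: "\<bar>partial b h x\<bar> \<le> C" for x
    using C0[THEN bspec, of x] out[of x] by (cases "norm x \<le> R") (auto simp: C_def)
  have der: "((\<lambda>s. h (x + s *\<^sub>R b)) has_real_derivative partial b h (x + s *\<^sub>R b)) (at s)" for x s
  proof -
    have "((\<lambda>s. x + s *\<^sub>R b) has_derivative (\<lambda>s. s *\<^sub>R b)) (at s)"
      by (auto intro!: derivative_eq_intros)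
    from has_derivative_compose[OF this has_derivative_partial[OF d]]
    have "((\<lambda>s. h (x + s *\<^sub>R b)) has_derivative (\<lambda>t. frechet_derivative h (at (x + s *\<^sub>R b)) (t *\<^sub>R b))) (at s)" .
    moreover have "frechet_derivative h (at (x + s *\<^sub>R b)) (t *\<^sub>R b) = partial b h (x + s *\<^sub>R b) * t" for t
      using has_derivative_linear[OF has_derivative_partial[OF d]] by (simp add: partial_def linear_scale)
    ultimately show ?thesis by (simp add: has_field_derivative_def)
  qed
  define t where "t n = 1 / real (Suc n)" for n
  have t: "t n > 0" "t n \<le> 1" for n by (auto simp: t_def field_simps)
  define D where "D n x = (h (t n *\<^sub>R b + x) - h x) / t n" for n x
  \<comment> \<open>The mean value theorem bounds all difference quotients by the maximum of the
    derivative. As the increments have length at most 1, the quotients vanish outside the ball of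
    radius \<open>R + 1\<close>, which gives an integrable majorant.\<close>
  have mvt: "\<exists>s. D n x = partial b h (x + s *\<^sub>R b)" for n x
  proof -
    obtain z where "h (x + t n *\<^sub>R b) - h (x + 0 *\<^sub>R b) = (t n - 0) * partial b h (x + z *\<^sub>R b)"
      using MVT2[of 0 "t n" "\<lambda>s. h (x + s *\<^sub>R b)" "\<lambda>s. partial b h (x + s *\<^sub>R b)"] der t(1)[of n] by auto
    then show ?thesis using t(1)[of n] by (intro exI[of _ z]) (simp add: D_def add.commute)
  qed
  have bound: "norm (D n x) \<le> C * indicator (cball 0 (R + 1)) x" for n x
  proof (cases "norm x \<le> R + 1")
    case True
    obtain s where "D n x = partial b h (x + s *\<^sub>R b)" using mvt by blast
    then show ?thesis using C[of "x + s *\<^sub>R b"] True by simp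
  next
    case False
    have "norm (t n *\<^sub>R b) \<le> 1" using b t[of n] by simp
    then have "norm (t n *\<^sub>R b + x) > R"
      using False norm_triangle_ineq4[of "t n *\<^sub>R b + x" "t n *\<^sub>R b"] by simp
    then show ?thesis using False R by (simp add: D_def)
  qed
  have lim: "(\<lambda>n. D n x) \<longlonglongrightarrow> partial b h x" for x
  proof -
    have "((\<lambda>s. (h (x + s *\<^sub>R b) - h (x + 0 *\<^sub>R b)) / (s - 0)) \<longlongrightarrow> partial b h (x + 0 *\<^sub>R b)) (at 0)"
      using der[of x 0] by (simp only: has_field_derivative_iff)
    moreover have "filterlim t (at 0) sequentially"
    proof -
      have "t \<longlonglongrightarrow> 0"
        using LIMSEQ_inverse_real_of_nat by (simp add: t_def[abs_def] inverse_eq_divide del: of_nat_Suc)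
      then show ?thesis using t(1) by (auto simp: filterlim_at less_imp_neq[symmetric])
    qed
    ultimately have "(\<lambda>n. (h (x + t n *\<^sub>R b) - h (x + 0 *\<^sub>R b)) / (t n - 0)) \<longlonglongrightarrow> partial b h (x + 0 *\<^sub>R b)"
      by (rule filterlim_compose)
    then show ?thesis by (simp add: D_def add.commute)
  qed
  have "(\<lambda>n. integral\<^sup>L lborel (D n)) \<longlonglongrightarrow> integral\<^sup>L lborel (partial b h)"
  proof (rule integral_dominated_convergence[where w = "\<lambda>x. C * indicator (cball 0 (R + 1)) x"])
    show "partial b h \<in> borel_measurable lborel"
      using borel_measurable_continuous_onI[OF c] by simp
    have "continuous_on UNIV (D n)" for n
      unfolding D_def by (intro continuous_intros continuous_on_compose2[OF ch]) (use t(1)[of n] in auto)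
    then show "D n \<in> borel_measurable lborel" for n
      by (simp add: borel_measurable_continuous_onI)
    show "integrable lborel (\<lambda>x::'a. C * indicator (cball 0 (R + 1)) x)"
      using emeasure_compact_finite[of "cball 0 (R + 1)"] by (intro integrable_mult_right integrable_real_indicator) auto
  qed (use lim bound in auto)
  moreover have "integral\<^sup>L lborel (D n) = 0" for n
    unfolding D_def using integral_translation[OF mh, of "t n *\<^sub>R b"] inth by simp
  ultimately have "(\<lambda>n. 0) \<longlonglongrightarrow> integral\<^sup>L lborel (partial b h)" by simp
  then show "integral\<^sup>L lborel (partial b h) = 0" using LIMSEQ_unique[OF _ tendsto_const] by blast
qed

text \<open>Squaring makes the cut-off differentiable across the spheres of radius 1 and 2.\<close>

definition cutoff :: "'a::euclidean_space \<Rightarrow> real" where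
  "cutoff x = (max 0 ((x \<bullet> x - 1) * (4 - x \<bullet> x)))\<^sup>2"

text \<open>The gradient of \<open>cutoff\<close> at \<open>x\<close> is this scalar times
  \<open>x\<close>. Being radial, it meets only radial derivatives in Green's identity.\<close>

definition cutoff_deriv :: "'a::euclidean_space \<Rightarrow> real" where
  "cutoff_deriv x = 4 * max 0 ((x \<bullet> x - 1) * (4 - x \<bullet> x)) * (5 - 2 * (x \<bullet> x))"

lemma max0_square_deriv: "((\<lambda>t::real. (max 0 t)\<^sup>2) has_real_derivative 2 * max 0 t) (at t)"
proof -
  consider "t > 0" | "t < 0" | "t = 0" by linarith
  then show ?thesis
  proof cases
    case 1
    have "((\<lambda>t::real. t\<^sup>2) has_real_derivative 2 * max 0 t) (at t)"
      using 1 by (auto intro!: derivative_eq_intros)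
    then show ?thesis
      by (rule has_field_derivative_transform_within_open[of _ _ _ "{0<..}"]) (use 1 in auto)
  next
    case 2
    have "((\<lambda>t::real. 0) has_real_derivative 2 * max 0 t) (at t)"
      using 2 by (auto intro!: derivative_eq_intros)
    then show ?thesis
      by (rule has_field_derivative_transform_within_open[of _ _ _ "{..<0}"]) (use 2 in auto)
  next
    case 3
    have "((\<lambda>h::real. (max 0 h)\<^sup>2 / h) \<longlongrightarrow> 0) (at 0)"
    proof (rule Lim_null_comparison)
      show "((\<lambda>h::real. \<bar>h\<bar>) \<longlongrightarrow> 0) (at 0)" by (rule tendsto_rabs_zero) (rule tendsto_ident_at)
      show "\<forall>\<^sub>F h::real in at 0. norm ((max 0 h)\<^sup>2 / h) \<le> \<bar>h\<bar>"
        by (rule always_eventually) (auto simp: max_def power2_eq_square)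
    qed
    then show ?thesis using 3 by (simp add: has_field_derivative_iff)
  qed
qed

lemma has_derivative_cutoff:
  fixes x :: "'a::euclidean_space"
  shows "(cutoff has_derivative (\<lambda>h. cutoff_deriv x * (x \<bullet> h))) (at x)"
proof -
  have "((\<lambda>x. (x \<bullet> x - 1) * (4 - x \<bullet> x)) has_derivative (\<lambda>h. 2 * (x \<bullet> h) * (5 - 2 * (x \<bullet> x)))) (at x)"
    by (rule derivative_eq_intros refl)+ (simp add: fun_eq_iff inner_commute algebra_simps)
  from has_derivative_compose[OF this max0_square_deriv[THEN has_field_derivative_imp_has_derivative]]
  have "((\<lambda>x. (max 0 ((x \<bullet> x - 1) * (4 - x \<bullet> x)))\<^sup>2) has_derivative
      (\<lambda>h. 2 * max 0 ((x \<bullet> x - 1) * (4 - x \<bullet> x)) * (2 * (x \<bullet> h) * (5 - 2 * (x \<bullet> x))))) (at x)" .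
  then have "(cutoff has_derivative
      (\<lambda>h. 2 * max 0 ((x \<bullet> x - 1) * (4 - x \<bullet> x)) * (2 * (x \<bullet> h) * (5 - 2 * (x \<bullet> x))))) (at x)"
    by (simp only: cutoff_def[abs_def])
  then show ?thesis
    by (rule has_derivative_eq_rhs) (simp add: cutoff_deriv_def fun_eq_iff algebra_simps)
qed

lemma partial_cutoff: "partial b cutoff x = cutoff_deriv x * (x \<bullet> b)"
  by (rule partial_eq[OF has_derivative_cutoff])

lemma cutoff_differentiable: "cutoff differentiable at x"
  using has_derivative_cutoff by (auto simp: differentiable_def)

lemma continuous_on_cutoff: "continuous_on S cutoff" "continuous_on S cutoff_deriv"
  unfolding cutoff_def[abs_def] cutoff_deriv_def[abs_def] by (intro continuous_intros)+

lemma cutoff_outside: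
  fixes x :: "'a::euclidean_space"
  assumes "norm x \<le> 1 \<or> norm x \<ge> 2"
  shows "cutoff x = 0" "cutoff_deriv x = 0"
proof -
  have "(x \<bullet> x - 1) * (4 - x \<bullet> x) \<le> 0"
  proof (cases "norm x \<le> 1")
    case True
    then have "x \<bullet> x \<le> 1" by (simp add: norm_eq_sqrt_inner)
    then show ?thesis by (intro mult_nonpos_nonneg) auto
  next
    case False
    then have "sqrt (x \<bullet> x) \<ge> sqrt 4" using assms by (simp add: norm_eq_sqrt_inner)
    then have "x \<bullet> x \<ge> 4" by (simp only: real_sqrt_le_iff)
    then show ?thesis by (intro mult_nonneg_nonpos) auto
  qed
  then show "cutoff x = 0" "cutoff_deriv x = 0" by (auto simp: cutoff_def cutoff_deriv_def)
qed

section \<open>The inner product over a shell\<close>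

lemma continuous_on_UNIV_if_zero_near_0:
  fixes k :: "'a::euclidean_space \<Rightarrow> real"
  assumes "continuous_on (- {0}) k" "\<And>x. norm x < 1 \<Longrightarrow> k x = 0"
  shows "continuous_on UNIV k"
proof -
  have "continuous_on (ball 0 1) k"
    using assms(2) continuous_on_const[of "ball 0 1" 0] by (subst continuous_on_cong[of _ "ball 0 1" k "\<lambda>x. 0"]) auto
  then have "continuous_on (- {0} \<union> ball 0 1) k"
    using assms(1) by (intro continuous_on_open_Un open_nonzero open_ball)
  moreover have "- {0} \<union> ball 0 1 = (UNIV :: 'a set)" by auto
  ultimately show ?thesis by simp
qed

text \<open>In polar coordinates this is a positive multiple of the usual inner product on the
  sphere. The denominator \<open>x \<bullet> x\<close> is the one that the Laplacian of an extension
  along rays carries, so Green's identity produces exactly this integral.\<close>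

definition sphere_inner :: "('a::euclidean_space \<Rightarrow> real) \<Rightarrow> ('a \<Rightarrow> real) \<Rightarrow> real" where
  "sphere_inner f g = integral\<^sup>L lborel (\<lambda>x. cutoff x / (x \<bullet> x) * (f (sgn x) * g (sgn x)))"

lemma weighted_continuous:
  fixes k :: "'a::euclidean_space \<Rightarrow> real"
  assumes "continuous_on (- {0}) k"
  shows "continuous_on UNIV (\<lambda>x. cutoff x / (x \<bullet> x) * k x)" "integrable lborel (\<lambda>x. cutoff x / (x \<bullet> x) * k x)"
proof -
  show c: "continuous_on UNIV (\<lambda>x. cutoff x / (x \<bullet> x) * k x)"
    by (rule continuous_on_UNIV_if_zero_near_0)
      (auto intro!: continuous_intros assms continuous_on_cutoff simp: cutoff_outside)
  show "integrable lborel (\<lambda>x. cutoff x / (x \<bullet> x) * k x)"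
    by (rule integrable_continuous_bounded_support[OF c, of 2]) (simp add: cutoff_outside)
qed

lemma sphere_inner_commute: "sphere_inner f g = sphere_inner g f"
  by (simp add: sphere_inner_def mult.commute)

lemma sphere_inner_lin:
  assumes "f \<in> smooth_sphere" "g \<in> smooth_sphere" "h \<in> smooth_sphere"
  shows "sphere_inner (\<lambda>x. f x + c * g x) h = sphere_inner f h + c * sphere_inner g h"
proof -
  note C = assms[THEN smooth_sphereD(3)]
  have "sphere_inner (\<lambda>x. f x + c * g x) h = integral\<^sup>L lborel (\<lambda>x. cutoff x / (x \<bullet> x) * (f (sgn x) * h (sgn x))
      + c * (cutoff x / (x \<bullet> x) * (g (sgn x) * h (sgn x))))"
    by (simp add: sphere_inner_def algebra_simps)
  also have "\<dots> = sphere_inner f h + c * sphere_inner g h"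
    unfolding sphere_inner_def
    by (simp only: Bochner_Integration.integral_add[OF weighted_continuous(2)[OF continuous_on_mult[OF C(1,3)]]
          integrable_mult_right[OF weighted_continuous(2)[OF continuous_on_mult[OF C(2,3)]]]] integral_mult_right_zero)
  finally show ?thesis .
qed

text \<open>The integrand is continuous and nonnegative, so it vanishes almost everywhere and then
  everywhere, the set where it is nonzero being open.\<close>

lemma sphere_inner_self_eq_0:
  assumes f: "f \<in> smooth_sphere" and 0: "sphere_inner f f = 0"
  shows "f = (\<lambda>x. 0)"
proof
  fix y :: 'a
  define k where "k x = cutoff x / (x \<bullet> x) * (f (sgn x) * f (sgn x))" for x
  have c: "continuous_on UNIV k" "integrable lborel k"
    unfolding k_def by (intro weighted_continuous continuous_on_mult smooth_sphereD(3)[OF f])+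
  have nn: "k x \<ge> 0" for x by (simp add: k_def cutoff_def)
  have "AE x in lborel. k x = 0"
  proof (rule integral_nonneg_eq_0_iff_AE[OF c(2), THEN iffD1])
    show "integral\<^sup>L lborel k = 0" using 0 by (simp add: sphere_inner_def k_def[abs_def])
  qed (simp add: nn)
  then have "{x. k x \<noteq> 0} \<in> null_sets lborel"
    using AE_iff_null_sets[of "{x. k x \<noteq> 0}" lborel] borel_measurable_continuous_onI[OF c(1)] by simp
  then have "negligible {x. k x \<noteq> 0}"
    by (simp add: negligible_iff_null_sets null_sets_completionI)
  moreover have "open {x. k x \<noteq> 0}" using c(1) by (intro open_Collect_neq continuous_on_const)
  ultimately have k0: "k x = 0" for x using open_not_negligible[of "{x. k x \<noteq> 0}"] by auto
  show "f y = 0"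
  proof (cases "norm y = 1")
    case True
    \<comment> \<open>A point on the ray through \<open>y\<close> inside the shell
      \<open>1 < norm x < 2\<close>, where the cut-off is positive.\<close>
    define x where "x = (3/2) *\<^sub>R y"
    have "sgn y = y" using True by (simp add: sgn_div_norm)
    then have "sgn x = y" by (simp add: x_def sgn_scale)
    moreover have "y \<bullet> y = 1" using True by (simp add: dot_square_norm)
    then have "x \<bullet> x = 9/4" by (simp add: x_def)
    moreover from this have "x \<noteq> 0" by auto
    ultimately show ?thesis using k0[of x] by (simp add: k_def cutoff_def)
  next
    case False
    then show ?thesis using smooth_sphereD(6)[OF f, of y] by simp
  qed
qed

text \<open>Second derivatives of a function constant along rays are homogeneous of degree -2, and
  at \<open>sgn x\<close> their trace is the sphere Laplacian up to sign.\<close>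

lemma laplacian_extension:
  fixes g :: "'a::euclidean_space \<Rightarrow> real"
  assumes g: "g \<in> smooth_sphere" and x: "x \<noteq> 0"
  shows "laplacian (\<lambda>x. g (sgn x)) x = - sphere_laplacian g (sgn x) / (x \<bullet> x)"
proof -
  let ?G = "\<lambda>x. g (sgn x)"
  define t where "t = inverse (norm x)"
  have t: "t > 0" and tx: "t *\<^sub>R x = sgn x" using x by (simp_all add: t_def sgn_div_norm)
  have s0: "sgn x \<noteq> 0" using x by (simp add: sgn_zero_iff)
  have "t\<^sup>2 * partial b (partial b ?G) (sgn x) = partial b (partial b ?G) x" if b: "b \<in> Basis" for b
  proof -
    have "partial b ?G (t *\<^sub>R y) = inverse t * partial b ?G y" if "y \<noteq> 0" for y
    proof -
      have "t *\<^sub>R y \<noteq> 0" using t that by simp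
      then have "t * partial b ?G (t *\<^sub>R y) = 1 * partial b ?G y"
        using t that by (intro partial_scale) (auto simp: sgn_scale intro: smooth_sphereD(1)[OF g])
      then show ?thesis using t by (simp add: field_simps)
    qed
    then have "t * partial b (partial b ?G) (t *\<^sub>R x) = inverse t * partial b (partial b ?G) x"
      using t x by (intro partial_scale) (auto intro: smooth_sphereD(2)[OF g _ b])
    then show ?thesis unfolding tx using t by (simp add: field_simps power2_eq_square)
  qed
  then have "laplacian ?G x = t\<^sup>2 * laplacian ?G (sgn x)"
    by (simp add: laplacian_def sum_distrib_left)
  moreover have "sphere_laplacian g (sgn x) = - laplacian ?G (sgn x)"
    using sphere_laplacian_eq[OF g, of "sgn x"] x by (simp add: norm_sgn laplacian_def)
  moreover have "t\<^sup>2 = inverse (x \<bullet> x)"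
    by (simp add: t_def power_inverse power2_norm_eq_inner)
  ultimately show ?thesis by (simp add: divide_inverse)
qed

text \<open>Green's identity: \<open>h b\<close> are the components of the cut-off times
  \<open>?F * grad ?G - ?G * grad ?F\<close>, and the integral of the divergence is 0. The gradient
  of the cut-off contributes only radial derivatives, that is 0, and the Laplacians leave
  \<open>(l - m)\<close> times the inner product.\<close>

lemma sphere_eigen_orthogonal:
  fixes f g :: "'a::euclidean_space \<Rightarrow> real"
  assumes f: "f \<in> smooth_sphere" "\<And>x. sphere_laplacian f x = l * f x"
    and g: "g \<in> smooth_sphere" "\<And>x. sphere_laplacian g x = m * g x"
    and lm: "l \<noteq> m"
  shows "sphere_inner f g = 0"
proof -
  let ?F = "\<lambda>x. f (sgn x)" and ?G = "\<lambda>x. g (sgn x)"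
  define W where "W b x = ?F x * partial b ?G x - ?G x * partial b ?F x" for b x
  define h where "h b x = cutoff x * W b x" for b x
  define h' where "h' b x = cutoff x * (?F x * partial b (partial b ?G) x - ?G x * partial b (partial b ?F) x)
      + cutoff_deriv x * ((x \<bullet> b) * W b x)" for b x
  note Fd = smooth_sphereD(1)[OF f(1)] smooth_sphereD(2)[OF f(1)]
  note Gd = smooth_sphereD(1)[OF g(1)] smooth_sphereD(2)[OF g(1)]
  have hball: "h b y = 0" if "y \<in> ball 0 1" for b and y :: 'a
    using that by (simp add: h_def cutoff_outside)
  have h: "h b differentiable at x \<and> partial b (h b) x = h' b x" if b: "b \<in> Basis" for b x
  proof (cases "x = 0")
    case True
    then have "h b differentiable at x" "partial b (h b) x = partial b (\<lambda>x. 0) x"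
      using differentiable_cong[of "ball 0 1" x "h b" "\<lambda>x. 0"] partial_cong[of "ball 0 1" x "h b" "\<lambda>x. 0"] hball
      by auto
    then show ?thesis using True by (simp add: h'_def cutoff_outside)
  next
    case False
    have d1: "(\<lambda>x. ?F x * partial b ?G x) differentiable at x" "(\<lambda>x. (-1) * (?G x * partial b ?F x)) differentiable at x"
      "(\<lambda>x. ?G x * partial b ?F x) differentiable at x"
      by (intro differentiable_mult differentiable_const Fd Gd False b)+
    have W: "W b = (\<lambda>x. ?F x * partial b ?G x + (-1) * (?G x * partial b ?F x))"
      by (simp add: W_def fun_eq_iff)
    have dW: "W b differentiable at x" unfolding W by (intro differentiable_add d1)
    have pW: "partial b (W b) x = ?F x * partial b (partial b ?G) x - ?G x * partial b (partial b ?F) x"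
      unfolding W partial_add[OF d1(1,2)] partial_cmult[OF d1(3)]
        partial_mult[OF Fd(1)[OF False] Gd(2)[OF False b]] partial_mult[OF Gd(1)[OF False] Fd(2)[OF False b]]
      by (simp add: mult.commute)
    have "h b differentiable at x"
      unfolding h_def[abs_def] by (intro differentiable_mult cutoff_differentiable dW)
    moreover have "partial b (h b) x = h' b x"
      unfolding h_def[abs_def] partial_mult[OF cutoff_differentiable dW] pW partial_cutoff h'_def
      by (simp add: mult_ac)
    ultimately show ?thesis by simp
  qed
  have c: "continuous_on UNIV (h' b)" if b: "b \<in> Basis" for b
  proof (rule continuous_on_UNIV_if_zero_near_0)
    show "continuous_on (- {0}) (h' b)"
      unfolding h'_def[abs_def] W_def[abs_def]
      by (intro continuous_on_add continuous_on_mult continuous_on_diff continuous_on_inner continuous_on_id continuous_on_const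
          continuous_on_cutoff smooth_sphereD[OF f(1)] smooth_sphereD[OF g(1)] b)
  qed (simp add: h'_def cutoff_outside)
  have ph: "partial b (h b) = h' b" if "b \<in> Basis" for b using h[OF that] by (simp add: fun_eq_iff)
  have int: "integrable lborel (h' b)" "integral\<^sup>L lborel (h' b) = 0" if b: "b \<in> Basis" for b
    using integral_partial_zero[OF b, of "h b" 2] h[OF b] c[OF b] unfolding ph[OF b]
    by (auto simp: h_def cutoff_outside)
  have "(\<Sum>b\<in>Basis. h' b x) = (l - m) * (cutoff x / (x \<bullet> x) * (?F x * ?G x))" for x
  proof (cases "x = 0")
    case True
    then show ?thesis by (simp add: h'_def cutoff_outside)
  next
    case False
    have "(\<Sum>b\<in>Basis. h' b x) = cutoff x * (?F x * laplacian ?G x - ?G x * laplacian ?F x)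
      + cutoff_deriv x * (?F x * (\<Sum>b\<in>Basis. (x \<bullet> b) * partial b ?G x) - ?G x * (\<Sum>b\<in>Basis. (x \<bullet> b) * partial b ?F x))"
      by (simp add: h'_def W_def laplacian_def sum.distrib sum_subtractf sum_distrib_left right_diff_distrib mult_ac)
    then show ?thesis
      using False by (simp add: radial_derivative_zero[OF f(1)] radial_derivative_zero[OF g(1)]
          laplacian_extension[OF f(1)] laplacian_extension[OF g(1)] f(2) g(2) field_simps)
  qed
  then have "(l - m) * sphere_inner f g = integral\<^sup>L lborel (\<lambda>x. \<Sum>b\<in>Basis. h' b x)"
    by (simp only: sphere_inner_def integral_mult_right_zero)
  also have "\<dots> = (\<Sum>b\<in>(Basis::'a set). integral\<^sup>L lborel (h' b))"
    by (rule Bochner_Integration.integral_sum) (rule int)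
  also have "\<dots> = 0" by (simp add: int)
  finally show ?thesis using lm by simp
qed

section \<open>Density of polynomials on the sphere\<close>

inductive poly_sum :: "('a::euclidean_space \<Rightarrow> real) \<Rightarrow> bool" where
  poly_sum_hpoly: "hpoly k p \<Longrightarrow> poly_sum p"
| poly_sum_add: "poly_sum p \<Longrightarrow> poly_sum q \<Longrightarrow> poly_sum (\<lambda>x. p x + q x)"

lemma poly_sum_times_hpoly: "poly_sum p \<Longrightarrow> hpoly k q \<Longrightarrow> poly_sum (\<lambda>x. p x * q x)"
proof (induction rule: poly_sum.induct)
  case (poly_sum_hpoly l p)
  then show ?case using hpoly_times poly_sum.poly_sum_hpoly by blast
next
  case (poly_sum_add p q')
  then show ?case using poly_sum.poly_sum_add[of "\<lambda>x. p x * q x" "\<lambda>x. q' x * q x"] by (simp add: distrib_right)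
qed

lemma poly_sum_times: "poly_sum q \<Longrightarrow> poly_sum p \<Longrightarrow> poly_sum (\<lambda>x. p x * q x)"
proof (induction rule: poly_sum.induct)
  case (poly_sum_hpoly l q)
  then show ?case using poly_sum_times_hpoly by blast
next
  case (poly_sum_add q q')
  then show ?case using poly_sum.poly_sum_add[of "\<lambda>x. p x * q x" "\<lambda>x. p x * q' x"] by (simp add: distrib_left)
qed

lemma real_polynomial_function_poly_sum:
  fixes p :: "'a::euclidean_space \<Rightarrow> real"
  shows "real_polynomial_function p \<Longrightarrow> poly_sum p"
proof (induction rule: real_polynomial_function.induct)
  case (linear f)
  have "f = (\<lambda>x. \<Sum>b\<in>Basis. f b * (x \<bullet> b))"
  proof
    fix x
    interpret f: bounded_linear f by fact
    have "f x = f (\<Sum>b\<in>Basis. (x \<bullet> b) *\<^sub>R b)" by (simp add: euclidean_representation)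
    then show "f x = (\<Sum>b\<in>Basis. f b * (x \<bullet> b))" by (simp add: f.sum f.scaleR mult.commute)
  qed
  moreover have "hpoly 1 (\<lambda>x. \<Sum>b\<in>Basis. f b * (x \<bullet> b))"
  proof (intro hpoly_sum hpoly_cmult)
    fix b :: 'a assume "b \<in> Basis"
    from hpoly_mult[OF this hpoly_const[of 1]] show "hpoly 1 (\<lambda>x. x \<bullet> b)" by simp
  qed
  ultimately show ?case using poly_sum_hpoly by metis
next
  case (const c)
  then show ?case using poly_sum_hpoly[OF hpoly_const] .
next
  case (add f g)
  then show ?case by (intro poly_sum_add)
next
  case (mult f g)
  then show ?case using poly_sum_times by blast
qed

lemma on_sphere_add: "on_sphere (\<lambda>x. p x + q x) = (\<lambda>x. on_sphere p x + on_sphere q x)"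
  by (auto simp: on_sphere_def fun_eq_iff)

lemma poly_sum_smooth: "poly_sum p \<Longrightarrow> on_sphere p \<in> smooth_sphere"
proof (induction rule: poly_sum.induct)
  case (poly_sum_hpoly k p)
  then show ?case by (rule hpoly_smooth)
next
  case (poly_sum_add p q)
  then show ?case using smooth_sphere_lin[OF poly_sum_add.IH, of 1] by (simp add: on_sphere_add)
qed

text \<open>For a polynomial \<open>q\<close> within \<open>e\<close> of \<open>f\<close> on the
  sphere, orthogonality gives that the inner product of \<open>f\<close> with itself equals that of
  \<open>f - q\<close> with \<open>f\<close>, which is at most \<open>e * C\<close> with
  \<open>C\<close> independent of \<open>q\<close>.\<close>

lemma orthogonal_to_polynomials_eq_0:
  fixes f :: "'a::euclidean_space \<Rightarrow> real"
  assumes f: "f \<in> smooth_sphere" and orth: "\<And>k p. hpoly k p \<Longrightarrow> sphere_inner (on_sphere p) f = 0"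
  shows "f = (\<lambda>x. 0)"
proof (rule sphere_inner_self_eq_0[OF f])
  let ?F = "\<lambda>x. f (sgn x)"
  define C where "C = integral\<^sup>L lborel (\<lambda>x. cutoff x / (x \<bullet> x) * \<bar>?F x\<bar>)"
  have cF: "continuous_on (- {0}) ?F" by (rule smooth_sphereD(3)[OF f])
  have orth': "sphere_inner (on_sphere p) f = 0" if "poly_sum p" for p
    using that
  proof induction
    case (poly_sum_hpoly k p)
    then show ?case by (rule orth)
  next
    case (poly_sum_add p q)
    then show ?case
      using sphere_inner_lin[OF poly_sum_smooth[OF poly_sum_add(1)] poly_sum_smooth[OF poly_sum_add(2)] f, of 1]
      by (simp add: on_sphere_add)
  qed
  have C0: "C \<ge> 0" unfolding C_def by (intro integral_nonneg_AE AE_I2) (simp add: cutoff_def)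
  have bound: "\<bar>sphere_inner f f\<bar> \<le> e * C" if e: "e > 0" for e
  proof -
    have "continuous_on (sphere 0 1) f"
    proof -
      have "continuous_on (sphere 0 1) ?F" by (rule continuous_on_subset[OF cF]) auto
      then show ?thesis by (rule continuous_on_eq) (simp add: sgn_div_norm)
    qed
    from Stone_Weierstrass_real_polynomial_function[OF compact_sphere this e]
    obtain q where q: "real_polynomial_function q" "\<And>x. x \<in> sphere 0 1 \<Longrightarrow> \<bar>f x - q x\<bar> < e" by blast
    have ps: "poly_sum q" by (rule real_polynomial_function_poly_sum[OF q(1)])
    define g where "g = (\<lambda>x. f x + (-1) * on_sphere q x)"
    have gs: "g \<in> smooth_sphere" unfolding g_def by (intro smooth_sphere_lin f poly_sum_smooth ps)
    have "sphere_inner g f = sphere_inner f f"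
      unfolding g_def using sphere_inner_lin[OF f poly_sum_smooth[OF ps] f, of "-1"] orth'[OF ps] by simp
    moreover have "\<bar>sphere_inner g f\<bar> \<le> integral\<^sup>L lborel (\<lambda>x. e * (cutoff x / (x \<bullet> x) * \<bar>?F x\<bar>))"
      unfolding sphere_inner_def
    proof (rule order_trans[OF integral_abs_bound], rule integral_mono)
      have 1: "continuous_on (- {0}) (\<lambda>x. g (sgn x) * ?F x)"
        by (intro continuous_on_mult smooth_sphereD(3)[OF gs] cF)
      show "integrable lborel (\<lambda>x. \<bar>cutoff x / (x \<bullet> x) * (g (sgn x) * ?F x)\<bar>)"
        by (intro integrable_abs weighted_continuous(2)[OF 1])
      show "integrable lborel (\<lambda>x. e * (cutoff x / (x \<bullet> x) * \<bar>?F x\<bar>))"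
        by (intro integrable_mult_right weighted_continuous(2) continuous_on_rabs cF)
      fix x :: 'a
      show "\<bar>cutoff x / (x \<bullet> x) * (g (sgn x) * ?F x)\<bar> \<le> e * (cutoff x / (x \<bullet> x) * \<bar>?F x\<bar>)"
      proof (cases "x = 0")
        case False
        have "\<bar>g (sgn x)\<bar> \<le> e"
          using q(2)[of "sgn x"] False by (simp add: g_def on_sphere_def norm_sgn less_imp_le)
        then have "\<bar>g (sgn x)\<bar> * (cutoff x / (x \<bullet> x) * \<bar>?F x\<bar>) \<le> e * (cutoff x / (x \<bullet> x) * \<bar>?F x\<bar>)"
          by (rule mult_right_mono) (simp add: cutoff_def)
        moreover have "cutoff x \<ge> 0" by (simp add: cutoff_def)
        ultimately show ?thesis by (simp add: abs_mult mult_ac)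
      qed simp
    qed
    ultimately show ?thesis by (simp only: C_def integral_mult_right_zero)
  qed
  have "\<bar>sphere_inner f f\<bar> \<le> 0"
  proof (rule field_le_epsilon)
    fix e :: real assume e: "e > 0"
    \<comment> \<open>Dividing by \<open>C + 1\<close> rather than \<open>C\<close> covers
      \<open>C = 0\<close>.\<close>
    have "\<bar>sphere_inner f f\<bar> \<le> e / (C + 1) * C" by (rule bound) (use e C0 in simp)
    also have "\<dots> \<le> e" using e C0 by (simp add: field_simps)
    finally show "\<bar>sphere_inner f f\<bar> \<le> 0 + e" by simp
  qed
  then show "sphere_inner f f = 0" by simp
qed

section \<open>Multiplicities\<close>

interpretation fs: vector_space "\<lambda>(c::real) (f::'a::euclidean_space \<Rightarrow> real) x. c * f x"
  by (rule vector_space_fun)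

section \<open>Monomials and the dimension of the homogeneous polynomials\<close>

fun monomial :: "'a::euclidean_space list \<Rightarrow> nat list \<Rightarrow> 'a \<Rightarrow> real" where
  "monomial [] m = (\<lambda>x. 1)"
| "monomial (b # bs) m = (\<lambda>x. (x \<bullet> b) ^ hd m * monomial bs (tl m) x)"

lemma hpoly_power: "b \<in> Basis \<Longrightarrow> hpoly a (\<lambda>x. (x \<bullet> b) ^ a)"
  by (induction a) (auto intro: hpoly_const[of 1] dest: hpoly_mult)

lemma hpoly_monomial:
  "set bs \<subseteq> Basis \<Longrightarrow> length m = length bs \<Longrightarrow> hpoly (sum_list m) (monomial bs m)"
proof (induction bs arbitrary: m)
  case Nil
  then show ?case by (simp add: hpoly_const)
next
  case (Cons b bs)
  then obtain a m' where m: "m = a # m'" by (cases m) auto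
  have "hpoly (a + sum_list m') (\<lambda>x. (x \<bullet> b) ^ a * monomial bs m' x)"
    using Cons.prems Cons.IH[of m'] by (intro hpoly_times hpoly_power) (auto simp: m)
  then show ?case by (simp add: m)
qed

lemma monomial_incr:
  assumes "length m = length bs" "i < length bs"
  shows "monomial bs (m[i := Suc (m ! i)]) x = (x \<bullet> (bs ! i)) * monomial bs m x"
  using assms
proof (induction bs arbitrary: m i)
  case (Cons b bs)
  then obtain a m' where m: "m = a # m'" by (cases m) auto
  show ?case using Cons by (cases i) (auto simp: m)
qed simp

lemma sum_list_incr: "i < length m \<Longrightarrow> sum_list (m[i := Suc (m ! i)]) = Suc (sum_list m)"
proof (induction m arbitrary: i)
  case (Cons a m)
  then show ?case by (cases i) auto
qed simp

lemma monomial_shift: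
  assumes "b \<in> Basis" "set bs \<subseteq> Basis" "b \<notin> set bs"
  shows "monomial bs m (x + t *\<^sub>R b) = monomial bs m x"
  using assms(2,3)
proof (induction bs arbitrary: m)
  case (Cons c bs)
  then have "b \<bullet> c = 0" using assms(1) by (auto intro: inner_not_same_Basis)
  then show ?case using Cons by (simp add: inner_add_left)
qed simp

text \<open>Induction on the variables. Moving a point along \<open>b\<close> changes only the power
  of that coordinate, so the sum is a polynomial in the displacement; its coefficients vanish and
  are combinations of monomials in the remaining variables.\<close>

lemma monomial_coeffs_zero:
  assumes "set bs \<subseteq> Basis" "distinct bs" "finite M" "\<And>m. m \<in> M \<Longrightarrow> length m = length bs"
    and "\<And>x. (\<Sum>m\<in>M. c m * monomial bs m x) = 0" and "m \<in> M"
  shows "c m = 0"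
  using assms
proof (induction bs arbitrary: M c m)
  case Nil
  then have M: "M \<subseteq> {[]}" by auto
  then have "M = {[]}" "m = []" using Nil.prems by auto
  then show ?case using Nil.prems(5)[of 0] by simp
next
  case (Cons b bs)
  define N where "N = Max (hd ` M)"
  define Ma where "Ma a = {m'. a # m' \<in> M}" for a
  have finMa: "finite (Ma a)" for a
  proof -
    have "Ma a = Cons a -` M" by (auto simp: Ma_def)
    then show ?thesis using Cons.prems(3) by (simp add: finite_vimageI)
  qed
  have hd: "hd m \<le> N" if "m \<in> M" for m using that Cons.prems(3) by (simp add: N_def)
  have M: "M = (\<lambda>(a, m'). a # m') ` (SIGMA a:{..N}. Ma a)"
  proof (intro set_eqI iffI)
    fix m assume m: "m \<in> M"
    then obtain a m' where "m = a # m'" using Cons.prems(4)[OF m] by (cases m) auto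
    then show "m \<in> (\<lambda>(a, m'). a # m') ` (SIGMA a:{..N}. Ma a)"
      using m hd[OF m] by (force simp: Ma_def)
  qed (auto simp: Ma_def)
  have Q: "(\<Sum>m'\<in>Ma a. c (a # m') * monomial bs m' y) = 0" if a: "a \<le> N" for a y
  proof -
    \<comment> \<open>Removing the \<open>b\<close>-component makes the displacement
      \<open>t\<close> the value of that coordinate, while the other coordinates of \<open>y\<close>
      are kept.\<close>
    define x where "x = y - (y \<bullet> b) *\<^sub>R b"
    have bB: "b \<in> Basis" "b \<notin> set bs" "set bs \<subseteq> Basis" using Cons.prems by auto
    have xb: "x \<bullet> b = 0" using bB by (simp add: x_def inner_diff_left)
    have mx: "monomial bs m' (x + t *\<^sub>R b) = monomial bs m' x" for m' t
      by (rule monomial_shift[OF bB(1,3,2)])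
    have "(\<Sum>a\<le>N. (\<Sum>m'\<in>Ma a. c (a # m') * monomial bs m' x) * t ^ a) = 0" for t
    proof -
      have "0 = (\<Sum>m\<in>M. c m * monomial (b # bs) m (x + t *\<^sub>R b))" using Cons.prems(5) by simp
      also have "\<dots> = (\<Sum>(a, m')\<in>(SIGMA a:{..N}. Ma a). c (a # m') * (t ^ a * monomial bs m' x))"
        unfolding M using bB xb
        by (subst sum.reindex) (auto simp: inj_on_def inner_add_left mx intro!: sum.cong)
      also have "\<dots> = (\<Sum>a\<le>N. \<Sum>m'\<in>Ma a. c (a # m') * (t ^ a * monomial bs m' x))"
        using finMa by (subst sum.Sigma) auto
      finally show ?thesis by (simp add: sum_distrib_left sum_distrib_right mult_ac)
    qed
    then have "(\<Sum>m'\<in>Ma a. c (a # m') * monomial bs m' x) = 0"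
      using a polyfun_eq_0[of "\<lambda>a. (\<Sum>m'\<in>Ma a. c (a # m') * monomial bs m' x)" N] by blast
    moreover have "monomial bs m' y = monomial bs m' x" for m'
      using mx[of m' "y \<bullet> b"] by (simp add: x_def)
    ultimately show ?thesis by simp
  qed
  obtain a m' where m: "m = a # m'" using Cons.prems(4)[OF Cons.prems(6)] by (cases m) auto
  have "c (a # m') = 0"
  proof (rule Cons.IH[of "Ma a" "\<lambda>m'. c (a # m')" m'])
    show "(\<Sum>m'\<in>Ma a. c (a # m') * monomial bs m' x) = 0" for x
      using Q[of a x] hd[OF Cons.prems(6)] m by simp
    show "length m'' = length bs" if "m'' \<in> Ma a" for m'' using Cons.prems(4)[of "a # m''"] that by (simp add: Ma_def)
  qed (use Cons.prems m Q[of a] hd[OF Cons.prems(6)] finMa in \<open>auto simp: Ma_def\<close>)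
  then show ?case using m by simp
qed

lemma sum_fun_apply: "(\<Sum>i\<in>I. f i) x = (\<Sum>i\<in>I. f i x)"
  by (induction I rule: infinite_finite_induct) auto

definition hspace :: "nat \<Rightarrow> ('a::euclidean_space \<Rightarrow> real) set" where
  "hspace k = {on_sphere p |p. hpoly k p}"

lemma hspace_smooth: "f \<in> hspace k \<Longrightarrow> f \<in> smooth_sphere"
  by (auto simp: hspace_def hpoly_smooth)

lemma hspace_lin: "f \<in> hspace k \<Longrightarrow> g \<in> hspace k \<Longrightarrow> (\<lambda>x. f x + c * g x) \<in> hspace k"
proof -
  assume "f \<in> hspace k" "g \<in> hspace k"
  then obtain p q where p: "hpoly k p" "f = on_sphere p" and q: "hpoly k q" "g = on_sphere q"
    by (auto simp: hspace_def)
  have "hpoly k (\<lambda>x. p x + c * q x)" by (intro hpoly_add hpoly_cmult p q)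
  moreover have "on_sphere (\<lambda>x. p x + c * q x) = (\<lambda>x. f x + c * g x)"
    unfolding p q by (auto simp: on_sphere_def fun_eq_iff)
  ultimately show ?thesis unfolding hspace_def by (intro CollectI exI[of _ "\<lambda>x. p x + c * q x"]) simp
qed

lemma hspace_zero: "(\<lambda>x. 0) \<in> hspace k"
  unfolding hspace_def using hpoly_zero[of k]
  by (intro CollectI exI[of _ "\<lambda>x. 0"]) (simp add: on_sphere_def)

lemma subspaceI:
  assumes "(\<lambda>x. 0) \<in> S" "\<And>f g c. f \<in> S \<Longrightarrow> g \<in> S \<Longrightarrow> (\<lambda>x. f x + c * g x) \<in> S"
  shows "fs.subspace S"
proof -
  have "f + g \<in> S" if "f \<in> S" "g \<in> S" for f g
    using assms(2)[OF that, of 1] by (simp add: plus_fun_def)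
  moreover have "(\<lambda>x. c * f x) \<in> S" if "f \<in> S" for c f
    using assms(2)[OF assms(1) that, of c] by simp
  ultimately show ?thesis using assms(1) by (simp add: fs.subspace_def zero_fun_def)
qed

lemma hspace_subspace: "fs.subspace (hspace k)"
  by (rule subspaceI) (auto intro: hspace_zero hspace_lin)

definition exponents :: "nat \<Rightarrow> nat \<Rightarrow> nat list set" where
  "exponents N k = {m. length m = N \<and> sum_list m = k}"

lemma card_exponents: "N \<ge> 1 \<Longrightarrow> card (exponents N k) = (k + N - 1) choose k" "N \<ge> 1 \<Longrightarrow> finite (exponents N k)"
proof -
  assume N: "N \<ge> 1"
  show c: "card (exponents N k) = (k + N - 1) choose k" by (simp add: exponents_def card_length_sum_list)
  then have "card (exponents N k) > 0" using N by (simp add: zero_less_binomial_iff)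
  then show "finite (exponents N k)" by (simp add: card_gt_0_iff)
qed

lemma hpoly_in_span:
  fixes bs :: "'a::euclidean_space list"
  assumes bs: "set bs = Basis" and p: "hpoly k p"
  shows "p \<in> fs.span (monomial bs ` exponents (length bs) k)"
  using p
proof induction
  case (hpoly_const c)
  have "monomial bs (replicate (length bs) 0) = (\<lambda>x. 1)" for bs :: "'a list"
    by (induction bs) auto
  then have "(\<lambda>x. 1) \<in> monomial bs ` exponents (length bs) 0"
    by (intro image_eqI[of _ _ "replicate (length bs) 0"]) (auto simp: exponents_def sum_list_replicate)
  from fs.span_scale[OF fs.span_base[OF this], of c] show ?case by simp
next
  case (hpoly_mult b k p)
  obtain i where i: "i < length bs" "bs ! i = b" using hpoly_mult(1) bs by (metis in_set_conv_nth)
  let ?T = "fs.span (monomial bs ` exponents (length bs) (Suc k))"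
  from hpoly_mult.IH show ?case
  proof (induction rule: fs.span_induct_alt)
    case base
    then show ?case using fs.span_zero by (simp add: zero_fun_def)
  next
    case (step c f g)
    then obtain m where m: "f = monomial bs m" "m \<in> exponents (length bs) k" by auto
    have "m[i := Suc (m ! i)] \<in> exponents (length bs) (Suc k)"
      using m(2) i by (simp add: exponents_def sum_list_incr)
    moreover have "(\<lambda>x. (x \<bullet> b) * f x) = monomial bs (m[i := Suc (m ! i)])"
      using m i monomial_incr[of m bs i] by (simp add: exponents_def fun_eq_iff)
    ultimately have "(\<lambda>x. (x \<bullet> b) * f x) \<in> ?T" by (intro fs.span_base) simp
    from fs.span_add[OF fs.span_scale[OF this, of c] step(2)]
    show ?case by (simp add: plus_fun_def algebra_simps)
  qed
next
  case (hpoly_add k p q)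
  from fs.span_add[OF hpoly_add.IH] show ?case by (simp add: plus_fun_def)
qed

text \<open>Homogeneity recovers \<open>p\<close> off the origin from its values on the sphere, and
  at 0 by scaling a basis vector with factor 0. Thus restriction to the sphere loses no dimension
  within one degree.\<close>

lemma on_sphere_hpoly_zero:
  fixes p :: "'a::euclidean_space \<Rightarrow> real"
  assumes p: "hpoly k p" and 0: "on_sphere p = (\<lambda>x. 0)"
  shows "p x = 0"
proof -
  have s: "p (sgn y) = 0" if "y \<noteq> 0" for y using fun_cong[OF 0, of "sgn y"] on_sphere_sgn[OF that] by simp
  have nz: "p y = 0" if "y \<noteq> 0" for y
    using hpoly_scale[OF p, of "norm y" "sgn y"] s[OF that] that by (simp add: sgn_div_norm)
  show ?thesis
  proof (cases "x = 0")
    case True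
    obtain b :: 'a where b: "b \<in> Basis" using nonempty_Basis by blast
    then have "p b = 0" using nz[of b] nonzero_Basis by blast
    then show ?thesis using hpoly_scale[OF p, of 0 b] True by simp
  qed (rule nz)
qed

text \<open>The restricted monomials form a basis, counted by stars and bars. The finite spanning
  set is stated as well because later dimension arguments need finite bases.\<close>

lemma hspace_dim:
  shows "fs.dim (hspace k :: ('a::euclidean_space \<Rightarrow> real) set) = (k + DIM('a) - 1) choose k"
    and "\<exists>B. finite B \<and> fs.span B = (hspace k :: ('a \<Rightarrow> real) set)"
proof -
  obtain bs :: "'a list" where bs: "set bs = Basis" "distinct bs"
    using finite_distinct_list[OF finite_Basis] by blast
  then have len: "length bs = DIM('a)" using distinct_card by force
  let ?M = "exponents (length bs) k"
  have D1: "DIM('a) \<ge> 1" by (simp add: Suc_leI)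
  have finM: "finite ?M" using card_exponents(2)[of "length bs" k] D1 by (simp add: len)
  define F where "F m = on_sphere (monomial bs m)" for m
  have hm: "hpoly k (monomial bs m)" if "m \<in> ?M" for m
    using hpoly_monomial[of bs m] bs that by (simp add: exponents_def)
  have coeff: "c m = 0" if z: "(\<Sum>m\<in>?M. (\<lambda>x. c m * F m x)) = 0" and m: "m \<in> ?M" for c m
  proof (rule monomial_coeffs_zero[of bs ?M c])
    have "on_sphere (\<lambda>x. \<Sum>m\<in>?M. c m * monomial bs m x) = (\<lambda>x. 0)"
    proof
      fix x show "on_sphere (\<lambda>x. \<Sum>m\<in>?M. c m * monomial bs m x) x = 0"
        using fun_cong[OF z, of x] by (auto simp: sum_fun_apply F_def on_sphere_def)
    qed
    then show "(\<Sum>m\<in>?M. c m * monomial bs m x) = 0" for x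
      by (rule on_sphere_hpoly_zero[where k = k, rotated]) (intro hpoly_sum hpoly_cmult hm)
  qed (use bs finM m in \<open>auto simp: exponents_def\<close>)
  \<comment> \<open>Two equal restricted monomials would be a vanishing combination with
    coefficients 1 and -1. Injectivity lets the basis be counted by exponents.\<close>
  have inj: "inj_on F ?M"
  proof (rule inj_onI, rule ccontr)
    fix m m' assume mm: "m \<in> ?M" "m' \<in> ?M" "F m = F m'" "m \<noteq> m'"
    define c where "c a = (if a = m then 1 else if a = m' then -1 else 0 :: real)" for a
    have "(\<Sum>a\<in>?M. (\<lambda>x. c a * F a x)) = 0"
    proof
      fix x
      have "(\<Sum>a\<in>?M. c a * F a x) = (\<Sum>a\<in>{m, m'}. c a * F a x)"
        by (rule sum.mono_neutral_right) (use finM mm in \<open>auto simp: c_def\<close>)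
      then show "(\<Sum>a\<in>?M. (\<lambda>x. c a * F a x)) x = 0 x"
        using mm by (simp add: sum_fun_apply c_def)
    qed
    from coeff[OF this mm(1)] show False by (simp add: c_def)
  qed
  have ind: "fs.independent (F ` ?M)"
  proof (rule fs.independent_if_scalars_zero)
    show "finite (F ` ?M)" using finM by simp
    fix g f assume "(\<Sum>f\<in>F ` ?M. (\<lambda>x. g f * f x)) = 0" and "f \<in> F ` ?M"
    then show "g f = 0"
      using coeff[of "\<lambda>m. g (F m)"] by (auto simp: sum.reindex[OF inj])
  qed
  have span: "fs.span (F ` ?M) = hspace k"
  proof (rule antisym)
    show "fs.span (F ` ?M) \<subseteq> hspace k"
      by (rule fs.span_minimal[OF _ hspace_subspace]) (use hm in \<open>auto simp: F_def hspace_def\<close>)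
    show "hspace k \<subseteq> fs.span (F ` ?M)"
    proof
      fix f :: "'a \<Rightarrow> real" assume "f \<in> hspace k"
      then obtain p where p: "hpoly k p" "f = on_sphere p" by (auto simp: hspace_def)
      have "on_sphere p \<in> fs.span (F ` ?M)"
        using hpoly_in_span[OF bs(1) p(1)]
      proof (induction rule: fs.span_induct_alt)
        case base
        have "on_sphere 0 = (0 :: 'a \<Rightarrow> real)" by (auto simp: on_sphere_def fun_eq_iff)
        then show ?case using fs.span_zero by (simp only:)
      next
        case (step c q r)
        have "on_sphere ((\<lambda>x. c * q x) + r) = (\<lambda>x. c * on_sphere q x) + on_sphere r"
          by (auto simp: on_sphere_def fun_eq_iff)
        moreover have "on_sphere q \<in> fs.span (F ` ?M)"
          using step(1) by (intro fs.span_base) (auto simp: F_def)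
        then have "(\<lambda>x. c * on_sphere q x) + on_sphere r \<in> fs.span (F ` ?M)"
          by (intro fs.span_add fs.span_scale step(2))
        ultimately show ?case by (simp only:)
      qed
      then show "f \<in> fs.span (F ` ?M)" using p by simp
    qed
  qed
  show "\<exists>B. finite B \<and> fs.span B = (hspace k :: ('a \<Rightarrow> real) set)"
    using span finM by (intro exI[of _ "F ` ?M"]) simp
  have "fs.dim (hspace k :: ('a \<Rightarrow> real) set) = card (F ` ?M)"
    unfolding span[symmetric] using ind by (rule fs.dim_span_eq_card_independent)
  then show "fs.dim (hspace k :: ('a \<Rightarrow> real) set) = (k + DIM('a) - 1) choose k"
    using card_image[OF inj] card_exponents(1)[of "length bs" k] D1 by (simp add: len)
qed

text \<open>The finite spanning set \<open>G\<close> forces the bases of both summands to be finite,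
  and the trivial intersection makes their union a disjoint basis.\<close>

lemma (in vector_space) dim_direct_sum:
  assumes V: "finite G" "V \<subseteq> span G" and S: "subspace S" "S \<subseteq> V" and T: "subspace T" "T \<subseteq> V"
    and sum: "\<And>v. v \<in> V \<Longrightarrow> \<exists>s\<in>S. \<exists>t\<in>T. v = s + t" and int: "\<And>v. v \<in> S \<Longrightarrow> v \<in> T \<Longrightarrow> v = 0"
  shows "dim V = dim S + dim T"
proof -
  obtain B where B: "B \<subseteq> S" "independent B" "S \<subseteq> span B" "card B = dim S" by (rule basis_exists)
  obtain C where C: "C \<subseteq> T" "independent C" "T \<subseteq> span C" "card C = dim T" by (rule basis_exists)
  have "B \<subseteq> span G" "C \<subseteq> span G" using B(1) C(1) S(2) T(2) V(2) by auto
  then have fin: "finite B" "finite C"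
    using independent_span_bound[OF V(1) B(2)] independent_span_bound[OF V(1) C(2)] by simp_all
  have disj: "B \<inter> C = {}"
  proof (rule ccontr)
    assume "B \<inter> C \<noteq> {}"
    then obtain v where v: "v \<in> B" "v \<in> C" by blast
    then have "v = 0" using int B(1) C(1) by blast
    then show False using v(1) B(2) dependent_zero by blast
  qed
  have "independent (B \<union> C)"
  proof (rule independent_if_scalars_zero)
    show "finite (B \<union> C)" using fin by simp
    fix f v assume s: "(\<Sum>v\<in>B \<union> C. f v *s v) = 0" and v: "v \<in> B \<union> C"
    define b where "b = (\<Sum>v\<in>B. f v *s v)"
    define c where "c = (\<Sum>v\<in>C. f v *s v)"
    have bc: "b + c = 0" using s fin disj by (simp add: sum.union_disjoint b_def c_def)
    have "b \<in> S" unfolding b_def using B(1) S(1) by (intro subspace_sum subspace_scale) auto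
    have cT: "c \<in> T" unfolding c_def using C(1) T(1) by (intro subspace_sum subspace_scale) auto
    have "b = - c" using bc by (simp add: eq_neg_iff_add_eq_0)
    then have "b \<in> T" using subspace_neg[OF T(1) cT] by simp
    then have "b = 0" using int \<open>b \<in> S\<close> by blast
    then have "c = 0" using bc by simp
    have "\<forall>v\<in>B. f v = 0"
    proof -
      have "\<not> ((\<exists>v\<in>B. f v \<noteq> 0) \<and> (\<Sum>v\<in>B. f v *s v) = 0)"
        using B(2) unfolding dependent_finite[OF fin(1)] by (rule contrapos_nn) (rule exI[of _ f])
      then show ?thesis using \<open>b = 0\<close> unfolding b_def by simp
    qed
    moreover have "\<forall>v\<in>C. f v = 0"
    proof -
      have "\<not> ((\<exists>v\<in>C. f v \<noteq> 0) \<and> (\<Sum>v\<in>C. f v *s v) = 0)"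
        using C(2) unfolding dependent_finite[OF fin(2)] by (rule contrapos_nn) (rule exI[of _ f])
      then show ?thesis using \<open>c = 0\<close> unfolding c_def by simp
    qed
    ultimately show "f v = 0" using v by blast
  qed
  moreover have "V \<subseteq> span (B \<union> C)"
  proof
    fix v assume "v \<in> V"
    then obtain s t where st: "s \<in> S" "t \<in> T" "v = s + t" using sum by blast
    have "s \<in> span (B \<union> C)" using st(1) B(3) span_mono[of B "B \<union> C"] by auto
    moreover have "t \<in> span (B \<union> C)" using st(2) C(3) span_mono[of C "B \<union> C"] by auto
    ultimately show "v \<in> span (B \<union> C)" unfolding st(3) by (rule span_add)
  qed
  moreover have "B \<union> C \<subseteq> V" using B(1) C(1) S(2) T(2) by blast
  ultimately have "dim V = card (B \<union> C)" by (intro dim_unique) auto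
  then show ?thesis using card_Un_disjoint[OF fin disj] B(4) C(4) by simp
qed

text \<open>Only eigenfunctions that are restrictions of polynomials of degree \<open>k\<close>;
  \<open>sphere_eigenfunctions\<close> shows that these are all of them.\<close>

definition eig :: "nat \<Rightarrow> ('a::euclidean_space \<Rightarrow> real) set" where
  "eig k = {f \<in> hspace k. \<forall>x. sphere_laplacian f x = sphere_ev DIM('a) k * f x}"

text \<open>The case distinction guards against truncated subtraction, which would turn
  \<open>k - 2\<close> into 0 for \<open>k < 2\<close>.\<close>

definition hlow :: "nat \<Rightarrow> ('a::euclidean_space \<Rightarrow> real) set" where
  "hlow k = (if k < 2 then {\<lambda>x. 0} else hspace (k - 2))"

section \<open>Splitting off the eigenspace of degree k\<close>

lemma sphere_ev_strict_mono:
  assumes "N \<ge> 2" "i < j"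
  shows "sphere_ev N i < sphere_ev N j"
proof -
  have "real i * (real i + real N - 2) \<le> real i * (real j + real N - 2)"
    using assms by (intro mult_left_mono) auto
  also have "\<dots> < real j * (real j + real N - 2)"
    using assms by (intro mult_strict_right_mono) auto
  finally show ?thesis by (simp add: sphere_ev_def)
qed

lemma sphere_ev_eq_iff:
  assumes "N \<ge> 2"
  shows "sphere_ev N i = sphere_ev N j \<longleftrightarrow> i = j"
  using sphere_ev_strict_mono[OF assms, of i j] sphere_ev_strict_mono[OF assms, of j i]
  by (cases i j rule: linorder_cases) auto

lemma zero_smooth: "(\<lambda>x. 0) \<in> smooth_sphere"
  using hspace_smooth[OF hspace_zero] .

lemma sphere_laplacian_zero: "sphere_laplacian (\<lambda>x. 0) x = 0"
  using sphere_laplacian_lin[OF zero_smooth zero_smooth, of "-1" x] by simp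

text \<open>Multiplication by \<open>x \<bullet> x\<close> raises the degree by 2 and does not
  change values on the sphere.\<close>

lemma hlow_subset: "hlow k \<subseteq> hspace k"
proof (cases "k < 2")
  case True
  then show ?thesis by (simp add: hlow_def hspace_zero)
next
  case False
  show ?thesis
  proof
    fix f :: "'a \<Rightarrow> real" assume "f \<in> hlow k"
    then obtain p where p: "hpoly (k - 2) p" "f = on_sphere p" using False by (auto simp: hlow_def hspace_def)
    have "hpoly (1 + 1 + (k - 2)) (\<lambda>x. (x \<bullet> x) * p x)"
    proof (rule hpoly_times[OF _ p(1)])
      have "hpoly (1 + 1) (\<lambda>x::'a. \<Sum>b\<in>Basis. (x \<bullet> b) ^ 1 * (x \<bullet> b) ^ 1)"
        by (intro hpoly_sum hpoly_times hpoly_power)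
      then show "hpoly (1 + 1) (\<lambda>x::'a. x \<bullet> x)" by (simp add: euclidean_inner[symmetric])
    qed
    moreover have "1 + 1 + (k - 2) = k" using False by simp
    ultimately have "hpoly k (\<lambda>x. (x \<bullet> x) * p x)" by (simp only:)
    moreover have "on_sphere (\<lambda>x. (x \<bullet> x) * p x) = f"
      unfolding p by (auto simp: on_sphere_def fun_eq_iff dot_square_norm)
    ultimately show "f \<in> hspace k" by (auto simp: hspace_def)
  qed
qed

lemma hlow_lin: "f \<in> hlow k \<Longrightarrow> g \<in> hlow k \<Longrightarrow> (\<lambda>x. f x + c * g x) \<in> hlow k"
  by (auto simp: hlow_def hspace_lin split: if_splits)

lemma hlow_laplacian:
  assumes "hpoly k p"
  shows "on_sphere (laplacian p) \<in> hlow k"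
  using hpoly_laplacian[OF assms] by (auto simp: hlow_def hspace_def on_sphere_def)

text \<open>On \<open>g\<close> the operator acts as the nonzero scalar
  \<open>sphere_ev DIM('a) k - \<mu>\<close> up to a restriction of degree \<open>k - 2\<close>. The
  induction hypothesis supplies \<open>h\<close> cancelling that error, and scaling
  \<open>g + h\<close> by \<open>c\<close> gives the solution.\<close>

lemma hspace_resolvent:
  fixes g :: "'a::euclidean_space \<Rightarrow> real"
  assumes "g \<in> hspace k" "\<And>j. j \<le> k \<Longrightarrow> \<mu> \<noteq> sphere_ev DIM('a) j"
  shows "\<exists>h\<in>hspace k. \<forall>x. sphere_laplacian h x - \<mu> * h x = g x"
  using assms
proof (induction k arbitrary: g rule: less_induct)
  case (less k)
  obtain p where p: "hpoly k p" "g = on_sphere p" using less.prems(1) by (auto simp: hspace_def)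
  have low: "on_sphere (laplacian p) \<in> hlow k" by (rule hlow_laplacian[OF p(1)])
  obtain h where h: "h \<in> hspace k" "\<And>x. sphere_laplacian h x - \<mu> * h x = on_sphere (laplacian p) x"
  proof (cases "k < 2")
    case True
    then have "on_sphere (laplacian p) = (\<lambda>x. 0)" using low by (simp add: hlow_def)
    then show ?thesis using that[OF hspace_zero] by (simp add: sphere_laplacian_zero)
  next
    case False
    then have "on_sphere (laplacian p) \<in> hspace (k - 2)" using low by (simp add: hlow_def)
    then have "\<exists>h\<in>hspace (k - 2). \<forall>x. sphere_laplacian h x - \<mu> * h x = on_sphere (laplacian p) x"
      using False less.prems(2) by (intro less.IH) auto
    then show ?thesis using that hlow_subset[of k] False by (auto simp: hlow_def)
  qed
  have gs: "g \<in> smooth_sphere" and hs: "h \<in> smooth_sphere"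
    using hspace_smooth less.prems(1) h(1) by blast+
  define c where "c = 1 / (sphere_ev DIM('a) k - \<mu>)"
  have c: "c * (sphere_ev DIM('a) k - \<mu>) = 1" using less.prems(2)[of k] by (simp add: c_def)
  define u where "u = (\<lambda>x. g x + 1 * h x)"
  have uH: "u \<in> hspace k" unfolding u_def by (rule hspace_lin[OF less.prems(1) h(1)])
  have us: "u \<in> smooth_sphere" using uH by (rule hspace_smooth)
  have u: "sphere_laplacian u x - \<mu> * u x = (sphere_ev DIM('a) k - \<mu>) * g x" for x
    using h(2)[of x] sphere_laplacian_hpoly[OF p(1), of x] unfolding u_def sphere_laplacian_lin[OF gs hs] p(2)[symmetric]
    by (simp add: algebra_simps)
  show ?case
  proof (intro bexI allI)
    fix x
    have "sphere_laplacian (\<lambda>x. 0 + c * u x) x - \<mu> * (0 + c * u x) = c * (sphere_laplacian u x - \<mu> * u x)"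
      unfolding sphere_laplacian_lin[OF zero_smooth us] sphere_laplacian_zero by (simp add: algebra_simps)
    also have "\<dots> = g x" unfolding u mult.assoc[symmetric] c by simp
    finally show "sphere_laplacian (\<lambda>x. 0 + c * u x) x - \<mu> * (0 + c * u x) = g x" .
    show "(\<lambda>x. 0 + c * u x) \<in> hspace k" by (rule hspace_lin[OF hspace_zero uH])
  qed
qed

text \<open>The defect of \<open>f\<close> from being an eigenfunction lies in degree
  \<open>k - 2\<close>, where the sphere Laplacian minus the \<open>k\<close>-th eigenvalue is
  solvable because the lower eigenvalues differ. Adding that solution makes \<open>f\<close> an
  eigenfunction.\<close>

lemma hspace_decomposition:
  fixes f :: "'a::euclidean_space \<Rightarrow> real"
  assumes D: "DIM('a) \<ge> 2" and f: "f \<in> hspace k"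
  shows "\<exists>e\<in>eig k. \<exists>g\<in>hlow k. f = (\<lambda>x. e x + 1 * g x)"
proof -
  obtain p where p: "hpoly k p" "f = on_sphere p" using f by (auto simp: hspace_def)
  have low: "on_sphere (laplacian p) \<in> hlow k" by (rule hlow_laplacian[OF p(1)])
  obtain h where h: "h \<in> hlow k" "\<And>x. sphere_laplacian h x - sphere_ev DIM('a) k * h x = on_sphere (laplacian p) x"
  proof (cases "k < 2")
    case True
    then have "on_sphere (laplacian p) = (\<lambda>x. 0)" using low by (simp add: hlow_def)
    then show ?thesis using that[of "\<lambda>x. 0"] True by (simp add: sphere_laplacian_zero hlow_def)
  next
    case False
    then have "on_sphere (laplacian p) \<in> hspace (k - 2)" using low by (simp add: hlow_def)
    then have "\<exists>h\<in>hspace (k - 2). \<forall>x. sphere_laplacian h x - sphere_ev DIM('a) k * h x = on_sphere (laplacian p) x"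
      using False by (intro hspace_resolvent) (auto simp: sphere_ev_eq_iff[OF D])
    then show ?thesis using that False by (auto simp: hlow_def)
  qed
  have hH: "h \<in> hspace k" using h(1) hlow_subset by blast
  define e where "e = (\<lambda>x. f x + 1 * h x)"
  have eH: "e \<in> hspace k" unfolding e_def by (rule hspace_lin[OF f hH])
  have "sphere_laplacian e x = sphere_ev DIM('a) k * e x" for x
    using h(2)[of x] sphere_laplacian_hpoly[OF p(1), of x]
    unfolding e_def sphere_laplacian_lin[OF hspace_smooth[OF f] hspace_smooth[OF hH]] p(2)[symmetric]
    by (simp add: algebra_simps)
  then have "e \<in> eig k" using eH by (simp add: eig_def)
  moreover have "(\<lambda>x. 0 + (-1) * h x) \<in> hlow k"
    using hlow_lin[OF _ h(1), of "\<lambda>x. 0" "-1"] by (auto simp: hlow_def hspace_zero)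
  ultimately show ?thesis
    by (intro bexI[of _ e] bexI[of _ "\<lambda>x. 0 + (-1) * h x"]) (auto simp: e_def)
qed

lemma eig_smooth: "f \<in> eig k \<Longrightarrow> f \<in> smooth_sphere"
  by (auto simp: eig_def hspace_smooth)

lemma eig_lin:
  fixes f g :: "'a::euclidean_space \<Rightarrow> real"
  assumes "f \<in> eig k" "g \<in> eig k"
  shows "(\<lambda>x. f x + c * g x) \<in> eig k"
  using assms sphere_laplacian_lin[OF assms[THEN eig_smooth]]
  by (auto simp: eig_def algebra_simps intro: hspace_lin)

lemma eig_subspace: "fs.subspace (eig k)"
  by (rule subspaceI) (simp add: eig_def hspace_zero sphere_laplacian_zero, rule eig_lin)

lemma hlow_subspace: "fs.subspace (hlow k)"
  by (rule subspaceI) (simp add: hlow_def hspace_zero, rule hlow_lin)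

text \<open>Repeated splitting reduces \<open>g\<close> to eigenfunctions of degrees at most
  \<open>k\<close>.\<close>

lemma hspace_orthogonal:
  fixes f g :: "'a::euclidean_space \<Rightarrow> real"
  assumes D: "DIM('a) \<ge> 2" and f: "f \<in> smooth_sphere"
    and orth: "\<And>j e. j \<le> k \<Longrightarrow> e \<in> eig j \<Longrightarrow> sphere_inner e f = 0" and g: "g \<in> hspace k"
  shows "sphere_inner g f = 0"
  using orth g
proof (induction k arbitrary: g rule: less_induct)
  case (less k)
  obtain e h where eh: "e \<in> eig k" "h \<in> hlow k" "g = (\<lambda>x. e x + 1 * h x)"
    using hspace_decomposition[OF D less.prems(2)] by (elim bexE) (rule that)
  have hs: "h \<in> smooth_sphere" using eh(2) hlow_subset hspace_smooth by blast
  have "sphere_inner h f = 0"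
  proof (cases "k < 2")
    case True
    then show ?thesis using eh(2) by (simp add: hlow_def sphere_inner_def)
  next
    case False
    show ?thesis
    proof (rule less.IH[of "k - 2"])
      show "k - 2 < k" using False by simp
      show "h \<in> hspace (k - 2)" using eh(2) False by (simp add: hlow_def)
      show "sphere_inner e f = 0" if "j \<le> k - 2" "e \<in> eig j" for j e
        by (rule less.prems(1)[OF _ that(2)]) (use that(1) in linarith)
    qed
  qed
  then show ?case
    unfolding eh(3) sphere_inner_lin[OF eig_smooth[OF eh(1)] hs f] using less.prems(1)[OF _ eh(1)] by simp
qed

lemma eig_orthogonal:
  fixes f :: "'a::euclidean_space \<Rightarrow> real"
  assumes f: "f \<in> smooth_sphere" "\<And>x. sphere_laplacian f x = l * f x"
    and e: "e \<in> eig j" and l: "l \<noteq> sphere_ev DIM('a) j"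
  shows "sphere_inner e f = 0"
  by (rule sphere_eigen_orthogonal[OF eig_smooth[OF e] _ f, of "sphere_ev DIM('a) j"])
    (use e l in \<open>auto simp: eig_def\<close>)

text \<open>Such an \<open>f\<close> is orthogonal to all eigenspaces of degree at most
  \<open>k - 2\<close>, hence to all of \<open>hspace (k - 2)\<close>, to which it belongs
  itself.\<close>

lemma eig_hlow_disjoint:
  fixes f :: "'a::euclidean_space \<Rightarrow> real"
  assumes D: "DIM('a) \<ge> 2" and f: "f \<in> eig k" "f \<in> hlow k"
  shows "f = (\<lambda>x. 0)"
proof (cases "k < 2")
  case True
  then show ?thesis using f(2) by (simp add: hlow_def)
next
  case False
  have "sphere_inner f f = 0"
  proof (rule hspace_orthogonal[OF D eig_smooth[OF f(1)]])
    show "f \<in> hspace (k - 2)" using f(2) False by (simp add: hlow_def)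
    show "sphere_inner e f = 0" if "j \<le> k - 2" "e \<in> eig j" for j e
      by (rule eig_orthogonal[OF eig_smooth[OF f(1)] _ that(2)])
        (use f(1) that False in \<open>auto simp: eig_def sphere_ev_eq_iff[OF D]\<close>)
  qed
  then show ?thesis by (rule sphere_inner_self_eq_0[OF eig_smooth[OF f(1)]])
qed

text \<open>Stated as a sum to avoid subtraction of naturals; the second summand is the dimension of
  \<open>hlow k\<close>.\<close>

lemma dim_eig:
  assumes D: "DIM('a::euclidean_space) \<ge> 2"
  shows "fs.dim (eig k :: ('a \<Rightarrow> real) set) + (if k < 2 then 0 else (k - 2 + DIM('a) - 1) choose (k - 2)) =
    (k + DIM('a) - 1) choose k"
proof -
  obtain G where G: "finite G" "fs.span G = (hspace k :: ('a \<Rightarrow> real) set)" using hspace_dim(2) by blast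
  have "fs.dim (hspace k :: ('a \<Rightarrow> real) set) = fs.dim (eig k :: ('a \<Rightarrow> real) set) + fs.dim (hlow k :: ('a \<Rightarrow> real) set)"
  proof (rule fs.dim_direct_sum[OF G(1)])
    show "eig k \<subseteq> (hspace k :: ('a \<Rightarrow> real) set)" by (auto simp: eig_def)
    show "\<exists>s\<in>eig k. \<exists>t\<in>hlow k. v = s + t" if v: "v \<in> hspace k" for v :: "'a \<Rightarrow> real"
      using hspace_decomposition[OF D v] by (simp add: plus_fun_def)
    show "v = 0" if "v \<in> eig k" "v \<in> hlow k" for v :: "'a \<Rightarrow> real"
      using eig_hlow_disjoint[OF D that] by (simp add: zero_fun_def)
  qed (simp_all add: G eig_subspace hlow_subspace hlow_subset)
  moreover have "fs.dim (hlow k :: ('a \<Rightarrow> real) set) = (if k < 2 then 0 else (k - 2 + DIM('a) - 1) choose (k - 2))"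
  proof (cases "k < 2")
    case True
    have "fs.dim {0 :: 'a \<Rightarrow> real} = 0"
      using fs.dim_unique[of "{}" "{0}" 0] fs.span_zero[of "{}"] fs.independent_empty by simp
    then show ?thesis using True by (simp add: hlow_def zero_fun_def)
  qed (simp add: hlow_def hspace_dim(1))
  ultimately show ?thesis by (simp add: hspace_dim(1))
qed

section \<open>Completeness of the polynomial eigenfunctions\<close>

lemma smooth_subspace: "fs.subspace smooth_sphere"
  by (rule subspaceI) (auto intro: smooth_sphere_lin zero_smooth)

lemma span_orthogonal:
  assumes B: "B \<subseteq> smooth_sphere" and g: "g \<in> smooth_sphere" and o: "\<And>b. b \<in> B \<Longrightarrow> sphere_inner b g = 0"
    and f: "f \<in> fs.span B"
  shows "sphere_inner f g = 0"
proof -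
  have "fs.subspace {f \<in> smooth_sphere. sphere_inner f g = 0}"
    by (rule subspaceI) (auto intro: smooth_sphere_lin zero_smooth simp: sphere_inner_lin g sphere_inner_def[of "\<lambda>x. 0"])
  then have "fs.span B \<subseteq> {f \<in> smooth_sphere. sphere_inner f g = 0}"
    by (rule fs.span_minimal[rotated]) (use B o in auto)
  then show ?thesis using f by blast
qed

text \<open>One Gram-Schmidt step per vector: from the residual \<open>f'\<close> of
  \<open>f\<close> a multiple of the residual \<open>b'\<close> of the new vector is subtracted,
  which keeps it orthogonal to the earlier vectors.\<close>

lemma orthogonal_projection:
  assumes "finite B" "B \<subseteq> smooth_sphere" "f \<in> smooth_sphere"
  shows "\<exists>e\<in>fs.span B. \<forall>b\<in>B. sphere_inner b (\<lambda>x. f x + (-1) * e x) = 0"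
  using assms
proof (induction B arbitrary: f rule: finite_induct)
  case empty
  then show ?case using fs.span_zero by auto
next
  case (insert b B)
  have BS: "B \<subseteq> smooth_sphere" and bS: "b \<in> smooth_sphere" using insert.prems by auto
  have spS: "fs.span B \<subseteq> smooth_sphere" by (rule fs.span_minimal[OF BS smooth_subspace])
  obtain e where e: "e \<in> fs.span B" "\<forall>a\<in>B. sphere_inner a (\<lambda>x. f x + (-1) * e x) = 0"
    using insert.IH[OF BS insert.prems(2)] by blast
  obtain d where d: "d \<in> fs.span B" "\<forall>a\<in>B. sphere_inner a (\<lambda>x. b x + (-1) * d x) = 0"
    using insert.IH[OF BS bS] by blast
  define f' where "f' = (\<lambda>x. f x + (-1) * e x)"
  define b' where "b' = (\<lambda>x. b x + (-1) * d x)"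
  have eS: "e \<in> smooth_sphere" and dS: "d \<in> smooth_sphere" using e(1) d(1) spS by auto
  have f'S: "f' \<in> smooth_sphere" and b'S: "b' \<in> smooth_sphere"
    unfolding f'_def b'_def by (intro smooth_sphere_lin insert.prems(2) bS eS dS)+
  define c where "c = sphere_inner f' b' / sphere_inner b' b'"
  define r where "r = (\<lambda>x. f' x + (- c) * b' x)"
  have rS: "r \<in> smooth_sphere" unfolding r_def by (intro smooth_sphere_lin f'S b'S)
  have rin: "sphere_inner a r = sphere_inner a f' - c * sphere_inner a b'" if "a \<in> smooth_sphere" for a
    using sphere_inner_lin[OF f'S b'S that, of "- c"] by (simp add: r_def sphere_inner_commute[of a])
  have rB: "sphere_inner a r = 0" if "a \<in> B" for a
    using rin[of a] that BS e(2) d(2) by (auto simp: f'_def b'_def)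
  \<comment> \<open>If \<open>b\<close> already lies in the span, then \<open>b'\<close> has norm 0
    and is the zero function, so nothing needs correcting; otherwise \<open>c\<close> is the usual
    projection coefficient.\<close>
  have "sphere_inner b' r = 0"
  proof (cases "sphere_inner b' b' = 0")
    case True
    then have "b' = (\<lambda>x. 0)" by (rule sphere_inner_self_eq_0[OF b'S])
    then show ?thesis by (simp add: sphere_inner_def)
  next
    case False
    then show ?thesis using rin[OF b'S] by (simp add: c_def sphere_inner_commute[of b' f'])
  qed
  moreover have "sphere_inner d r = 0" by (rule span_orthogonal[OF BS rS rB d(1)])
  moreover have "b = (\<lambda>x. b' x + 1 * d x)" by (simp add: b'_def)
  ultimately have rb: "sphere_inner b r = 0"
    using sphere_inner_lin[OF b'S dS rS, of 1] by simp
  have sp: "fs.span B \<subseteq> fs.span (insert b B)" by (rule fs.span_mono) auto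
  have "e + (\<lambda>x. c * (b - d) x) \<in> fs.span (insert b B)"
    using e(1) d(1) sp fs.span_base[of b "insert b B"] by (intro fs.span_add fs.span_scale fs.span_diff) auto
  moreover have "(\<lambda>x. f x + (-1) * (e + (\<lambda>x. c * (b - d) x)) x) = r"
    by (simp add: r_def f'_def b'_def fun_eq_iff algebra_simps)
  ultimately show ?case using rb rB by (intro bexI[of _ "e + (\<lambda>x. c * (b - d) x)"]) (simp_all only: ball_simps simp_thms insert_iff, auto)
qed

text \<open>A smooth function orthogonal to every \<open>eig j\<close> is orthogonal to all
  polynomials, hence zero. Eigenfunctions for different eigenvalues are orthogonal, so
  \<open>f\<close> itself qualifies if \<open>l\<close> is not in the list; if \<open>l\<close> is
  the \<open>k\<close>-th number, \<open>f\<close> minus its projection to \<open>eig k\<close>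
  does.\<close>

lemma sphere_eigenfunctions:
  fixes f :: "'a::euclidean_space \<Rightarrow> real"
  assumes D: "DIM('a) \<ge> 2" and f: "f \<in> smooth_sphere" "\<And>x. sphere_laplacian f x = l * f x"
  shows "\<And>k. l = sphere_ev DIM('a) k \<Longrightarrow> f \<in> eig k"
    and "l \<notin> range (sphere_ev DIM('a)) \<Longrightarrow> f = (\<lambda>x. 0)"
proof -
  have main: "g = (\<lambda>x. 0)" if gS: "g \<in> smooth_sphere" and orth: "\<And>j e. e \<in> eig j \<Longrightarrow> sphere_inner e g = 0" for g :: "'a \<Rightarrow> real"
  proof (rule orthogonal_to_polynomials_eq_0[OF gS])
    fix k and p :: "'a \<Rightarrow> real" assume "hpoly k p"
    then have "on_sphere p \<in> hspace k" by (auto simp: hspace_def)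
    from hspace_orthogonal[OF D gS _ this] orth
    show "sphere_inner (on_sphere p) g = 0" by simp
  qed
  show "f = (\<lambda>x. 0)" if l: "l \<notin> range (sphere_ev DIM('a))"
  proof (rule main[OF f(1)])
    fix j and e :: "'a \<Rightarrow> real" assume "e \<in> eig j"
    then show "sphere_inner e f = 0" by (rule eig_orthogonal[OF f]) (use l in blast)
  qed
  show "f \<in> eig k" if l: "l = sphere_ev DIM('a) k" for k
  proof -
    obtain G where G: "finite G" "fs.span G = (hspace k :: ('a \<Rightarrow> real) set)" using hspace_dim(2) by blast
    obtain B where B: "B \<subseteq> eig k" "fs.independent B" "(eig k :: ('a \<Rightarrow> real) set) \<subseteq> fs.span B"
      by (rule fs.basis_exists) blast
    have "B \<subseteq> fs.span G" using B(1) unfolding G(2) eig_def by blast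
    then have "finite B" using fs.independent_span_bound[OF G(1) B(2)] by blast
    have BS: "B \<subseteq> smooth_sphere" using B(1) eig_smooth by blast
    obtain e where e: "e \<in> fs.span B" "\<forall>b\<in>B. sphere_inner b (\<lambda>x. f x + (-1) * e x) = 0"
      using orthogonal_projection[OF \<open>finite B\<close> BS f(1)] by blast
    have "fs.span B \<subseteq> eig k" by (rule fs.span_minimal[OF B(1) eig_subspace])
    then have ek: "e \<in> eig k" using e(1) by blast
    define g where "g = (\<lambda>x. f x + (-1) * e x)"
    have gS: "g \<in> smooth_sphere" unfolding g_def by (intro smooth_sphere_lin f(1) eig_smooth[OF ek])
    have gl: "sphere_laplacian g x = l * g x" for x
      using ek unfolding g_def sphere_laplacian_lin[OF f(1) eig_smooth[OF ek]] f(2) by (simp add: eig_def l algebra_simps)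
    have "g = (\<lambda>x. 0)"
    proof (rule main[OF gS])
      fix j and a :: "'a \<Rightarrow> real" assume a: "a \<in> eig j"
      show "sphere_inner a g = 0"
      proof (cases "j = k")
        case True
        then have "a \<in> fs.span B" using a B(3) by blast
        then show ?thesis by (rule span_orthogonal[OF BS gS, rotated]) (use e(2) in \<open>auto simp: g_def\<close>)
      next
        case False
        then show ?thesis by (intro eig_orthogonal[OF gS gl a]) (simp add: l sphere_ev_eq_iff[OF D])
      qed
    qed
    then have "f = e" by (simp add: g_def fun_eq_iff)
    then show ?thesis using ek by simp
  qed
qed

section \<open>Determinants of depth r\<close>

lemma continued_sum_reindex:
  assumes "inj_on h I"
  shows "continued_sum a (h ` I) = continued_sum (\<lambda>i. a (h i)) I"
proof -
  have "is_continued_sum a (h ` I) = is_continued_sum (\<lambda>i. a (h i)) I"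
    unfolding is_continued_sum_def fun_eq_iff by (simp add: has_sum_reindex[OF assms] o_def)
  then show ?thesis by (simp add: continued_sum_def)
qed

text \<open>\<open>P_mult n\<close> at \<open>k + n_check n\<close> is a difference of ordinary
  binomial coefficients. Positivity is included so that each number in the list really occurs as an
  eigenvalue.\<close>

lemma dim_eig_P_mult:
  assumes n: "n \<ge> 1" and D: "DIM('a::euclidean_space) = n + 1"
  shows "fs.dim (eig 0 :: ('a \<Rightarrow> real) set) = 1"
    and "k \<ge> 1 \<Longrightarrow> real (fs.dim (eig k :: ('a \<Rightarrow> real) set)) = P_mult n (real k + n_check n)"
    and "fs.dim (eig k :: ('a \<Rightarrow> real) set) > 0"
proof -
  have D2: "DIM('a) \<ge> 2" using n D by simp
  note dim = dim_eig[OF D2, unfolded D]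
  show "fs.dim (eig 0 :: ('a \<Rightarrow> real) set) = 1" using dim[of 0] by simp
  \<comment> \<open>For \<open>k = 1\<close> the missing term agrees with
    \<open>(n - 1) choose n = 0\<close>, so one formula serves all \<open>k \<ge> 1\<close>.\<close>
  have low: "(if k < 2 then 0 else (k - 2 + n) choose (k - 2)) = (k + n - 2) choose n" if k: "k \<ge> 1" for k
  proof (cases "k < 2")
    case True
    then have "k = 1" using k by simp
    then show ?thesis using n by (simp add: binomial_eq_0_iff)
  next
    case False
    then have "k + n - 2 = k - 2 + n" by simp
    then show ?thesis using False binomial_symmetric[of n "k - 2 + n"] by simp
  qed
  have sum: "fs.dim (eig k :: ('a \<Rightarrow> real) set) + ((k + n - 2) choose n) = (k + n) choose n" if k: "k \<ge> 1" for k
  proof -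
    have "k - 2 + (n + 1) - 1 = k - 2 + n" "k + (n + 1) - 1 = k + n" by simp_all
    then show ?thesis
      using dim[of k] low[OF k] binomial_symmetric[of n "k + n"] by (simp only:) simp
  qed
  show "real (fs.dim (eig k :: ('a \<Rightarrow> real) set)) = P_mult n (real k + n_check n)" if k: "k \<ge> 1"
  proof -
    have 1: "real k + n_check n + n_check n + 1 = real (k + n)" "real k + n_check n + n_check n - 1 = real (k + n - 2)"
      using n k by (simp_all add: n_check_def of_nat_diff field_simps)
    have "real (fs.dim (eig k :: ('a \<Rightarrow> real) set)) + real ((k + n - 2) choose n) = real ((k + n) choose n)"
      using sum[OF k] by (simp flip: of_nat_add)
    then show ?thesis unfolding P_mult_def 1 by (simp add: binomial_gbinomial)
  qed
  show "fs.dim (eig k :: ('a \<Rightarrow> real) set) > 0"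
  proof (cases "k = 0")
    case True
    then show ?thesis using dim[of 0] by simp
  next
    case False
    obtain j m where j: "k = Suc j" and m: "n = Suc m" using False n by (metis not0_implies_Suc One_nat_def not_less_eq_eq le0)
    have "(k + n - 2) choose n \<le> (j + n) choose n" by (rule binomial_right_mono) (use j in simp)
    also have "\<dots> < ((j + n) choose n) + ((j + n) choose m)"
      using m by (simp add: zero_less_binomial_iff)
    also have "\<dots> = (k + n) choose n" by (simp add: j m)
    finally show ?thesis using sum[of k] False by simp
  qed
qed

text \<open>Completing the square: \<open>sphere_ev (n + 1) k + (n_check n)\<^sup>2 = (k + n_check
  n)\<^sup>2\<close>. Eigenfunctions of \<open>L_op n s\<close> are those of the Laplacian with
  shifted eigenvalue.\<close>

lemma L_op_spectrum:
  fixes s :: real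
  assumes n: "n \<ge> 1" and D: "DIM('a::euclidean_space) = n + 1"
  defines "ev \<equiv> \<lambda>k. (real k + n_check n)\<^sup>2 - s\<^sup>2"
  shows "sphere_eigenvalues (L_op n s :: ('a \<Rightarrow> real) \<Rightarrow> 'a \<Rightarrow> real) = range ev"
    and "multiplicity_of (L_op n s :: ('a \<Rightarrow> real) \<Rightarrow> 'a \<Rightarrow> real) (ev k) = fs.dim (eig k :: ('a \<Rightarrow> real) set)"
    and "inj ev"
proof -
  have D2: "DIM('a) \<ge> 2" using n D by simp
  have ev: "ev k = sphere_ev DIM('a) k + ((n_check n)\<^sup>2 - s\<^sup>2)" for k
    by (simp add: ev_def sphere_ev_def D n_check_def power2_eq_square field_simps)
  show "inj ev" by (rule injI) (simp add: ev sphere_ev_eq_iff[OF D2])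
  have mem: "f \<in> sphere_eigenspace (L_op n s) l \<longleftrightarrow>
      f \<in> smooth_sphere \<and> (\<forall>x. sphere_laplacian f x = (l - ((n_check n)\<^sup>2 - s\<^sup>2)) * f x)" for f :: "'a \<Rightarrow> real" and l
    unfolding sphere_eigenspace_def L_op_def by (auto simp: algebra_simps)
  have E: "sphere_eigenspace (L_op n s) (ev k) = (eig k :: ('a \<Rightarrow> real) set)" for k
  proof (intro set_eqI iffI)
    fix f :: "'a \<Rightarrow> real" assume "f \<in> sphere_eigenspace (L_op n s) (ev k)"
    then have "f \<in> smooth_sphere" "\<And>x. sphere_laplacian f x = sphere_ev DIM('a) k * f x"
      unfolding mem by (simp_all add: ev)
    then show "f \<in> eig k" using sphere_eigenfunctions(1)[OF D2] by blast
  next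
    fix f :: "'a \<Rightarrow> real" assume "f \<in> eig k"
    then show "f \<in> sphere_eigenspace (L_op n s) (ev k)"
      unfolding mem using eig_smooth by (auto simp: ev eig_def)
  qed
  show "multiplicity_of (L_op n s :: ('a \<Rightarrow> real) \<Rightarrow> 'a \<Rightarrow> real) (ev k) = fs.dim (eig k :: ('a \<Rightarrow> real) set)"
    unfolding multiplicity_of_def E ..
  show "sphere_eigenvalues (L_op n s :: ('a \<Rightarrow> real) \<Rightarrow> 'a \<Rightarrow> real) = range ev"
  proof (intro set_eqI iffI)
    fix l assume "l \<in> sphere_eigenvalues (L_op n s :: ('a \<Rightarrow> real) \<Rightarrow> 'a \<Rightarrow> real)"
    then obtain f :: "'a \<Rightarrow> real" where f: "f \<in> sphere_eigenspace (L_op n s) l" "f \<noteq> (\<lambda>x. 0)"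
      by (auto simp: sphere_eigenvalues_def)
    then have "l - ((n_check n)\<^sup>2 - s\<^sup>2) \<in> range (sphere_ev DIM('a))"
      using sphere_eigenfunctions(2)[OF D2, of f "l - ((n_check n)\<^sup>2 - s\<^sup>2)"] unfolding mem by blast
    then obtain k where "l - ((n_check n)\<^sup>2 - s\<^sup>2) = sphere_ev DIM('a) k" by blast
    then have "l = ev k" by (simp add: ev)
    then show "l \<in> range ev" by blast
  next
    fix l assume "l \<in> range ev"
    then obtain k where l: "l = ev k" by blast
    \<comment> \<open>Otherwise the empty set would span \<open>eig k\<close>, whose dimension is
      positive.\<close>
    have "\<exists>f\<in>eig k. f \<noteq> (\<lambda>x::'a. 0)"
    proof (rule ccontr)
      assume "\<not> ?thesis"
      then have "(eig k :: ('a \<Rightarrow> real) set) \<subseteq> fs.span {}" by (auto simp: zero_fun_def)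
      then have "fs.dim (eig k :: ('a \<Rightarrow> real) set) \<le> card ({} :: ('a \<Rightarrow> real) set)" by (rule fs.dim_le_card) simp
      then show False using dim_eig_P_mult(3)[OF n D, of k] by simp
    qed
    then show "l \<in> sphere_eigenvalues (L_op n s :: ('a \<Rightarrow> real) \<Rightarrow> 'a \<Rightarrow> real)"
      unfolding sphere_eigenvalues_def l by (simp add: E)
  qed
qed

text \<open>The sum over positive eigenvalues becomes a sum over their indices, since distinct
  indices give distinct eigenvalues.\<close>

lemma Det_L_op:
  assumes n: "n \<ge> 1" and r: "r \<ge> 1" and D: "DIM('a::euclidean_space) = n + 1"
    and s: "s \<in> {- n_check n - 1 <..< n_check n + 1}"
  shows "Det r (L_op n s :: ('a \<Rightarrow> real) \<Rightarrow> 'a \<Rightarrow> real) =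
          of_real (if \<bar>s\<bar> < n_check n
                   then ((n_check n)\<^sup>2 - s\<^sup>2) powr (((n_check n)\<^sup>2 - s\<^sup>2) ^ (r - 1)) else 1)
          * of_real (exp (f_poly n r s))
          * (\<Prod>l=1..2*r+n-2.
               (multiple_gamma l (of_real (xi_plus n s)) * multiple_gamma l (of_real (xi_minus n s)))
                 powr of_real (beta_poly n r s l))"
proof -
  define ev where "ev = (\<lambda>k. (real k + n_check n)\<^sup>2 - s\<^sup>2)"
  define mult where "mult k = fs.dim (eig k :: ('a \<Rightarrow> real) set)" for k
  note spec = L_op_spectrum[OF n D, of s, folded ev_def]
  have m: "multiplicity_of (L_op n s :: ('a \<Rightarrow> real) \<Rightarrow> 'a \<Rightarrow> real) (ev k) = mult k" for k
    using L_op_spectrum(2)[OF n D, of s k] by (simp add: ev_def mult_def)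
  have "{l \<in> sphere_eigenvalues (L_op n s :: ('a \<Rightarrow> real) \<Rightarrow> 'a \<Rightarrow> real). l > 0} = ev ` {k. ev k > 0}"
    unfolding spec(1) by auto
  moreover have "inj_on ev {k. ev k > 0}" using spec(3) by (rule inj_on_subset) simp
  ultimately have "spectral_zeta (L_op n s :: ('a \<Rightarrow> real) \<Rightarrow> 'a \<Rightarrow> real) =
      continued_sum (\<lambda>k w. of_nat (mult k) * of_real (ev k) powr (- w)) {k. ev k > 0}"
    unfolding spectral_zeta_def by (simp only: continued_sum_reindex m)
  then show ?thesis
    unfolding Det_def ev_def
    by (simp only: exp_deriv_spectral_sum[OF n r s dim_eig_P_mult(1,2)[OF n D, folded mult_def]])
qed

theorem theorem4p4:
  fixes n r :: nat
  assumes "n \<ge> 1" and "r \<ge> 1" and "DIM('a::euclidean_space) = n + 1"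
  shows
    "(\<forall>s \<in> {- n_check n - 1 <..< n_check n + 1}.
        Det r (L_op n s :: ('a \<Rightarrow> real) \<Rightarrow> 'a \<Rightarrow> real) =
          of_real (if \<bar>s\<bar> < n_check n
                   then ((n_check n)\<^sup>2 - s\<^sup>2) powr (((n_check n)\<^sup>2 - s\<^sup>2) ^ (r - 1)) else 1)
          * of_real (exp (f_poly n r s))
          * (\<Prod>l=1..2*r+n-2.
               (multiple_gamma l (of_real (xi_plus n s)) * multiple_gamma l (of_real (xi_minus n s)))
                 powr of_real (beta_poly n r s l)))
     \<and> Det r (sphere_laplacian :: ('a \<Rightarrow> real) \<Rightarrow> 'a \<Rightarrow> real) =
          of_real (exp (f_poly n r (n_check n)))
          * (\<Prod>l=1..2*r+n-2.
               (multiple_gamma l (of_nat n) * multiple_gamma l 1)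
                 powr of_real (beta_poly n r (n_check n) l))
     \<and> Det r (Y_op n :: ('a \<Rightarrow> real) \<Rightarrow> 'a \<Rightarrow> real) =
          of_real (if n \<ge> 3
                   then (real n * (real n - 2) / 4) powr ((real n * (real n - 2) / 4) ^ (r - 1))
                   else 1)
          * of_real (exp (f_poly n r (1/2)))
          * (\<Prod>l=1..2*r+n-2.
               (multiple_gamma l (of_nat n / 2 + 1) * multiple_gamma l (of_nat n / 2))
                 powr of_real (beta_poly n r (1/2) l))"
proof (intro conjI ballI, goal_cases)
  note det = Det_L_op[OF assms]
  case (1 s)
  then show ?case by (rule det)
next
  note det = Det_L_op[OF assms]
  have nc: "n_check n \<ge> 0" using assms(1) by (simp add: n_check_def)
  case 2
  have L: "sphere_laplacian = (L_op n (n_check n) :: ('a \<Rightarrow> real) \<Rightarrow> 'a \<Rightarrow> real)"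
    by (simp add: L_op_def fun_eq_iff)
  have p: "of_real (xi_plus n (n_check n)) = (of_nat n :: complex)"
  proof -
    have "xi_plus n (n_check n) = real n" by (simp add: xi_plus_def n_check_def field_simps)
    then show ?thesis by simp
  qed
  have m: "of_real (xi_minus n (n_check n)) = (1 :: complex)" by (simp add: xi_minus_def)
  \<comment> \<open>At \<open>s = n_check n\<close> the strict inequality in the prefactor fails:
    the eigenvalue number 0 is 0 and is not counted.\<close>
  have "n_check n \<in> {- n_check n - 1 <..< n_check n + 1}" using nc by auto
  from det[OF this, folded L, unfolded p m]
  show ?case using nc by simp
next
  case 3
  note det = Det_L_op[OF assms]
  have nc: "n_check n \<ge> 0" using assms(1) by (simp add: n_check_def)
  have q: "(n_check n)\<^sup>2 - (1/2)\<^sup>2 = real n * (real n - 2) / 4"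
    by (simp add: n_check_def power2_eq_square field_simps)
  have L: "Y_op n = (L_op n (1/2) :: ('a \<Rightarrow> real) \<Rightarrow> 'a \<Rightarrow> real)"
    unfolding L_op_def[abs_def] Y_op_def[abs_def] q ..
  have p: "of_real (xi_plus n (1/2)) = (of_nat n / 2 + 1 :: complex)"
  proof -
    have "xi_plus n (1/2) = real n / 2 + 1" by (simp add: xi_plus_def n_check_def field_simps)
    then show ?thesis by simp
  qed
  have m: "of_real (xi_minus n (1/2)) = (of_nat n / 2 :: complex)"
  proof -
    have "xi_minus n (1/2) = real n / 2" by (simp add: xi_minus_def n_check_def field_simps)
    from arg_cong[OF this, of complex_of_real] show ?thesis by simp
  qed
  \<comment> \<open>For \<open>n = 1\<close> and \<open>n = 2\<close> the eigenvalue number 0 is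
    -1/4 and 0, so it does not enter the zeta function.\<close>
  have c: "\<bar>1/2\<bar> < n_check n \<longleftrightarrow> n \<ge> 3" by (auto simp: n_check_def)
  have "1/2 \<in> {- n_check n - 1 <..< n_check n + 1}" using nc by auto
  from det[OF this, folded L, unfolded p m c q]
  show ?case .
qed

end
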